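(* Let $C$ be a plane quartic curve defined over $\mathbb{F}_2$. Then $C$ is isomorphic, over an algebraic closure of $\mathbb{F}_2$, to the invariant curve $I_4=0$ if and only if $C$ is the zero locus of the form $$ \det\left( \begin{pmatrix} X \\ Y \\ Z \end{pmatrix},\; P\begin{pmatrix} X^2 \\ Y^2 \\ Z^2 \end{pmatrix},\; P^3\begin{pmatrix} X^8 \\ Y^8 \\ Z^8 \end{pmatrix} \right) \Big/ \det\left( \begin{pmatrix} X \\ Y \\ Z \end{pmatrix},\; P\begin{pmatrix} X^2 \\ Y^2 \\ Z^2 \end{pmatrix},\; P^2\begin{pmatrix} X^4 \\ Y^4 \\ Z^4 \end{pmatrix} \right) $$ for some $P \in PSL(3,2)$ (each determinant being that of the $3\times 3$ matrix with the three indicated columns). Moreover, for such a curve $C$ with matrix $P$: (1) The rational automorphisms of $C$ (those defined over $\mathbb{F}_2$) are given by the elements of $PSL(3,2)$ that commute with $P$. (2) The action of the Frobenius on the bitangents of $C$ is given by the matrix $R = P^t$, where $R\in PSL(3,2)$ is the matrix associated to $C$ as defined in the context. (3) The tangent to $C$ at the point $(x,y,z)$ has intersection divisor with $C$ equal to $$ 2\,(x,y,z) + (x^2,y^2,z^2)\,P^t + (x^8,y^8,z^8)\,(P^t)^3 . $$ In particular, $P \in PSL(3,2)$ is determined by the generic tangent of the curve.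
   Context: $PSL(3,2)=GL(3,\mathbb{F}_2)$ is the group of invertible $3\times 3$ matrices over $\mathbb{F}_2$, of order 168. The superscript $t$ denotes transpose. Points of $\mathbb{P}^2$ are over an algebraic closure of $\mathbb{F}_2$ and are written in homogeneous coordinates, as columns or as row vectors; a matrix $M$ acts on columns by left multiplication, equivalently on row vectors by right multiplication by $M^t$. The form $I_4\in\mathbb{F}_2[X,Y,Z]$ is the quartic $$I_4=\det\begin{pmatrix} X&X^2&X^8\\ Y&Y^2&Y^8\\ Z&Z^2&Z^8\end{pmatrix}\Big/\det\begin{pmatrix} X&X^2&X^4\\ Y&Y^2&Y^4\\ Z&Z^2&Z^4\end{pmatrix}$$ $$= X^4+Y^4+Z^4+X^2Y^2+Y^2Z^2+Z^2X^2+X^2YZ+XY^2Z+XYZ^2.$$ It is invariant under $PSL(3,2)$, and $PSL(3,2)$ is the full automorphism group of the curve $I_4=0$. This curve has exactly seven bitangents, namely the seven lines of $\mathbb{P}^2$ defined over $\mathbb{F}_2$. It is isomorphic over an algebraic extension of $\mathbb{F}_2$ to the Klein curve $X^3Y+Y^3Z+Z^3X=0$. The matrix $R$: to a quartic curve over $\mathbb{F}_2$ with seven bitangents one associates the unique $R\in PSL(3,2)$ such that the action of $R$ on the bitangents agrees with the action of the Frobenius automorphism: $(a^2,b^2,c^2)^t=R\,(a,b,c)^t$ for each bitangent $aX+bY+cZ=0$. Here the coefficient vectors $(a,b,c)$ of the seven bitangents (defined over some extension of $\mathbb{F}_2$) are chosen such that together with the zero vector they are closed under addition and such that the Frobenius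 action is given by an element of $PSL(3,2)$. *)

theory Defs
  imports
    "HOL-Analysis.Analysis"
    "HOL-Algebra.Algebraic_Closure_Type"
    "HOL-Library.Poly_Mapping"
    "HOL-Library.Z2"
begin

unbundle no fps_syntax

text \<open>
  The field with two elements is \<^typ>\<open>bit\<close>, and \<^typ>\<open>bit alg_closure\<close> is an algebraic closure
  of it, with embedding \<^const>\<open>to_ac\<close>.  For matrices, powers are written out with \<open>**\<close>, because
  the operations \<open>*\<close> and \<open>^\<close> on \<^typ>\<open>bit^3^3\<close> act entrywise.
\<close>

type_synonym F2bar = "bit alg_closure"

text \<open>Over \<^typ>\<open>bit\<close> the only nonzero scalar is \<open>1\<close>, so that \<open>PSL(3,2) = GL(3,2)\<close>.\<close>

definition PSL32 :: "(bit^3^3) set" where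
  "PSL32 = {A. invertible A}"

abbreviation mat_ac :: "bit^3^3 \<Rightarrow> F2bar^3^3" where
  "mat_ac \<equiv> map_matrix to_ac"

definition vpow :: "nat \<Rightarrow> 'a::monoid_mult^3 \<Rightarrow> 'a^3" where
  "vpow n v = (\<chi> i. v $ i ^ n)"

type_synonym 'a mpoly3 = "(3 \<Rightarrow>\<^sub>0 nat) \<Rightarrow>\<^sub>0 'a"

definition Const :: "'a::zero \<Rightarrow> 'a mpoly3" where
  "Const c = Poly_Mapping.single 0 c"

definition Var :: "3 \<Rightarrow> 'a::zero_neq_one mpoly3" where
  "Var i = Poly_Mapping.single (Poly_Mapping.single i 1) 1"

definition homogeneous :: "nat \<Rightarrow> 'a::zero mpoly3 \<Rightarrow> bool" where
  "homogeneous d F \<longleftrightarrow> (\<forall>m\<in>Poly_Mapping.keys F. (\<Sum>i\<in>UNIV. Poly_Mapping.lookup m i) = d)"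

definition eval :: "'a::comm_semiring_1 mpoly3 \<Rightarrow> 'a^3 \<Rightarrow> 'a" where
  "eval F v = (\<Sum>m\<in>Poly_Mapping.keys F.
     Poly_Mapping.lookup F m * (\<Prod>i\<in>UNIV. v $ i ^ Poly_Mapping.lookup m i))"

definition partial :: "3 \<Rightarrow> 'a::comm_semiring_1 mpoly3 \<Rightarrow> 'a mpoly3" where
  "partial i F = (\<Sum>m\<in>Poly_Mapping.keys F.
     Poly_Mapping.single (m - Poly_Mapping.single i 1)
       (of_nat (Poly_Mapping.lookup m i) * Poly_Mapping.lookup F m))"

definition gradient :: "'a::comm_semiring_1 mpoly3 \<Rightarrow> 'a^3 \<Rightarrow> 'a^3" where
  "gradient F v = (\<chi> i. eval (partial i F) v)"

definition extend_scalars :: "bit mpoly3 \<Rightarrow> F2bar mpoly3" where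
  "extend_scalars F = Poly_Mapping.map to_ac F"

definition proportional :: "'a::field^3 \<Rightarrow> 'a^3 \<Rightarrow> bool" where
  "proportional u v \<longleftrightarrow> u \<noteq> 0 \<and> v \<noteq> 0 \<and> (\<exists>c. v = c *s u)"

text \<open>Points are classes of nonzero vectors; the class \<^term>\<open>point 0\<close> is unspecified.\<close>

quotient_type (overloaded) 'a proj2 = "'a::field^3" / partial: proportional
  morphisms coords point
proof (rule part_equivpI)
  have "proportional (axis 1 1 :: 'a^3) (axis 1 1)"
    unfolding proportional_def by (auto simp: axis_eq_0_iff intro!: exI[of _ 1])
  then show "\<exists>v :: 'a^3. proportional v v" ..
  show "symp (proportional :: 'a^3 \<Rightarrow> _)"
  proof (rule sympI)
    fix u v :: "'a^3"
    assume "proportional u v"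
    then obtain c where c: "u \<noteq> 0" "v \<noteq> 0" "v = c *s u"
      unfolding proportional_def by blast
    then have "c \<noteq> 0" by auto
    then have "u = inverse c *s v" by (simp add: c vec.scale_scale)
    then show "proportional v u"
      unfolding proportional_def using c(1,2) by blast
  qed
  show "transp (proportional :: 'a^3 \<Rightarrow> _)"
    by (rule transpI) (auto simp: proportional_def vec.scale_scale)
qed

text \<open>A line is given by the point of the dual plane formed by its coefficients.\<close>

definition lin_form :: "'a::field^3 \<Rightarrow> 'a^3 \<Rightarrow> 'a" where
  "lin_form l v = (\<Sum>i\<in>UNIV. l $ i * v $ i)"

definition incident :: "'a::field proj2 \<Rightarrow> 'a proj2 \<Rightarrow> bool" where
  "incident L p \<longleftrightarrow> lin_form (coords L) (coords p) = 0"

definition zero_locus :: "'a::field mpoly3 \<Rightarrow> 'a proj2 set" where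
  "zero_locus F = {point v | v. v \<noteq> 0 \<and> eval F v = 0}"

definition curve :: "bit mpoly3 \<Rightarrow> F2bar proj2 set" where
  "curve F = zero_locus (extend_scalars F)"

definition proj_map :: "'a::field^3^3 \<Rightarrow> 'a proj2 \<Rightarrow> 'a proj2" where
  "proj_map A p = point (A *v coords p)"

definition form_over :: "'a::zero set \<Rightarrow> nat \<Rightarrow> 'a mpoly3 \<Rightarrow> bool" where
  "form_over K d F \<longleftrightarrow> homogeneous d F \<and> (\<forall>m. Poly_Mapping.lookup F m \<in> K)"

text \<open>
  \<open>\<phi>\<close> is a morphism of projective varieties defined over the subfield \<open>K\<close>: every point of \<open>C\<close> has a
  (principal) Zariski neighbourhood \<open>g \<noteq> 0\<close> on which \<open>\<phi>\<close> is given by three forms of the same degree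
  without common zero, all coefficients being in \<open>K\<close>.
\<close>

definition morphism_over ::
  "'a::field set \<Rightarrow> 'a proj2 set \<Rightarrow> 'a proj2 set \<Rightarrow> ('a proj2 \<Rightarrow> 'a proj2) \<Rightarrow> bool" where
  "morphism_over K C D \<phi> \<longleftrightarrow> \<phi> ` C \<subseteq> D \<and>
     (\<forall>p\<in>C. \<exists>e g d f. form_over K e g \<and> (\<forall>i::3. form_over K d (f i)) \<and> p \<notin> zero_locus g \<and>
        (\<forall>v. v \<noteq> 0 \<and> point v \<in> C \<and> eval g v \<noteq> 0 \<longrightarrow>
           (\<chi> i. eval (f i) v) \<noteq> 0 \<and> \<phi> (point v) = point (\<chi> i. eval (f i) v)))"

definition isomorphism_over ::
  "'a::field set \<Rightarrow> 'a proj2 set \<Rightarrow> 'a proj2 set \<Rightarrow> ('a proj2 \<Rightarrow> 'a proj2) \<Rightarrow> bool" where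
  "isomorphism_over K C D \<phi> \<longleftrightarrow>
     bij_betw \<phi> C D \<and> morphism_over K C D \<phi> \<and> morphism_over K D C (inv_into C \<phi>)"

definition isomorphic_curves :: "F2bar proj2 set \<Rightarrow> F2bar proj2 set \<Rightarrow> bool" where
  "isomorphic_curves C D \<longleftrightarrow> (\<exists>\<phi>. isomorphism_over UNIV C D \<phi>)"

text \<open>
  Automorphisms are maps on \<open>C\<close> only; \<^const>\<open>extensional\<close> fixes their values off \<open>C\<close>, so that
  equality of functions is equality of automorphisms.
\<close>

definition rational_automorphisms :: "F2bar proj2 set \<Rightarrow> (F2bar proj2 \<Rightarrow> F2bar proj2) set" where
  "rational_automorphisms C = {\<phi> \<in> extensional C. isomorphism_over (range to_ac) C C \<phi>}"

definition restrict_line :: "'a::field mpoly3 \<Rightarrow> 'a^3 \<Rightarrow> 'a^3 \<Rightarrow> 'a poly" where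
  "restrict_line F u w = eval (Poly_Mapping.map (\<lambda>c. [:c:]) F) (\<chi> i. [:u $ i, w $ i:])"

text \<open>
  The multiplicity at a point \<open>u\<close> of \<open>L\<close> is the order of vanishing at \<open>t = 0\<close> of \<open>F(u + t w)\<close>, where
  \<open>w\<close> is any other point of \<open>L\<close>; it is meaningful only if \<open>F\<close> does not vanish on all of \<open>L\<close>.
\<close>

definition line_mult :: "'a::field mpoly3 \<Rightarrow> 'a proj2 \<Rightarrow> 'a proj2 \<Rightarrow> nat" where
  "line_mult F L p = (if incident L p
     then Polynomial.order 0 (restrict_line F (coords p)
            (coords (SOME q. incident L q \<and> q \<noteq> p)))
     else 0)"

text \<open>Effective divisors are represented by finite multisets of points.\<close>

definition is_intersection_divisor ::
  "'a::field mpoly3 \<Rightarrow> 'a proj2 \<Rightarrow> 'a proj2 multiset \<Rightarrow> bool" where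
  "is_intersection_divisor F L D \<longleftrightarrow>
     \<not> {p. incident L p} \<subseteq> zero_locus F \<and> (\<forall>p. count D p = line_mult F L p)"

definition tangent_divisor ::
  "'a::field mpoly3 \<Rightarrow> 'a^3 \<Rightarrow> 'a proj2 multiset \<Rightarrow> bool" where
  "tangent_divisor F v D \<longleftrightarrow>
     gradient F v \<noteq> 0 \<and> is_intersection_divisor F (point (gradient F v)) D"

text \<open>The points of contact may coincide (hyperflex lines).\<close>

definition bitangents :: "'a::field mpoly3 \<Rightarrow> 'a proj2 set" where
  "bitangents F = {L. \<exists>p q. is_intersection_divisor F L {#p, p, q, q#}}"

text \<open>
  \<open>V\<close> is one choice of a coefficient vector for every bitangent such that \<open>V\<close> together with \<open>0\<close> is
  closed under addition; the bijection says that every bitangent is represented exactly once.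
\<close>

definition bitangent_coefficients :: "bit mpoly3 \<Rightarrow> (F2bar^3) set \<Rightarrow> bool" where
  "bitangent_coefficients F V \<longleftrightarrow>
     0 \<notin> V \<and> bij_betw point V (bitangents (extend_scalars F)) \<and>
     (\<forall>a\<in>insert 0 V. \<forall>b\<in>insert 0 V. a + b \<in> insert 0 V)"

definition frobenius_matrix :: "bit mpoly3 \<Rightarrow> bit^3^3 \<Rightarrow> bool" where
  "frobenius_matrix F R \<longleftrightarrow> card (bitangents (extend_scalars F)) = 7 \<and> R \<in> PSL32 \<and>
     (\<exists>V. bitangent_coefficients F V \<and> (\<forall>a\<in>V. vpow 2 a = mat_ac R *v a))"

definition I4 :: "bit mpoly3" where
  "I4 = (let x = Var 1; y = Var 2; z = Var 3 in
     x^4 + y^4 + z^4 + x^2 * y^2 + y^2 * z^2 + z^2 * x^2 + x^2 * y * z + x * y^2 * z + x * y * z^2)"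

definition det_cols :: "'a::comm_ring_1^3 \<Rightarrow> 'a^3 \<Rightarrow> 'a^3 \<Rightarrow> 'a" where
  "det_cols a b c = det (transpose (vector [a, b, c] :: 'a^3^3))"

definition var_powers :: "nat \<Rightarrow> bit mpoly3^3" where
  "var_powers n = vpow n (\<chi> i. Var i)"

definition numer_form :: "bit^3^3 \<Rightarrow> bit mpoly3" where
  "numer_form P = det_cols (var_powers 1) (map_matrix Const P *v var_powers 2)
     (map_matrix Const (P ** P ** P) *v var_powers 8)"

definition denom_form :: "bit^3^3 \<Rightarrow> bit mpoly3" where
  "denom_form P = det_cols (var_powers 1) (map_matrix Const P *v var_powers 2)
     (map_matrix Const (P ** P) *v var_powers 4)"

definition quotient_form :: "bit^3^3 \<Rightarrow> bit mpoly3" where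
  "quotient_form P = (THE G. G * denom_form P = numer_form P)"

text \<open>
  The divisor \<open>2 (x,y,z) + (x\<^sup>2,y\<^sup>2,z\<^sup>2) P\<^sup>t + (x\<^sup>8,y\<^sup>8,z\<^sup>8) (P\<^sup>t)\<^sup>3\<close> for \<open>v = (x,y,z)\<close>, in row vectors.
\<close>

definition power_divisor :: "bit^3^3 \<Rightarrow> F2bar^3 \<Rightarrow> F2bar proj2 multiset" where
  "power_divisor P v = (let Q = mat_ac (transpose P) in
     {#point v, point v, point (vpow 2 v v* Q), point (vpow 8 v v* (Q ** Q ** Q))#})"

end

theory Submission
  imports Defs
begin

text \<open>
  The tangent of \<open>I\<^sub>4 = 0\<close> at \<open>v\<close> is spanned by \<open>v\<close> and \<open>v\<^sup>2\<close> (entrywise), because the gradient of \<open>I\<^sub>4\<close> is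
  \<open>v \<times> v\<^sup>2\<close>.  By Lang's theorem every \<open>P\<close> admits an invertible \<open>A\<close> with \<open>P A\<^sup>\<sigma> = A\<close>, where \<open>\<sigma>\<close> squares the
  entries.  The quotient of determinants is then \<open>I\<^sub>4\<close> composed with \<open>A\<^sup>-\<^sup>1\<close>, and \<open>x \<mapsto> P x\<^sup>2\<close> corresponds
  under \<open>A\<close> to squaring on \<open>I\<^sub>4 = 0\<close>; this gives the tangents, the bitangents and one direction of the
  equivalence.

  For the other direction and for the automorphisms, an isomorphism of \<open>I\<^sub>4 = 0\<close> onto a plane quartic
  \<open>G = 0\<close> has to be shown linear.  If it is given locally by forms \<open>f\<close>, and \<open>f'\<close> is the derivative of \<open>f\<close>
  along \<open>v\<^sup>2\<close>, then \<open>f \<times> f' = k grad G(f)\<close> for a scalar function \<open>k\<close>.  The product \<open>k f\<close> does not depend on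
  the choice of \<open>f\<close>, hence is regular of degree \<open>1\<close>, and regular functions are forms (an elementary
  substitute for the canonical embedding).  If the quartic is \<open>A(I\<^sub>4 = 0)\<close> and is defined over \<open>\<F>\<^sub>2\<close>, then
  \<open>A\<^sup>-\<^sup>1 A\<^sup>\<sigma>\<close> preserves \<open>I\<^sub>4 = 0\<close> and, comparing tangents, is a multiple of a matrix over \<open>\<F>\<^sub>2\<close>.
\<close>

text \<open>Differentiation along \<open>v^2\<close> takes the place of the sheaf of differentials:
  it is defined on the coordinate ring of \<open>I4 = 0\<close> because \<open>v^2\<close> is a
  tangent direction, and it raises degrees by one. If \<open>f\<close> has degree \<open>d\<close>
  and \<open>G\<close> has degree \<open>c\<close>, then \<open>k\<close> has degree
  \<open>2d + 1 - (c - 1)d = (3 - c)d + 1\<close>. For \<open>c = 4\<close> this is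
  \<open>1 - d\<close>, which explains the degree 1 of \<open>k f\<close>. The given equation of the
  target is an obstacle: it is just some nonzero quartic, possibly reducible or with multiple
  factors. So \<open>G\<close> has to be a form of least degree vanishing on the image, and
  \<open>c = 4\<close> as well as the smoothness of \<open>G = 0\<close> at the image points must be
  proved. The common algebraic tool is elimination from a point off the curve. If an irreducible
  form does not divide another form, then some combination of the two is a product of lines through
  that point. This yields irreducibility of the curves, the Nullstellensatz for them, and
  denominators of regular functions that can be cancelled line by line.\<close>

no_notation fps_nth (infixl \<open>$\<close> 75)
hide_const (open) Polynomials.degree Coset.order Divisibility.irreducible up_ring.coeff up_ring.monom module.smult

section \<open>Forms as polynomial functions\<close>

text \<open>Forms are functions that carry a degree, so that substitution and restriction to lines
  need no polynomial algebra. The zero function has every degree. \<open>form_eval\<close> and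
  \<open>form_imp_eval\<close> give the passage to formal polynomials.\<close>

inductive form :: "nat \<Rightarrow> ('a::comm_ring_1^3 \<Rightarrow> 'a) \<Rightarrow> bool" where
  form_const: "form 0 (\<lambda>v. c)"
| form_coord: "form 1 (\<lambda>v. v $ i)"
| form_add: "form n f \<Longrightarrow> form n g \<Longrightarrow> form n (\<lambda>v. f v + g v)"
| form_mult: "form m f \<Longrightarrow> form n g \<Longrightarrow> form (m + n) (\<lambda>v. f v * g v)"

lemma form_cong: "form n f \<Longrightarrow> n = m \<Longrightarrow> (\<And>v. f v = g v) \<Longrightarrow> form m g"
  by (metis ext)

lemma form_cmult: "form n f \<Longrightarrow> form n (\<lambda>v. c * f v)"
  using form_mult[OF form_const] by force

lemma form_power: "form n f \<Longrightarrow> form (n * k) (\<lambda>v. f v ^ k)"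
proof (induction k)
  case 0 then show ?case using form_const[of 1] by simp
next
  case (Suc k)
  then show ?case by (auto intro: form_cong[OF form_mult[OF Suc.prems Suc.IH]])
qed

lemma form_zero: "form n (\<lambda>v. 0)"
  by (rule form_cong[OF form_mult[OF form_const[of 0] form_power[OF form_coord, of n 1]]]) auto

lemma form_uminus: "form n f \<Longrightarrow> form n (\<lambda>v. - f v)"
  using form_cmult[of n f "-1"] by simp

lemma form_diff: "form n f \<Longrightarrow> form n g \<Longrightarrow> form n (\<lambda>v. f v - g v)"
  using form_add[OF _ form_uminus, of n f g] by simp

lemma form_sum: "(\<And>i. i \<in> A \<Longrightarrow> form n (f i)) \<Longrightarrow> form n (\<lambda>v. \<Sum>i\<in>A. f i v)"
  by (induction A rule: infinite_finite_induct) (auto intro: form_zero form_add)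

lemma form_lin: "form 1 (\<lambda>v. lin_form l v)"
  unfolding lin_form_def by (intro form_sum form_cmult form_coord)

lemma form_compose:
  assumes "form n a" and "\<And>i. form d (\<lambda>v. f v $ i)"
  shows "form (n * d) (\<lambda>v. a (f v))"
  using assms(1)
proof induction
  case (form_mult m a n b)
  then show ?case by (auto simp: add_mult_distrib intro: form.form_mult)
qed (use assms(2) in \<open>auto intro: form.intros\<close>)

lemma form_mv: "form 1 (\<lambda>v. (A *v v) $ i)"
  unfolding matrix_vector_mult_def by (simp del: One_nat_def, intro form_sum form_cmult form_coord)

lemma form_compose_matrix: "form n a \<Longrightarrow> form n (\<lambda>v. a (A *v v))"
  using form_compose[of n a 1 "\<lambda>v. A *v v", OF _ form_mv] by simp

lemma form_homog:
  assumes "form n f" shows "f (c *s v) = c ^ n * f v"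
  using assms by induction (auto simp: algebra_simps power_add)

lemma form_at_0: "form n f \<Longrightarrow> 0 < n \<Longrightarrow> f 0 = 0"
  using form_homog[of n f 0 0] by (simp add: power_0_left)

lemma lin_form_add: "lin_form l (u + v) = lin_form l u + lin_form l v"
  by (simp add: lin_form_def algebra_simps sum.distrib)
lemma lin_form_diff: "lin_form l (u - v) = lin_form l u - lin_form l v"
  by (simp add: lin_form_def algebra_simps sum_subtractf)
lemma lin_form_scale: "lin_form l (c *s v) = c * lin_form l v"
  by (simp add: lin_form_def sum_distrib_left algebra_simps)
lemma lin_form_add_left: "lin_form (l + m) v = lin_form l v + lin_form m v"
  by (simp add: lin_form_def algebra_simps sum.distrib)
lemma lin_form_scale_left: "lin_form (c *s l) v = c * lin_form l v"
  by (simp add: lin_form_def sum_distrib_left algebra_simps)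
lemma lin_form_0 [simp]: "lin_form l 0 = 0" "lin_form 0 l = 0"
  by (simp_all add: lin_form_def)
lemma lin_form_commute: "lin_form l v = lin_form v l"
  by (simp add: lin_form_def mult.commute)
lemma lin_form_axis: "lin_form l (axis i 1) = l $ i" "lin_form (axis i 1) l = l $ i"
  by (simp_all add: lin_form_def axis_def if_distrib if_distribR cong: if_cong)
lemmas lin_form_simps = lin_form_add lin_form_diff lin_form_scale lin_form_add_left
  lin_form_scale_left lin_form_0

lemma lin_form_eqI: "(\<And>v. lin_form l v = lin_form m v) \<Longrightarrow> l = m"
  by (metis lin_form_axis(1) vec_eq_iff)

lemma lin_form_normalise:
  assumes "l \<noteq> 0" obtains u where "lin_form l u = 1"
proof -
  from assms obtain i where "l $ i \<noteq> 0" by (auto simp: vec_eq_iff)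
  then have "lin_form l ((1 / l $ i) *s axis i 1) = 1" by (simp only: lin_form_scale lin_form_axis) simp
  then show ?thesis using that by blast
qed

lemma form_line:
  assumes "form n f" shows "\<exists>p. degree p \<le> n \<and> (\<forall>t. poly p t = f (v + t *s w))"
  using assms
proof induction
  case (form_const c) show ?case by (intro exI[of _ "[:c:]"]) auto
next
  case (form_coord i) show ?case by (intro exI[of _ "[:v $ i, w $ i:]"]) (auto simp: algebra_simps)
next
  case (form_add n f g)
  then obtain p q where "degree p \<le> n" "degree q \<le> n" "\<forall>t. poly p t = f (v + t *s w)"
    "\<forall>t. poly q t = g (v + t *s w)" by blast
  then show ?case by (intro exI[of _ "p + q"]) (auto intro: degree_add_le)
next
  case (form_mult m f n g)
  then obtain p q where "degree p \<le> m" "degree q \<le> n" "\<forall>t. poly p t = f (v + t *s w)"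
    "\<forall>t. poly q t = g (v + t *s w)" by blast
  then show ?case
    by (intro exI[of _ "p * q"]) (auto intro!: order_trans[OF degree_mult_le] add_mono)
qed

lemma poly_eq_infinite:
  fixes p q :: "'a::field poly"
  assumes "infinite (UNIV :: 'a set)" and "\<And>t. t \<noteq> c \<Longrightarrow> poly p t = poly q t"
  shows "p = q"
proof (rule ccontr)
  assume "p \<noteq> q"
  then have "finite {t. poly (p - q) t = 0}" by (intro poly_roots_finite) auto
  moreover have "UNIV \<subseteq> insert c {t. poly (p - q) t = 0}" using assms(2) by auto
  ultimately show False using assms(1) by (meson finite.insertI finite_subset)
qed

lemma infinite_alg_closed: "infinite (UNIV :: 'a::alg_closed_field set)"
proof
  assume fin: "finite (UNIV :: 'a set)"
  define p :: "'a poly" where "p = 1 + (\<Prod>a\<in>UNIV. [:- a, 1:])"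
  have "degree (\<Prod>a\<in>(UNIV :: 'a set). [:- a, 1:]) = card (UNIV :: 'a set)"
    by (subst degree_prod_eq_sum_degree) (use fin in auto)
  moreover have "card (UNIV :: 'a set) > 0" using fin by (simp add: card_gt_0_iff)
  ultimately have "degree p > 0" unfolding p_def by (subst degree_add_eq_right) auto
  then obtain x where "poly p x = 0" using alg_closed_imp_poly_has_root by blast
  moreover have "(\<Prod>a\<in>UNIV. x - a) = 0" using fin by (intro prod_zero) auto
  ultimately show False by (simp add: p_def poly_prod)
qed

text \<open>Restrict both factors to the line joining a point where one is nonzero to a point where
  the other is: a product of nonzero univariate polynomials is nonzero.\<close>

lemma form_mult_zero:
  fixes f g :: "'a::field^3 \<Rightarrow> 'a"
  assumes inf: "infinite (UNIV :: 'a set)" and f: "form m f" and g: "form n g"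
    and 0: "\<And>v. f v * g v = 0"
  shows "(\<forall>v. f v = 0) \<or> (\<forall>v. g v = 0)"
proof (rule ccontr)
  assume "\<not> ?thesis"
  then obtain v w where vw: "f v \<noteq> 0" "g w \<noteq> 0" by blast
  obtain p where p: "\<forall>t. poly p t = f (v + t *s (w - v))" using form_line[OF f] by blast
  obtain q where q: "\<forall>t. poly q t = g (v + t *s (w - v))" using form_line[OF g] by blast
  have "p * q = 0" by (rule poly_eq_infinite[OF inf]) (auto simp: p q 0)
  then have "p = 0 \<or> q = 0" by simp
  then show False using p[rule_format, of 0] q[rule_format, of 1] vw by auto
qed

subsection \<open>Gradients\<close>

text \<open>The gradient is characterized by the linear Taylor coefficient along every line, which
  makes sense for functions in any characteristic. Over an infinite field
  \<open>taylor_unique\<close> makes the choice harmless.\<close>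

definition grad :: "('a::field^3 \<Rightarrow> 'a) \<Rightarrow> 'a^3 \<Rightarrow> 'a^3" where
  "grad f = (SOME g. \<forall>v w. \<exists>R. \<forall>t. f (v + t *s w) = f v + t * lin_form (g v) w + t^2 * poly R t)"

lemma taylor_unique:
  fixes a :: "'a::field"
  assumes inf: "infinite (UNIV :: 'a set)"
    and "\<And>t. f t = a + t * b + t^2 * poly R t" and "\<And>t. f t = a + t * c + t^2 * poly S t"
  shows "b = c"
proof -
  have "[:a, b:] + monom 1 2 * R = [:a, c:] + monom 1 2 * S"
    by (rule poly_eq_infinite[OF inf])
       (use assms(2,3) in \<open>simp add: poly_monom algebra_simps\<close>)
  then have "coeff ([:a, b:] + monom 1 2 * R) 1 = coeff ([:a, c:] + monom 1 2 * S) 1" by simp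
  then show ?thesis by (simp add: coeff_monom_mult)
qed

text \<open>The clause for \<open>n = 0\<close> compensates truncated subtraction: the gradient of a
  constant is recorded with degree \<open>0 - 1 = 0\<close>, and the product rule reaches degree
  \<open>m + n - 1\<close> only if this gradient is known to be zero.\<close>

lemma form_taylor:
  assumes "form n (f :: 'a::field^3 \<Rightarrow> 'a)"
  shows "\<exists>g. (\<forall>i. form (n - 1) (\<lambda>v. g v $ i)) \<and> (n = 0 \<longrightarrow> (\<forall>v. g v = 0)) \<and>
    (\<forall>v w. \<exists>R. \<forall>t. f (v + t *s w) = f v + t * lin_form (g v) w + t^2 * poly R t)"
  using assms
proof induction
  case (form_const c)
  show ?case by (intro exI[of _ "\<lambda>v. 0"]) (auto simp: form_zero intro: exI[of _ 0])
next
  case (form_coord i)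
  have "form 0 (\<lambda>v::'a^3. (axis i 1 :: 'a^3) $ j)" for j by (rule form_const)
  then show ?case
    by (intro exI[of _ "\<lambda>v. axis i 1"]) (auto simp: lin_form_axis algebra_simps intro: exI[of _ 0])
next
  case (form_add n f g)
  then obtain f' g' where
    f': "\<forall>i. form (n - 1) (\<lambda>v. f' v $ i)" "n = 0 \<longrightarrow> (\<forall>v. f' v = 0)"
      "\<forall>v w. \<exists>R. \<forall>t. f (v + t *s w) = f v + t * lin_form (f' v) w + t^2 * poly R t" and
    g': "\<forall>i. form (n - 1) (\<lambda>v. g' v $ i)" "n = 0 \<longrightarrow> (\<forall>v. g' v = 0)"
      "\<forall>v w. \<exists>R. \<forall>t. g (v + t *s w) = g v + t * lin_form (g' v) w + t^2 * poly R t" by blast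
  show ?case
  proof (intro exI[of _ "\<lambda>v. f' v + g' v"] conjI allI impI)
    fix v w
    obtain R S where "\<forall>t. f (v + t *s w) = f v + t * lin_form (f' v) w + t^2 * poly R t"
      "\<forall>t. g (v + t *s w) = g v + t * lin_form (g' v) w + t^2 * poly S t" using f' g' by meson
    then show "\<exists>R. \<forall>t. f (v + t *s w) + g (v + t *s w) =
        f v + g v + t * lin_form (f' v + g' v) w + t\<^sup>2 * poly R t"
      by (intro exI[of _ "R + S"]) (auto simp: algebra_simps lin_form_add_left)
  qed (use f' g' in \<open>auto intro: form.form_add\<close>)
next
  case (form_mult m f n g)
  then obtain f' g' where
    f': "\<forall>i. form (m - 1) (\<lambda>v. f' v $ i)" "m = 0 \<longrightarrow> (\<forall>v. f' v = 0)"
      "\<forall>v w. \<exists>R. \<forall>t. f (v + t *s w) = f v + t * lin_form (f' v) w + t^2 * poly R t" and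
    g': "\<forall>i. form (n - 1) (\<lambda>v. g' v $ i)" "n = 0 \<longrightarrow> (\<forall>v. g' v = 0)"
      "\<forall>v w. \<exists>R. \<forall>t. g (v + t *s w) = g v + t * lin_form (g' v) w + t^2 * poly R t" by blast
  show ?case
  proof (intro exI[of _ "\<lambda>v. f v *s g' v + g v *s f' v"] conjI allI impI)
    fix i
    have "form (m + n - 1) (\<lambda>v. f v * g' v $ i)"
      using form.form_mult[OF form_mult.hyps(1) g'(1)[rule_format, of i]] g'(2)
      by (cases "n = 0") (auto simp: form_zero)
    moreover have "form (m + n - 1) (\<lambda>v. g v * f' v $ i)"
      using form.form_mult[OF form_mult.hyps(2) f'(1)[rule_format, of i]] f'(2)
      by (cases "m = 0") (auto simp: form_zero add.commute)
    ultimately show "form (m + n - 1) (\<lambda>v. (f v *s g' v + g v *s f' v) $ i)"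
      by (simp add: form.form_add)
  next
    fix v w
    obtain R S where R: "\<And>t. f (v + t *s w) = f v + t * lin_form (f' v) w + t^2 * poly R t"
      and S: "\<And>t. g (v + t *s w) = g v + t * lin_form (g' v) w + t^2 * poly S t" using f' g' by meson
    define a b where "a = lin_form (f' v) w" and "b = lin_form (g' v) w"
    show "\<exists>R. \<forall>t. f (v + t *s w) * g (v + t *s w) =
        f v * g v + t * lin_form (f v *s g' v + g v *s f' v) w + t\<^sup>2 * poly R t"
      by (intro exI[of _ "smult (f v) S + smult (g v) R + [:a * b:] + pCons 0 (smult a S + smult b R)
            + monom 1 2 * (R * S)"])
         (simp add: R S lin_form_simps a_def[symmetric] b_def[symmetric] poly_monom algebra_simps
           power2_eq_square)
  qed (use f' g' in auto)
qed

context
  assumes inf: "infinite (UNIV :: 'a::field set)"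
begin
no_notation fps_nth (infixl \<open>$\<close> 75)

lemma grad_props:
  assumes "form n (f :: 'a^3 \<Rightarrow> 'a)"
  shows grad_form: "form (n - 1) (\<lambda>v. grad f v $ i)"
    and grad_taylor: "\<exists>R. \<forall>t. f (v + t *s w) = f v + t * lin_form (grad f v) w + t^2 * poly R t"
proof -
  obtain g where g: "\<forall>i. form (n - 1) (\<lambda>v. g v $ i)"
    "\<forall>v w. \<exists>R. \<forall>t. f (v + t *s w) = f v + t * lin_form (g v) w + t^2 * poly R t"
    using form_taylor[OF assms] by blast
  have *: "\<forall>v w. \<exists>R. \<forall>t. f (v + t *s w) = f v + t * lin_form (grad f v) w + t^2 * poly R t"
    unfolding grad_def by (rule someI[of "\<lambda>g. \<forall>v w. \<exists>R. \<forall>t. f (v + t *s w) =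
      f v + t * lin_form (g v) w + t^2 * poly R t", OF g(2)])
  have "lin_form (grad f v) w = lin_form (g v) w" for v w
  proof -
    obtain R S where "\<forall>t. f (v + t *s w) = f v + t * lin_form (grad f v) w + t^2 * poly R t"
      "\<forall>t. f (v + t *s w) = f v + t * lin_form (g v) w + t^2 * poly S t" using * g(2) by meson
    then show ?thesis by (metis taylor_unique[OF inf, where f = "\<lambda>t. f (v + t *s w)"])
  qed
  then have "grad f = g" by (intro ext lin_form_eqI)
  then show "form (n - 1) (\<lambda>v. grad f v $ i)" using g(1) by simp
  show "\<exists>R. \<forall>t. f (v + t *s w) = f v + t * lin_form (grad f v) w + t^2 * poly R t" using * by blast
qed

lemma grad_eqI:
  assumes "form n (f :: 'a^3 \<Rightarrow> 'a)"
    and "\<And>t. f (v + t *s w) = f v + t * d + t^2 * poly R t"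
  shows "lin_form (grad f v) w = d"
  using grad_taylor[OF assms(1), of v w] assms(2)
  by (metis taylor_unique[OF inf, where f = "\<lambda>t. f (v + t *s w)"])

lemma grad_const: "lin_form (grad (\<lambda>v::'a^3. c) v) w = 0"
  by (rule grad_eqI[OF form_const, where R = 0]) simp

lemma grad_lin: "lin_form (grad (\<lambda>v::'a^3. lin_form l v) v) w = lin_form l w"
  by (rule grad_eqI[OF form_lin, where R = 0]) (simp add: lin_form_simps)

lemma grad_coord: "lin_form (grad (\<lambda>v::'a^3. v $ i) v) w = w $ i"
  by (rule grad_eqI[OF form_coord, where R = 0]) simp

lemma grad_add:
  assumes "form n (f :: 'a^3 \<Rightarrow> 'a)" "form n g"
  shows "lin_form (grad (\<lambda>v. f v + g v) v) w = lin_form (grad f v) w + lin_form (grad g v) w"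
proof -
  obtain R S where R: "\<And>t. f (v + t *s w) = f v + t * lin_form (grad f v) w + t^2 * poly R t"
    and S: "\<And>t. g (v + t *s w) = g v + t * lin_form (grad g v) w + t^2 * poly S t"
    using grad_taylor[OF assms(1)] grad_taylor[OF assms(2)] by meson
  show ?thesis
    by (rule grad_eqI[OF form_add[OF assms], where R = "R + S"]) (simp add: R S algebra_simps)
qed

lemma grad_mult:
  assumes "form m (f :: 'a^3 \<Rightarrow> 'a)" "form n g"
  shows "lin_form (grad (\<lambda>v. f v * g v) v) w =
    f v * lin_form (grad g v) w + g v * lin_form (grad f v) w"
proof -
  obtain R S where R: "\<And>t. f (v + t *s w) = f v + t * lin_form (grad f v) w + t^2 * poly R t"
    and S: "\<And>t. g (v + t *s w) = g v + t * lin_form (grad g v) w + t^2 * poly S t"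
    using grad_taylor[OF assms(1)] grad_taylor[OF assms(2)] by meson
  define a b where "a = lin_form (grad f v) w" and "b = lin_form (grad g v) w"
  show ?thesis
    by (rule grad_eqI[OF form_mult[OF assms], where R = "smult (f v) S + smult (g v) R + [:a * b:]
            + pCons 0 (smult a S + smult b R) + monom 1 2 * (R * S)"])
       (simp add: R S a_def[symmetric] b_def[symmetric] poly_monom algebra_simps power2_eq_square)
qed

lemma grad_cmult:
  assumes "form n (f :: 'a^3 \<Rightarrow> 'a)"
  shows "lin_form (grad (\<lambda>v. c * f v) v) w = c * lin_form (grad f v) w"
  using grad_mult[OF form_const assms, of c] grad_const[of c] by simp

lemma grad_diff:
  assumes "form n (f :: 'a^3 \<Rightarrow> 'a)" "form n g"
  shows "lin_form (grad (\<lambda>v. f v - g v) v) w = lin_form (grad f v) w - lin_form (grad g v) w"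
  using grad_add[OF assms(1) form_cmult[OF assms(2), of "-1"]] grad_cmult[OF assms(2), of "-1"]
  by simp

text \<open>This is the Jacobian matrix of \<open>f\<close> at \<open>v\<close> applied to the
  direction \<open>w\<close>; the direction of interest is \<open>sq v\<close>.\<close>

definition jac :: "('a^3 \<Rightarrow> 'a^3) \<Rightarrow> 'a^3 \<Rightarrow> 'a^3 \<Rightarrow> 'a^3" where
  "jac f v w = (\<chi> i. lin_form (grad (\<lambda>v. f v $ i) v) w)"

lemma grad_compose:
  assumes "form n (a :: 'a^3 \<Rightarrow> 'a)" and f: "\<And>i. form d (\<lambda>v. f v $ i)"
  shows "lin_form (grad (\<lambda>v. a (f v)) v) w = lin_form (grad a (f v)) (jac f v w)"
  using assms(1)
proof induction
  case (form_const c) show ?case by (simp add: grad_const)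
next
  case (form_coord i) show ?case by (simp add: grad_coord jac_def)
next
  case (form_add n a b)
  then show ?case
    by (simp add: grad_add[OF form_add.hyps]
        grad_add[OF form_compose[OF form_add.hyps(1) f] form_compose[OF form_add.hyps(2) f]])
next
  case (form_mult m a n b)
  then show ?case
    by (simp add: grad_mult[OF form_mult.hyps]
        grad_mult[OF form_compose[OF form_mult.hyps(1) f] form_compose[OF form_mult.hyps(2) f]])
qed

lemma grad_euler:
  assumes "form n (f :: 'a^3 \<Rightarrow> 'a)" shows "lin_form (grad f v) v = of_nat n * f v"
  using assms
proof induction
  case (form_const c) show ?case by (simp add: grad_const)
next
  case (form_coord i) show ?case by (simp add: grad_coord)
next
  case (form_add n f g) then show ?case by (simp add: grad_add[OF form_add.hyps] algebra_simps)
next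
  case (form_mult m f n g) then show ?case by (simp add: grad_mult[OF form_mult.hyps] algebra_simps)
qed

lemma jac_euler:
  assumes f: "\<And>i. form d (\<lambda>v::'a^3. f v $ i)" shows "jac f v v = of_nat d *s f v"
  by (simp add: vec_eq_iff jac_def grad_euler[OF f])

lemma jac_scale: "jac f v (c *s w) = c *s jac f v w"
  by (simp add: vec_eq_iff jac_def lin_form_simps)

end

subsection \<open>Division by a linear form\<close>

text \<open>Moving \<open>v\<close> by \<open>l(v)\<close> along \<open>u\<close> changes
  \<open>f\<close> by a multiple of \<open>l(v)\<close>; products follow from
  \<open>a b - a' b' = (a - a') b + a' (b - b')\<close>. If \<open>l(u) = 1\<close>, the moved point
  lies on the line \<open>l = 0\<close>, which gives division by \<open>l\<close>.\<close>

lemma form_project: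
  assumes "form n f"
  shows "\<exists>g. form (n - 1) g \<and> (n = 0 \<longrightarrow> (\<forall>v. g v = 0)) \<and>
    (\<forall>v. f v = f (v - lin_form l v *s u) + lin_form l v * g v)"
  using assms
proof induction
  case (form_const c) show ?case by (intro exI[of _ "\<lambda>v. 0"]) (auto intro: form_zero)
next
  case (form_coord i) show ?case by (intro exI[of _ "\<lambda>v. u $ i"]) (auto intro: form.form_const)
next
  case (form_add n a b)
  then obtain f g where f: "form (n - 1) f" "n = 0 \<longrightarrow> (\<forall>v. f v = 0)"
    and f2: "\<And>v. a v = a (v - lin_form l v *s u) + lin_form l v * f v"
    and g: "form (n - 1) g" "n = 0 \<longrightarrow> (\<forall>v. g v = 0)"
    and g2: "\<And>v. b v = b (v - lin_form l v *s u) + lin_form l v * g v" by blast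
  show ?case
  proof (intro exI conjI allI)
    fix v show "a v + b v = a (v - lin_form l v *s u) + b (v - lin_form l v *s u) +
        lin_form l v * (f v + g v)"
      by (subst f2, subst g2) (simp only: distrib_left add_ac)
  qed (use f g in \<open>auto intro: form.form_add\<close>)
next
  case (form_mult m a n b)
  then obtain f g where f: "form (m - 1) f" "m = 0 \<longrightarrow> (\<forall>v. f v = 0)"
    and f2: "\<And>v. a v = a (v - lin_form l v *s u) + lin_form l v * f v"
    and g: "form (n - 1) g" "n = 0 \<longrightarrow> (\<forall>v. g v = 0)"
    and g2: "\<And>v. b v = b (v - lin_form l v *s u) + lin_form l v * g v" by blast
  have pr: "form 1 (\<lambda>v. (v - lin_form l v *s u) $ i)" for i
    using form_diff[OF form_coord form_cmult[OF form_lin[of l], of "u $ i"]]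
    by (simp add: mult.commute)
  have "form (m + n - 1) (\<lambda>v. f v * b v)"
    using form.form_mult[OF f(1) form_mult.hyps(2)] f(2) by (cases m) (auto simp: form_zero)
  moreover have "form (m + n - 1) (\<lambda>v. a (v - lin_form l v *s u) * g v)"
    using form.form_mult[OF form_compose[OF form_mult.hyps(1) pr] g(1)] g(2)
    by (cases n) (auto simp: form_zero)
  ultimately have h: "form (m + n - 1) (\<lambda>v. f v * b v + a (v - lin_form l v *s u) * g v)"
    by (rule form.form_add)
  show ?case
  proof (intro exI conjI, rule h)
    show "\<forall>v. a v * b v = a (v - lin_form l v *s u) * b (v - lin_form l v *s u) +
        lin_form l v * (f v * b v + a (v - lin_form l v *s u) * g v)"
    proof
      fix v show "a v * b v = a (v - lin_form l v *s u) * b (v - lin_form l v *s u) +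
        lin_form l v * (f v * b v + a (v - lin_form l v *s u) * g v)"
        using f2[of v] g2[of v] by (simp only: ring_distribs) (simp only: ac_simps)
    qed
  qed (use f g in auto)
qed

lemma form_lin_dvd:
  fixes f :: "'a::field^3 \<Rightarrow> 'a"
  assumes f: "form n f" and l: "l \<noteq> 0" and 0: "\<And>v. lin_form l v = 0 \<Longrightarrow> f v = 0"
  shows "\<exists>g. form (n - 1) g \<and> (n = 0 \<longrightarrow> (\<forall>v. g v = 0)) \<and> (\<forall>v. f v = lin_form l v * g v)"
proof -
  obtain u where u: "lin_form l u = 1" using lin_form_normalise[OF l] .
  then have "f (v - lin_form l v *s u) = 0" for v by (intro 0) (simp add: lin_form_simps)
  then show ?thesis using form_project[OF f, of l u] by auto
qed

text \<open>Projection along \<open>u\<close> onto the line pulls both forms back to forms on the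
  whole space, where \<open>form_mult_zero\<close> applies.\<close>

lemma form_mult_zero_on_line:
  fixes f g :: "'a::field^3 \<Rightarrow> 'a"
  assumes inf: "infinite (UNIV :: 'a set)" and f: "form m f" and g: "form n g" and l: "l \<noteq> 0"
    and 0: "\<And>v. lin_form l v = 0 \<Longrightarrow> f v * g v = 0"
  shows "(\<forall>v. lin_form l v = 0 \<longrightarrow> f v = 0) \<or> (\<forall>v. lin_form l v = 0 \<longrightarrow> g v = 0)"
proof -
  obtain u where u: "lin_form l u = 1" using lin_form_normalise[OF l] .
  let ?p = "\<lambda>v. v - lin_form l v *s u"
  have pr: "form 1 (\<lambda>v. ?p v $ i)" for i
    using form_diff[OF form_coord form_cmult[OF form_lin[of l], of "u $ i"]]
    by (simp add: mult.commute)
  have "f (?p v) * g (?p v) = 0" for v by (rule 0) (simp add: lin_form_simps u)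
  from form_mult_zero[OF inf form_compose[OF f pr] form_compose[OF g pr] this]
  show ?thesis by (metis diff_zero vector_smult_lzero)
qed

section \<open>Divisibility of forms\<close>

instance alg_closure :: (field) field_gcd ..

lemma lin_form_diff_left: "lin_form (l - m) v = lin_form l v - lin_form m v"
  by (simp add: lin_form_def algebra_simps sum_subtractf)

lemma form_linpow: "form k (\<lambda>v. lin_form l v ^ k)"
  by (rule form_cong[OF form_power[OF form_lin]]) auto

text \<open>A movable coordinate system. The distinguished vector is \<open>ey\<close>: first a
  centre of projection on the line at infinity \<open>lz = 0\<close>, later a point of the curve
  with tangent \<open>lz = 0\<close>.\<close>

locale frame =
  fixes ex ey ez lx ly lz :: "'a::{alg_closed_field, field_gcd}^3"
  assumes dual [simp]:
    "lin_form lx ex = 1" "lin_form lx ey = 0" "lin_form lx ez = 0"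
    "lin_form ly ex = 0" "lin_form ly ey = 1" "lin_form ly ez = 0"
    "lin_form lz ex = 0" "lin_form lz ey = 0" "lin_form lz ez = 1"
    and expand: "v = lin_form lx v *s ex + lin_form ly v *s ey + lin_form lz v *s ez"

lemma ex_frame:
  fixes w :: "'a::{alg_closed_field, field_gcd}^3"
  assumes "w \<noteq> 0"
  obtains ex ez lx ly lz where "frame ex w ez lx ly lz"
proof -
  obtain i where i: "w $ i \<noteq> 0" using assms by (auto simp: vec_eq_iff)
  obtain j k :: 3 where jk: "i \<noteq> j" "i \<noteq> k" "j \<noteq> k" "\<And>a. a = i \<or> a = j \<or> a = k"
  proof -
    have "\<exists>j k :: 3. i \<noteq> j \<and> i \<noteq> k \<and> j \<noteq> k \<and> (\<forall>a. a = i \<or> a = j \<or> a = k)"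
      using exhaust_3[of i]
    proof (elim disjE)
      assume "i = 1"
      then show ?thesis using exhaust_3 by (intro exI[of _ 2] exI[of _ 3]) auto
    next
      assume "i = 2"
      then show ?thesis using exhaust_3 by (intro exI[of _ 1] exI[of _ 3]) auto
    next
      assume "i = 3"
      then show ?thesis using exhaust_3 by (intro exI[of _ 1] exI[of _ 2]) auto
    qed
    then show ?thesis using that by blast
  qed
  have ax: "axis a (1::'a) $ b = (if b = a then 1 else 0)" for a b :: 3 by (simp add: axis_def)
  \<comment> \<open>\<open>w\<close> replaces the unit vector of its pivot coordinate
    \<open>i\<close>, and the dual basis arises by clearing that coordinate.\<close>
  have "frame (axis j 1) w (axis k 1) (axis j 1 - (w $ j / w $ i) *s axis i 1) ((1 / w $ i) *s axis i 1)
    (axis k 1 - (w $ k / w $ i) *s axis i 1)"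
  proof
    fix v :: "'a^3"
    show "v = lin_form (axis j 1 - (w $ j / w $ i) *s axis i 1) v *s axis j 1 +
      lin_form ((1 / w $ i) *s axis i 1) v *s w +
      lin_form (axis k 1 - (w $ k / w $ i) *s axis i 1) v *s axis k 1"
      unfolding vec_eq_iff
    proof
      fix a
      show "v $ a = (lin_form (axis j 1 - (w $ j / w $ i) *s axis i 1) v *s axis j 1 +
        lin_form ((1 / w $ i) *s axis i 1) v *s w +
        lin_form (axis k 1 - (w $ k / w $ i) *s axis i 1) v *s axis k 1) $ a"
        using jk(4)[of a] i jk(1-3)
        by (auto simp: lin_form_simps lin_form_diff_left lin_form_axis ax field_simps)
    qed
  qed (use i jk in \<open>auto simp: lin_form_simps lin_form_diff_left lin_form_axis ax field_simps\<close>)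
  then show ?thesis using that by blast
qed

text \<open>A nonzero multiple of a product of \<open>n\<close> lines through \<open>w\<close>. It
  is constant in the direction \<open>w\<close> and takes the place of a resultant for the
  projection from \<open>w\<close>.\<close>

inductive split_form :: "'a::field^3 \<Rightarrow> nat \<Rightarrow> ('a^3 \<Rightarrow> 'a) \<Rightarrow> bool" for w where
  split_const: "c \<noteq> 0 \<Longrightarrow> split_form w 0 (\<lambda>v. c)"
| split_mult: "l \<noteq> 0 \<Longrightarrow> lin_form l w = 0 \<Longrightarrow> split_form w n r \<Longrightarrow>
    split_form w (Suc n) (\<lambda>v. lin_form l v * r v)"

lemma split_form_form: "split_form w n r \<Longrightarrow> form n r"
  by (induction rule: split_form.induct)
     (auto intro: form_const form_cong[OF form_mult[OF form_lin]])

definition irreducible_form :: "('a::comm_ring_1^3 \<Rightarrow> 'a) \<Rightarrow> bool" where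
  "irreducible_form G \<longleftrightarrow>
    (\<forall>i j a b. form i a \<longrightarrow> form j b \<longrightarrow> (\<forall>v. G v = a v * b v) \<longrightarrow> i = 0 \<or> j = 0)"

text \<open>The outer variable is \<open>y\<close>, the coordinate along the centre of projection,
  so that eliminating \<open>y\<close> leaves an element of the coefficient ring
  \<open>'a poly\<close>.\<close>

definition poly2 :: "'a::comm_ring_1 poly poly \<Rightarrow> 'a \<Rightarrow> 'a \<Rightarrow> 'a" where
  "poly2 p x y = poly (poly p [:y:]) x"

lemma poly2_simps [simp]:
  "poly2 0 x y = 0" "poly2 1 x y = 1" "poly2 (p + q) x y = poly2 p x y + poly2 q x y"
  "poly2 (p * q) x y = poly2 p x y * poly2 q x y" "poly2 (pCons c p) x y = poly c x + y * poly2 p x y"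
  by (simp_all add: poly2_def)

lemma poly2_eqI:
  fixes p q :: "'a::field poly poly"
  assumes inf: "infinite (UNIV :: 'a set)" and "\<And>x y. poly2 p x y = poly2 q x y"
  shows "p = q"
proof (rule ccontr)
  assume "p \<noteq> q"
  have "poly (p - q) [:y:] = 0" for y
    using poly_eq_infinite[OF inf, of 0 "poly p [:y:]" "poly q [:y:]"] assms(2) by (simp add: poly2_def)
  then have "range (\<lambda>y. [:y:]) \<subseteq> {t. poly (p - q) t = 0}" by auto
  moreover have "finite {t. poly (p - q) t = 0}" using \<open>p \<noteq> q\<close> by (intro poly_roots_finite) auto
  moreover have "infinite (range (\<lambda>y::'a. [:y:]))" using inf by (subst finite_image_iff) (auto intro: injI)
  ultimately show False using finite_subset by blast
qed

context frame
begin

definition pt :: "'a \<Rightarrow> 'a \<Rightarrow> 'a^3" where "pt x y = x *s ex + y *s ey + ez"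

lemma lin_pt [simp]:
  "lin_form lx (pt x y) = x" "lin_form ly (pt x y) = y" "lin_form lz (pt x y) = 1"
  by (simp_all add: pt_def lin_form_simps)

lemma nonzero [simp]: "lx \<noteq> 0" "ly \<noteq> 0" "lz \<noteq> 0" "ey \<noteq> 0"
  using dual by (metis lin_form_0 zero_neq_one)+

text \<open>The chart says nothing directly about the line at infinity; multiplying the difference
  by \<open>lz\<close> makes it zero there, and \<open>form_mult_zero\<close> removes this factor
  again.\<close>

lemma chart_eqI:
  assumes f: "form n f" and g: "form n g" and eq: "\<And>x y. f (pt x y) = g (pt x y)"
  shows "f v = g v"
proof -
  have "lin_form lz v * (f v - g v) = 0" for v
  proof (cases "lin_form lz v = 0")
    case False
    define z where "z = lin_form lz v"
    have "v = z *s pt (lin_form lx v / z) (lin_form ly v / z)"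
      using False expand[of v] by (simp add: pt_def z_def vector_add_ldistrib)
    then have "f v = z ^ n * f (pt (lin_form lx v / z) (lin_form ly v / z))"
      "g v = z ^ n * g (pt (lin_form lx v / z) (lin_form ly v / z))"
      using form_homog[OF f] form_homog[OF g] by metis+
    then show ?thesis using eq by simp
  qed simp
  from form_mult_zero[OF infinite_alg_closed form_lin form_diff[OF f g] this]
  show ?thesis by (metis dual(9) eq_iff_diff_eq_0 zero_neq_one)
qed

lemma dehomogenize:
  assumes "form n f" shows "\<exists>p. \<forall>x y. poly2 p x y = f (pt x y)"
  using assms
proof induction
  case (form_const c) show ?case by (intro exI[of _ "[:[:c:]:]"]) simp
next
  case (form_coord i)
  show ?case by (intro exI[of _ "[:[:ez $ i, ex $ i:], [:ey $ i:]:]"]) (simp add: pt_def)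
next
  case (form_add n f g) then show ?case by (metis poly2_simps(3))
next
  case (form_mult m f n g) then show ?case by (metis poly2_simps(4))
qed

lemma homogenize1: "\<exists>n f. form n f \<and> (\<forall>x y. f (pt x y) = poly c x)"
proof (induction c)
  case 0 then show ?case using form_zero[of 0] by (intro exI conjI) auto
next
  case (pCons a c)
  then obtain n f where f: "form n f" "\<forall>x y. f (pt x y) = poly c x" by blast
  have "form (1 + n) (\<lambda>v. a * lin_form lz v ^ (1 + n) + lin_form lx v * f v)"
    by (rule form_add[OF form_cmult[OF form_linpow] form_mult[OF form_lin f(1)]])
  then show ?case using f(2) by (intro exI conjI) auto
qed

lemma homogenize: "\<exists>n f. form n f \<and> (\<forall>x y. f (pt x y) = poly2 p x y)"
proof (induction p)
  case 0 then show ?case using form_zero[of 0] by (intro exI conjI) auto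
next
  case (pCons c p)
  then obtain n f where f: "form n f" "\<forall>x y. f (pt x y) = poly2 p x y" by blast
  obtain m g where g: "form m g" "\<forall>x y. g (pt x y) = poly c x" using homogenize1 by blast
  have "form (1 + n + m) (\<lambda>v. lin_form lz v ^ (1 + n) * g v)"
    by (rule form_mult[OF form_linpow g(1)])
  moreover have "form (1 + n + m) (\<lambda>v. lin_form lx v ^ 0 * (lin_form lz v ^ m * (lin_form ly v * f v)))"
    by (rule form_cong[OF form_mult[OF form_power[OF form_lin] form_mult[OF form_lin f(1)]]]) auto
  ultimately have "form (1 + n + m) (\<lambda>v. lin_form lz v ^ (1 + n) * g v
      + lin_form lx v ^ 0 * (lin_form lz v ^ m * (lin_form ly v * f v)))" by (rule form_add)
  then show ?case using f(2) g(2) by (intro exI conjI) auto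
qed

text \<open>Restriction to the chart forgets exactly the powers of \<open>lz\<close>. A form without
  such a factor can be recovered from the chart with its degree.\<close>

lemma strip:
  assumes "form n f" and "f v0 \<noteq> 0"
  shows "\<exists>m g. m \<le> n \<and> form (n - m) g \<and> (\<forall>v. f v = lin_form lz v ^ m * g v) \<and>
    (\<exists>v. lin_form lz v = 0 \<and> g v \<noteq> 0)"
  using assms
proof (induction n arbitrary: f)
  case 0
  then show ?case using form_homog[of 0 f 0] by (intro exI[of _ 0] exI[of _ f]) (auto intro!: exI[of _ 0])
next
  case (Suc n)
  show ?case
  proof (cases "\<exists>v. lin_form lz v = 0 \<and> f v \<noteq> 0")
    case True
    then show ?thesis using Suc.prems by (intro exI[of _ 0] exI[of _ f]) auto
  next
    case False
    then obtain g where g: "form n g" "\<forall>v. f v = lin_form lz v * g v"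
      using form_lin_dvd[OF Suc.prems(1) nonzero(3)] by auto
    then have "g v0 \<noteq> 0" using Suc.prems(2) by auto
    from Suc.IH[OF g(1) this] obtain m h where "m \<le> n" "form (n - m) h"
      "\<forall>v. g v = lin_form lz v ^ m * h v" "\<exists>v. lin_form lz v = 0 \<and> h v \<noteq> 0" by blast
    then show ?thesis using g(2) by (intro exI[of _ "Suc m"] exI[of _ h]) (auto simp: mult.assoc)
  qed
qed

lemma off_line_mult:
  assumes "form m f" "form n g" "\<exists>v. lin_form lz v = 0 \<and> f v \<noteq> 0" "\<exists>v. lin_form lz v = 0 \<and> g v \<noteq> 0"
  shows "\<exists>v. lin_form lz v = 0 \<and> f v * g v \<noteq> 0"
  using form_mult_zero_on_line[OF infinite_alg_closed assms(1,2) nonzero(3)] assms(3,4) by blast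

lemma form_lz_power: "form n f \<Longrightarrow> form (m + n) (\<lambda>v. lin_form lz v ^ m * f v)"
  by (rule form_mult[OF form_linpow])

text \<open>A product that does not vanish identically at infinity has the least degree among the
  forms with the same restriction to the chart; the missing degree is a power of
  \<open>lz\<close>.\<close>

lemma chart_product:
  assumes f: "form m f" and g: "form n g" and h: "form k h"
    and fz: "\<exists>v. lin_form lz v = 0 \<and> f v \<noteq> 0" and gz: "\<exists>v. lin_form lz v = 0 \<and> g v \<noteq> 0"
    and eq: "\<And>x y. h (pt x y) = f (pt x y) * g (pt x y)"
  shows "m + n \<le> k" "h v = lin_form lz v ^ (k - (m + n)) * (f v * g v)"
proof -
  obtain v0 where v0: "lin_form lz v0 = 0" "f v0 * g v0 \<noteq> 0" using off_line_mult[OF f g fz gz] by blast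
  show le: "m + n \<le> k"
  proof (rule ccontr)
    assume "\<not> m + n \<le> k"
    then have "form (m + n) (\<lambda>v. lin_form lz v ^ (m + n - k) * h v)"
      by (intro form_cong[OF form_lz_power[OF h, of "m + n - k"]]) auto
    from chart_eqI[OF this form_mult[OF f g], of v0]
    have "lin_form lz v0 ^ (m + n - k) * h v0 = f v0 * g v0" by (simp add: eq)
    then show False using v0 \<open>\<not> m + n \<le> k\<close> by (simp add: power_0_left)
  qed
  show "h v = lin_form lz v ^ (k - (m + n)) * (f v * g v)"
  proof (rule chart_eqI[OF h])
    show "form k (\<lambda>v. lin_form lz v ^ (k - (m + n)) * (f v * g v))"
      using le by (intro form_cong[OF form_lz_power[OF form_mult[OF f g], of "k - (m + n)"]]) auto
  qed (simp add: eq)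
qed

text \<open>A root \<open>a\<close> of \<open>r\<close> becomes the line \<open>lx = a lz\<close>,
  which passes through \<open>ey\<close>. Here algebraic closedness turns an eliminant into a
  product of lines.\<close>

lemma split_of_poly:
  assumes "r \<noteq> 0" shows "\<exists>n R. split_form ey n R \<and> (\<forall>x y. R (pt x y) = poly r x)"
  using assms
proof (induction "degree r" arbitrary: r)
  case 0
  then obtain c where "r = [:c:]" by (metis degree_eq_zeroE)
  then show ?case using 0 split_const[of c] by (intro exI[of _ 0] exI[of _ "\<lambda>v. c"]) auto
next
  case (Suc d)
  then obtain a where "poly r a = 0" using alg_closed_imp_poly_has_root[of r] by auto
  then obtain q where q: "r = [:- a, 1:] * q" by (metis dvdE poly_eq_0_iff_dvd)
  then have "q \<noteq> 0" using Suc.prems by auto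
  then have "degree q = d" using Suc.hyps(2) by (simp add: q degree_mult_eq del: mult_pCons_left)
  from Suc.hyps(1)[OF this[symmetric] \<open>q \<noteq> 0\<close>] obtain n R where
    R: "split_form ey n R" "\<forall>x y. R (pt x y) = poly q x" by blast
  have "lin_form (lx - a *s lz) ex = 1" by (simp add: lin_form_simps lin_form_diff_left)
  then have "lx - a *s lz \<noteq> 0" by (metis lin_form_0(2) zero_neq_one)
  moreover have "lin_form (lx - a *s lz) ey = 0" by (simp add: lin_form_simps lin_form_diff_left)
  ultimately have "split_form ey (Suc n) (\<lambda>v. lin_form (lx - a *s lz) v * R v)"
    by (rule split_mult) (rule R)
  moreover have "lin_form (lx - a *s lz) (pt x y) * R (pt x y) = poly r x" for x y
    by (simp add: q R(2) lin_form_simps lin_form_diff_left algebra_simps)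
  ultimately show ?case by blast
qed

lemma split_lz_power: "split_form ey n R \<Longrightarrow> split_form ey (m + n) (\<lambda>v. lin_form lz v ^ m * R v)"
proof (induction m)
  case (Suc m)
  then show ?case using split_mult[OF nonzero(3) dual(8) Suc.IH[OF Suc.prems]] by (simp add: mult.assoc)
qed simp

end

section \<open>Elimination of a variable by Bezout identities\<close>

lemma fract_poly_clear_denominator:
  fixes p :: "'a::{factorial_ring_gcd, semiring_gcd_mult_normalize} fract poly"
  shows "\<exists>d q. d \<noteq> 0 \<and> smult (to_fract d) p = fract_poly q"
proof -
  obtain c p' where c: "p = smult c (fract_poly p')"
    by (rule content_decompose_fract)
  obtain a b where ab: "c = Fract a b" "b \<noteq> 0" by (cases c) auto
  have "smult (to_fract b) p = fract_poly (smult a p')"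
    by (subst c) (use ab in \<open>simp add: Fract_conv_to_fract\<close>)
  then show ?thesis using ab by blast
qed

text \<open>A nonzero element of least degree in the ideal of \<open>g\<close> and \<open>w\<close>
  divides both. Since \<open>g\<close> is irreducible and does not divide \<open>w\<close>, this
  element is a unit.\<close>

lemma field_poly_bezout:
  fixes g w :: "'a::field poly"
  assumes irr: "irreducible g" and ndvd: "\<not> g dvd w"
  shows "\<exists>a b. a * g + b * w = 1"
proof -
  define I where "I = {a * g + b * w | a b. True}"
  have in_I: "a * g + b * w \<in> I" for a b unfolding I_def by blast
  have "w \<in> I" "g \<in> I" using in_I[of 0 1] in_I[of 1 0] by auto
  moreover have "w \<noteq> 0" using ndvd by auto
  ultimately obtain d where d: "d \<in> I" "d \<noteq> 0" and min: "\<And>e. e \<in> I \<Longrightarrow> e \<noteq> 0 \<Longrightarrow> degree d \<le> degree e"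
    using ex_has_least_nat[of "\<lambda>x. x \<in> I \<and> x \<noteq> 0" w degree] by blast
  obtain a b where ab: "d = a * g + b * w" using d(1) unfolding I_def by blast
  have dvd: "d dvd x" if x: "x \<in> I" for x
  proof -
    obtain s t where "x = s * g + t * w" using x unfolding I_def by blast
    moreover have "x mod d = x - x div d * d" by (simp add: minus_div_mult_eq_mod)
    ultimately have "x mod d = (s - x div d * a) * g + (t - x div d * b) * w"
      by (simp add: ab algebra_simps)
    then have "x mod d \<in> I" using in_I by metis
    then have "x mod d = 0" using min[of "x mod d"] degree_mod_less[OF d(2), of x] by force
    then show ?thesis by (rule mod_0_imp_dvd)
  qed
  obtain e where e: "g = d * e" using dvd[OF \<open>g \<in> I\<close>] by (elim dvdE)
  have "\<not> e dvd 1"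
  proof
    assume "e dvd 1"
    then have "g dvd d" using e by (metis dvd_mult_unit_iff' dvd_refl mult.commute dvd_mult_unit_iff)
    then show False using dvd[OF \<open>w \<in> I\<close>] ndvd dvd_trans by blast
  qed
  then have "d dvd 1" using Factorial_Ring.irreducibleD[OF irr e] by blast
  then obtain u where "1 = d * u" by (elim dvdE)
  then have "(u * a) * g + (u * b) * w = 1" by (simp add: ab algebra_simps)
  then show ?thesis by blast
qed

text \<open>By Gauss's lemma \<open>g\<close> stays irreducible over the fraction field of the
  coefficients, where Bezout gives 1. Clearing denominators leaves a nonzero \<open>r\<close>
  without the outer variable.\<close>

lemma poly_poly_bezout:
  fixes g w :: "'a::{factorial_ring_gcd, semiring_gcd_mult_normalize} poly"
  assumes g: "irreducible g" "degree g \<noteq> 0" and ndvd: "\<not> g dvd w"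
  shows "\<exists>r s t. r \<noteq> 0 \<and> s * g + t * w = [:r:]"
proof -
  have irr: "irreducible (fract_poly g)" "content g = 1"
    using nonconst_poly_irreducible_iff[OF g(2)] g(1) by auto
  moreover have "\<not> fract_poly g dvd fract_poly w"
    using fract_poly_dvdD[of g w] irr(2) ndvd by auto
  ultimately obtain a b where ab: "a * fract_poly g + b * fract_poly w = 1"
    using field_poly_bezout by blast
  obtain d p where d: "d \<noteq> 0" "smult (to_fract d) a = fract_poly p"
    using fract_poly_clear_denominator by blast
  obtain e q where e: "e \<noteq> 0" "smult (to_fract e) b = fract_poly q"
    using fract_poly_clear_denominator by blast
  have "fract_poly (smult e p * g + smult d q * w)
      = smult (to_fract (d * e)) (a * fract_poly g + b * fract_poly w)"
    by (simp add: d(2)[symmetric] e(2)[symmetric] smult_add_right mult.commute)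
  also have "\<dots> = fract_poly [:d * e:]" by (simp add: ab map_poly_pCons)
  finally have "smult e p * g + smult d q * w = [:d * e:]" by (simp only: fract_poly_eq_iff)
  moreover have "d * e \<noteq> 0" using d(1) e(1) by simp
  ultimately show ?thesis by blast
qed

text \<open>The homogeneous version of \<open>poly_poly_bezout\<close>. The condition
  \<open>G w \<noteq> 0\<close> puts the centre of projection off the curve, so that
  \<open>G\<close> has no factor \<open>lz\<close> and really involves \<open>y\<close>.\<close>

theorem form_bezout:
  fixes G W :: "'a::{alg_closed_field, field_gcd}^3 \<Rightarrow> 'a"
  assumes G: "form c G" and c: "c > 0" and Gw: "G w \<noteq> 0" and irr: "irreducible_form G"
    and W: "form n W"
  shows "(\<exists>U. form (n - c) U \<and> (n < c \<longrightarrow> (\<forall>v. U v = 0)) \<and> (\<forall>v. W v = G v * U v)) \<or>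
    (\<exists>m r i s j t. split_form w m r \<and> form i s \<and> form j t \<and> i + c = m \<and> j + n = m \<and>
      (\<forall>v. r v = s v * G v + t v * W v))"
proof (cases "\<forall>v. W v = 0")
  case True
  then show ?thesis using form_zero[of "n - c"] by (intro disjI1 exI[of _ "\<lambda>v. 0"]) auto
next
  case False
  then obtain v1 where v1: "W v1 \<noteq> 0" by blast
  have "w \<noteq> 0" using form_at_0[OF G c] Gw by auto
  then obtain ex ez lx ly lz where "frame ex w ez lx ly lz" using ex_frame by blast
  then interpret frame ex w ez lx ly lz .
  note inf = infinite_alg_closed[where 'a = 'a]
  have Gz: "\<exists>v. lin_form lz v = 0 \<and> G v \<noteq> 0" using Gw by (intro exI[of _ w]) simp
  obtain g where g: "\<And>x y. poly2 g x y = G (pt x y)" using dehomogenize[OF G] by blast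
  have const: "c = 0" if "\<And>x y. G (pt x y) = a" for a
  proof (rule ccontr)
    assume "c \<noteq> 0"
    have "G w = a * lin_form lz w ^ c"
      by (rule chart_eqI[OF G form_cmult[OF form_linpow]]) (simp add: that)
    then show False using Gw c by (simp add: power_0_left)
  qed
  have g0: "g \<noteq> 0" using const[of 0] g c by (metis poly2_simps(1) less_irrefl)
  have stripped: "\<exists>m f. form m f \<and> (\<exists>v. lin_form lz v = 0 \<and> f v \<noteq> 0) \<and> (\<forall>x y. f (pt x y) = poly2 u x y)"
    if "u \<noteq> 0" for u
  proof -
    obtain m f where f: "form m f" "\<forall>x y. f (pt x y) = poly2 u x y" using homogenize by blast
    have "\<exists>v. f v \<noteq> 0" using f(2) that poly2_eqI[OF inf, of u 0] by force
    then obtain v0 where "f v0 \<noteq> 0" by blast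
    from strip[OF f(1) this] obtain k h where "form (m - k) h"
      "\<forall>v. f v = lin_form lz v ^ k * h v" "\<exists>v. lin_form lz v = 0 \<and> h v \<noteq> 0" by blast
    then show ?thesis using f(2) by (intro exI[of _ "m - k"] exI[of _ h]) auto
  qed
  have unit: "u dvd 1" if "form 0 f" "\<And>x y. f (pt x y) = poly2 u x y" "u \<noteq> 0" for f u
  proof -
    have "f v = f 0" for v using form_homog[OF that(1), of 0 v] by simp
    then have "poly2 u x y = f 0" for x y using that(2)[of x y] by metis
    then have "u = [:[:f 0:]:]" by (intro poly2_eqI[OF inf]) simp
    then show ?thesis using that(3) by (simp add: is_unit_const_poly_iff dvd_field_iff)
  qed
  have irr_g: "irreducible g"
  proof (rule Factorial_Ring.irreducibleI)
    show "g \<noteq> 0" by fact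
    show "\<not> g dvd 1"
    proof
      assume "g dvd 1"
      then obtain a where "g = [:a:]" "a dvd 1" by (auto simp: is_unit_poly_iff)
      then obtain b where "g = [:[:b:]:]" by (auto simp: is_unit_poly_iff)
      then have "G (pt x y) = b" for x y using g[of x y] by simp
      then show False using const c by blast
    qed
    fix a b assume ab: "g = a * b"
    then have nz: "a \<noteq> 0" "b \<noteq> 0" using g0 by auto
    obtain m f where f: "form m f" "\<exists>v. lin_form lz v = 0 \<and> f v \<noteq> 0" "\<And>x y. f (pt x y) = poly2 a x y"
      using stripped[OF nz(1)] by blast
    obtain n h where h: "form n h" "\<exists>v. lin_form lz v = 0 \<and> h v \<noteq> 0" "\<And>x y. h (pt x y) = poly2 b x y"
      using stripped[OF nz(2)] by blast
    have eq: "G (pt x y) = f (pt x y) * h (pt x y)" for x y by (simp add: g[symmetric] ab f(3) h(3))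
    note prod = chart_product[OF f(1) h(1) G f(2) h(2) eq]
    \<comment> \<open>Otherwise \<open>G\<close> would contain the factor \<open>lz\<close>, which
      vanishes at \<open>w\<close>.\<close>
    have "c = m + n" using prod(1) prod(2)[of w] Gw by (cases "c = m + n") (auto simp: power_0_left)
    then have "G v = f v * h v" for v using prod(2) by simp
    then have "m = 0 \<or> n = 0" using irr f(1) h(1) unfolding irreducible_form_def by blast
    then show "a dvd 1 \<or> b dvd 1" using unit[of f a] unit[of h b] f h nz by auto
  qed
  \<comment> \<open>Look at the line \<open>w + t ez\<close>: if \<open>g\<close> did not involve
    \<open>y\<close>, then \<open>G\<close> would be \<open>t ^ c\<close> times a constant on it and
    vanish at \<open>w\<close>.\<close>
  have deg_g: "degree g \<noteq> 0"
  proof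
    assume "degree g = 0"
    then obtain r where r: "g = [:r:]" by (metis degree_eq_zeroE)
    obtain p where p: "\<forall>t. poly p t = G (w + t *s ez)" using form_line[OF G] by blast
    have "[:0, 1:] ^ c * [:poly r 0:] = p"
    proof (rule poly_eq_infinite[OF inf, of 0])
      fix t :: 'a assume "t \<noteq> 0"
      then have "w + t *s ez = t *s pt 0 (1 / t)" by (simp add: pt_def vector_add_ldistrib)
      then have "poly p t = t ^ c * G (pt 0 (1 / t))" using p form_homog[OF G] by metis
      then show "poly ([:0, 1:] ^ c * [:poly r 0:]) t = poly p t" using g[of 0 "1 / t"] r by simp
    qed
    then have "poly p 0 = 0" using c by (auto simp: power_0_left)
    then show False using p[rule_format, of 0] Gw by simp
  qed
  obtain u where u: "\<And>x y. poly2 u x y = W (pt x y)" using dehomogenize[OF W] by blast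
  have u0: "u \<noteq> 0"
  proof
    assume "u = 0"
    then have "W (pt x y) = 0" for x y using u[of x y] by simp
    then have "W v1 = 0" by (rule chart_eqI[OF W form_zero])
    then show False using v1 by simp
  qed
  show ?thesis
  proof (cases "g dvd u")
    case True
    then obtain q where q: "u = g * q" by (elim dvdE)
    then have "q \<noteq> 0" using u0 by auto
    then obtain m f where f: "form m f" "\<exists>v. lin_form lz v = 0 \<and> f v \<noteq> 0" "\<And>x y. f (pt x y) = poly2 q x y"
      using stripped by blast
    have eq: "W (pt x y) = G (pt x y) * f (pt x y)" for x y by (simp add: u[symmetric] q f(3) g)
    note prod = chart_product[OF G f(1) W Gz f(2) eq]
    have "form (n - c) (\<lambda>v. lin_form lz v ^ (n - (c + m)) * f v)"
      by (rule form_cong[OF form_lz_power[OF f(1), of "n - (c + m)"]]) (use prod(1) in auto)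
    then show ?thesis using prod
      by (intro disjI1 exI[of _ "\<lambda>v. lin_form lz v ^ (n - (c + m)) * f v"]) (auto simp: mult_ac)
  next
    case False
    obtain r s t where r: "r \<noteq> 0" "s * g + t * u = [:r:]" using poly_poly_bezout[OF irr_g deg_g False] by blast
    obtain m R where R: "split_form w m R" "\<forall>x y. R (pt x y) = poly r x" using split_of_poly[OF r(1)] by blast
    obtain i S where S: "form i S" "\<forall>x y. S (pt x y) = poly2 s x y" using homogenize by blast
    obtain j T where T: "form j T" "\<forall>x y. T (pt x y) = poly2 t x y" using homogenize by blast
    \<comment> \<open>Powers of \<open>lz\<close> bring all terms to the common degree
      \<open>N\<close>; only then does equality on the chart become an identity of forms.\<close>
    let ?N = "m + i + c + j + n"
    let ?R = "\<lambda>v. lin_form lz v ^ (i + c + j + n) * R v"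
    let ?S = "\<lambda>v. lin_form lz v ^ (m + j + n) * S v"
    let ?T = "\<lambda>v. lin_form lz v ^ (m + i + c) * T v"
    have R': "split_form w ?N ?R" using split_lz_power[OF R(1), of "i + c + j + n"] by (simp add: ac_simps)
    have S': "form (?N - c) ?S" by (rule form_cong[OF form_lz_power[OF S(1), of "m + j + n"]]) auto
    have T': "form (?N - n) ?T" by (rule form_cong[OF form_lz_power[OF T(1), of "m + i + c"]]) auto
    have "?R v = ?S v * G v + ?T v * W v" for v
    proof (rule chart_eqI[OF split_form_form[OF R'] form_add])
      show "form ?N (\<lambda>v. ?S v * G v)" by (rule form_cong[OF form_mult[OF S' G]]) auto
      show "form ?N (\<lambda>v. ?T v * W v)" by (rule form_cong[OF form_mult[OF T' W]]) auto
      fix x y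
      have "poly2 (s * g + t * u) x y = poly r x" by (simp add: r(2))
      then show "?R (pt x y) = ?S (pt x y) * G (pt x y) + ?T (pt x y) * W (pt x y)"
        by (simp add: R(2) S(2) T(2) g u)
    qed
    then have "split_form w ?N ?R \<and> form (?N - c) ?S \<and> form (?N - n) ?T \<and> ?N - c + c = ?N \<and> ?N - n + n = ?N \<and>
      (\<forall>v. ?R v = ?S v * G v + ?T v * W v)" using R' S' T' by simp
    then show ?thesis by (intro disjI2) blast
  qed
qed

section \<open>The invariant quartic\<close>

lemma two_F2bar [simp]: "(2 :: F2bar) = 0"
proof -
  have "(2 :: bit) = 0" by simp
  then have "to_ac (2 :: bit) = 0" by (simp only: to_ac_0)
  then show ?thesis by (simp only: to_ac_numeral)
qed

lemma F2bar_add_self [simp]: "(x :: F2bar) + x = 0"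
  using mult_2[of x] by simp

lemma F2bar_add_self_left [simp]: "(x :: F2bar) + (x + y) = y"
  by (simp add: add.assoc[symmetric])

lemma F2bar_uminus [simp]: "- (x :: F2bar) = x"
  by (rule minus_unique) simp

lemma F2bar_diff: "(x :: F2bar) - y = x + y"
  by (simp add: diff_conv_add_uminus del: add_uminus_conv_diff)

lemma F2bar_add_eq_0: "(x :: F2bar) + y = 0 \<longleftrightarrow> x = y"
  by (metis F2bar_diff eq_iff_diff_eq_0)

lemma F2bar_square_add: "((x :: F2bar) + y)\<^sup>2 = x\<^sup>2 + y\<^sup>2"
  by (simp add: power2_sum)

lemmas inf_F2bar = infinite_alg_closed[where 'a = F2bar]

definition cross :: "'a::comm_ring_1^3 \<Rightarrow> 'a^3 \<Rightarrow> 'a^3" where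
  "cross u v = vector [u$2 * v$3 - u$3 * v$2, u$3 * v$1 - u$1 * v$3, u$1 * v$2 - u$2 * v$1]"

lemma cross_component [simp]:
  "cross u v $ 1 = u$2 * v$3 - u$3 * v$2" "cross u v $ 2 = u$3 * v$1 - u$1 * v$3"
  "cross u v $ 3 = u$1 * v$2 - u$2 * v$1"
  by (simp_all add: cross_def vector_3)

lemma lin_form_3: "lin_form l v = l$1 * v$1 + l$2 * v$2 + l$3 * v$3"
  by (simp add: lin_form_def sum_3)

definition i4 :: "F2bar^3 \<Rightarrow> F2bar" where
  "i4 v = v$1^4 + v$2^4 + v$3^4 + v$1^2 * v$2^2 + v$2^2 * v$3^2 + v$3^2 * v$1^2
     + v$1^2 * v$2 * v$3 + v$1 * v$2^2 * v$3 + v$1 * v$2 * v$3^2"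

text \<open>The coefficient of \<open>a^2 b^2\<close> in \<open>i4 (a v + b w)\<close>, see
  \<open>i4_expand\<close>. At \<open>w = sq v\<close> it is the middle coefficient of Dickson's
  relation \<open>vpow8\<close>.\<close>

definition i4_polar :: "F2bar^3 \<Rightarrow> F2bar^3 \<Rightarrow> F2bar" where
  "i4_polar v w = v$1^2 * w$2^2 + w$1^2 * v$2^2 + v$2^2 * w$3^2 + w$2^2 * v$3^2 + v$3^2 * w$1^2
    + w$3^2 * v$1^2 + v$1^2 * w$2 * w$3 + w$1^2 * v$2 * v$3 + v$2^2 * w$1 * w$3
    + w$2^2 * v$1 * v$3 + v$3^2 * w$1 * w$2 + w$3^2 * v$1 * v$2"

abbreviation sq :: "'a::monoid_mult^3 \<Rightarrow> 'a^3" where "sq \<equiv> vpow 2"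

lemma vpow_component [simp]: "vpow n v $ i = v $ i ^ n"
  by (simp add: vpow_def)

lemma form_i4: "form 4 i4"
proof -
  note c = form_coord[where 'a = F2bar]
  have p4: "form 4 (\<lambda>v::F2bar^3. v$i^4)" for i by (rule form_cong[OF form_power[OF c]]) auto
  have p2: "form 2 (\<lambda>v::F2bar^3. v$i^2)" for i by (rule form_cong[OF form_power[OF c]]) auto
  have p22: "form 4 (\<lambda>v::F2bar^3. v$i^2 * v$j^2)" for i j by (rule form_cong[OF form_mult[OF p2 p2]]) auto
  have p211: "form 4 (\<lambda>v::F2bar^3. v$i^2 * v$j * v$k)" for i j k
    by (rule form_cong[OF form_mult[OF form_mult[OF p2 c] c]]) auto
  have p121: "form 4 (\<lambda>v::F2bar^3. v$i * v$j^2 * v$k)" for i j k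
    by (rule form_cong[OF form_mult[OF form_mult[OF c p2] c]]) auto
  have p112: "form 4 (\<lambda>v::F2bar^3. v$i * v$j * v$k^2)" for i j k
    by (rule form_cong[OF form_mult[OF form_mult[OF c c] p2]]) auto
  show ?thesis unfolding i4_def by (intro form_add p4 p22 p211 p121 p112)
qed

lemma F2bar_power4_add: "((x :: F2bar) + y)^4 = x^4 + y^4"
proof -
  have "(x + y)^4 = ((x + y)\<^sup>2)\<^sup>2" by simp
  also have "\<dots> = (x\<^sup>2)\<^sup>2 + (y\<^sup>2)\<^sup>2" by (simp only: F2bar_square_add)
  finally show ?thesis by simp
qed

lemma i4_expand:
  "i4 (a *s v + b *s w) = a^4 * i4 v + a^3 * b * lin_form (cross v (sq v)) w
     + a^2 * b^2 * i4_polar v w + a * b^3 * lin_form (cross w (sq w)) v + b^4 * i4 w"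
  by (simp add: i4_def i4_polar_def lin_form_3 F2bar_diff F2bar_square_add F2bar_power4_add)
     (simp add: algebra_simps power2_eq_square power3_eq_cube power4_eq_xxxx)

definition i4_line :: "F2bar^3 \<Rightarrow> F2bar^3 \<Rightarrow> F2bar poly" where
  "i4_line v w = [:i4 v, lin_form (cross v (sq v)) w, i4_polar v w, lin_form (cross w (sq w)) v, i4 w:]"

lemma i4_line: "i4 (v + t *s w) = poly (i4_line v w) t"
  using i4_expand[of 1 v t w]
  by (simp add: i4_line_def algebra_simps power2_eq_square power3_eq_cube power4_eq_xxxx)

lemma grad_i4: "grad i4 v = cross v (sq v)"
proof (rule lin_form_eqI)
  fix w
  show "lin_form (grad i4 v) w = lin_form (cross v (sq v)) w"
    by (rule grad_eqI[OF inf_F2bar form_i4,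
          where R = "[:i4_polar v w, lin_form (cross w (sq w)) v, i4 w:]"])
       (simp add: i4_line i4_line_def algebra_simps power2_eq_square)
qed

text \<open>The point \<open>(0,1,0)\<close> lies off the curve and serves as the centre of all
  eliminations on it.\<close>

lemma i4_e2 [simp]: "i4 (axis 2 1) = 1"
  by (simp add: i4_def axis_def)

lemma i4_root: assumes "i4 w \<noteq> 0" shows "\<exists>t. i4 (v + t *s w) = 0"
proof -
  have "degree (i4_line v w) > 0" using assms by (simp add: i4_line_def)
  then show ?thesis using alg_closed_imp_poly_has_root i4_line by metis
qed

subsection \<open>Irreducibility\<close>

lemma form_Suc_expand:
  assumes "form n f"
  shows "n = 0 \<or> (\<exists>g. (\<forall>i. form (n - 1) (g i)) \<and> (\<forall>v. f v = (\<Sum>i\<in>UNIV. v $ i * g i v)))"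
  using assms
proof induction
  case (form_coord i)
  have "form 0 (\<lambda>v. if j = i then 1 else 0 :: 'a)" for j by (rule form_const)
  then show ?case
    by (intro disjI2 exI[of _ "\<lambda>j v. if j = i then 1 else 0"]) (auto simp: if_distrib cong: if_cong)
next
  case (form_add n f g)
  show ?case
  proof (cases "n = 0")
    case False
    then obtain F G where "\<forall>i. form (n - 1) (F i)" "\<forall>v. f v = (\<Sum>i\<in>UNIV. v $ i * F i v)"
      "\<forall>i. form (n - 1) (G i)" "\<forall>v. g v = (\<Sum>i\<in>UNIV. v $ i * G i v)" using form_add.IH by blast
    then show ?thesis
      by (intro disjI2 exI[of _ "\<lambda>i v. F i v + G i v"])
         (auto simp: algebra_simps sum.distrib intro: form.form_add)
  qed simp
next
  case (form_mult m f n g)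
  show ?case
  proof (cases "m = 0")
    case False
    then obtain F where F: "\<forall>i. form (m - 1) (F i)" "\<forall>v. f v = (\<Sum>i\<in>UNIV. v $ i * F i v)"
      using form_mult.IH by blast
    have "form (m + n - 1) (\<lambda>v. F i v * g v)" for i
      using form.form_mult[OF F(1)[rule_format, of i] form_mult.hyps(2)] False by simp
    then show ?thesis using F(2)
      by (intro disjI2 exI[of _ "\<lambda>i v. F i v * g v"]) (auto simp: sum_distrib_right mult.assoc)
  next
    case True
    show ?thesis
    proof (cases "n = 0")
      case False
      then obtain G where G: "\<forall>i. form (n - 1) (G i)" "\<forall>v. g v = (\<Sum>i\<in>UNIV. v $ i * G i v)"
        using form_mult.IH by blast
      have "form (m + n - 1) (\<lambda>v. f v * G i v)" for i
        using form.form_mult[OF form_mult.hyps(1) G(1)[rule_format, of i]] False by simp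
      then show ?thesis using G(2)
        by (intro disjI2 exI[of _ "\<lambda>i v. f v * G i v"]) (auto simp: sum_distrib_left mult_ac)
    qed (use True in simp)
  qed
qed simp

lemma form_0: "form 0 f \<Longrightarrow> f v = f w"
  using form_homog[of 0 f 0 v] form_homog[of 0 f 0 w] by simp

lemma form_1: "form 1 (f :: 'a::field^3 \<Rightarrow> 'a) \<Longrightarrow> \<exists>l. \<forall>v. f v = lin_form l v"
proof -
  assume "form 1 f"
  then obtain g where g: "\<forall>i. form 0 (g i)" "\<forall>v. f v = (\<Sum>i\<in>UNIV. v $ i * g i v)"
    using form_Suc_expand[of 1 f] by auto
  have "f v = lin_form (\<chi> i. g i 0) v" for v
    using g(2) form_0[OF g(1)[rule_format], of _ v 0] by (simp add: lin_form_def mult.commute)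
  then show ?thesis by blast
qed

lemma form_2:
  assumes "form 2 (f :: 'a::field^3 \<Rightarrow> 'a)"
  obtains a b c d e h where "\<And>x y z. f (vector [x, y, z]) =
    a * y^2 + (b * x + c * z) * y + (d * x^2 + e * x * z + h * z^2)"
proof -
  obtain g where g: "\<forall>i. form 1 (g i)" "\<forall>v. f v = (\<Sum>i\<in>UNIV. v $ i * g i v)"
    using form_Suc_expand[OF assms] by auto
  obtain L where L: "\<And>i v. g i v = lin_form (L i) v" using form_1[OF g(1)[rule_format]] by metis
  show ?thesis
    by (rule that[of "L 2 $ 2" "L 1 $ 2 + L 2 $ 1" "L 2 $ 3 + L 3 $ 2" "L 1 $ 1" "L 1 $ 3 + L 3 $ 1" "L 3 $ 3"])
       (simp add: g(2) L sum_3 lin_form_3 vector_3 algebra_simps power2_eq_square)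
qed

lemma form_degree_unique:
  fixes f :: "'a::field^3 \<Rightarrow> 'a"
  assumes inf: "infinite (UNIV :: 'a set)" and "form m f" "form n f" "f v \<noteq> 0"
  shows "m = n"
proof -
  have "monom (f v) m = monom (f v) n"
    by (rule poly_eq_infinite[OF inf]) (metis poly_monom form_homog[OF assms(2)] form_homog[OF assms(3)] mult.commute)
  then have "degree (monom (f v) m) = degree (monom (f v) n)" by simp
  then show ?thesis using assms(4) by (simp add: degree_monom_eq)
qed

text \<open>As the quartic is nonzero at \<open>(0,1,0)\<close>, a linear factor is a line
  \<open>y = \<alpha> x + \<beta>\<close>. The two leading coefficients on it give
  \<open>\<alpha>^2 = \<alpha>\<close> and \<open>\<alpha>^4 + \<alpha>^2 = 1\<close>, which are
  incompatible.\<close>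

lemma i4_no_linear_factor:
  assumes "\<And>v. i4 v = lin_form l v * b v" shows False
proof -
  have l2: "l $ 2 \<noteq> 0" using assms[of "axis 2 1"] by (auto simp: lin_form_axis)
  define \<alpha> \<beta> where "\<alpha> = l $ 1 / l $ 2" and "\<beta> = l $ 3 / l $ 2"
  have 0: "i4 (vector [x, \<alpha> * x + \<beta>, 1]) = 0" for x
  proof -
    have "lin_form l (vector [x, \<alpha> * x + \<beta>, 1]) = 0"
      using l2 by (simp add: lin_form_3 vector_3 \<alpha>_def \<beta>_def field_simps)
    then show ?thesis using assms by simp
  qed
  have "[:\<beta>^4 + \<beta>^2 + 1, \<beta>^2 + \<beta>, \<alpha>^2 + \<beta>^2 + \<alpha> + \<beta> + 1, \<alpha>^2 + \<alpha>, \<alpha>^4 + \<alpha>^2 + 1:] = 0"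
    by (rule poly_eq_infinite[OF inf_F2bar])
       (use 0 in \<open>simp add: i4_def vector_3 F2bar_square_add F2bar_power4_add\<close>,
        simp add: algebra_simps power2_eq_square power4_eq_xxxx)
  then have "\<alpha>^2 + \<alpha> = 0" "\<alpha>^4 + \<alpha>^2 + 1 = 0" by auto
  then have "\<alpha>^2 = \<alpha>" by (simp add: F2bar_add_eq_0)
  then have "\<alpha>^4 = \<alpha>" by (metis power2_eq_square power4_eq_xxxx mult.assoc)
  then show False using \<open>\<alpha>^4 + \<alpha>^2 + 1 = 0\<close> \<open>\<alpha>^2 = \<alpha>\<close> by simp
qed

lemma F2bar_idem: "(x :: F2bar)\<^sup>2 = x \<Longrightarrow> x = 0 \<or> x = 1"
  by (auto simp: power2_eq_square)

text \<open>On \<open>z = 1\<close> the quartic is monic in \<open>y\<close> without a cubic term,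
  so in characteristic 2 the factors are, up to constants, \<open>y^2 + p y + q\<close> and
  \<open>y^2 + p y + q'\<close> with the same \<open>p = \<alpha> x + \<beta>\<close>. Comparing
  coefficients puts \<open>\<alpha>\<close> and \<open>\<beta>\<close> into \<open>F_2\<close> and
  then excludes all four choices.\<close>

lemma i4_no_quadratic_factor:
  assumes a: "form 2 a" and b: "form 2 b" and ab: "\<And>v. i4 v = a v * b v"
  shows False
proof -
  obtain a0 a1 a2 a3 a4 a5 where a: "\<And>x y z. a (vector [x, y, z]) =
    a0 * y^2 + (a1 * x + a2 * z) * y + (a3 * x^2 + a4 * x * z + a5 * z^2)" using form_2[OF a] by blast
  obtain b0 b1 b2 b3 b4 b5 where b: "\<And>x y z. b (vector [x, y, z]) =
    b0 * y^2 + (b1 * x + b2 * z) * y + (b3 * x^2 + b4 * x * z + b5 * z^2)" using form_2[OF b] by blast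
  have pol: "[:a3 * x^2 + a4 * x + a5, a1 * x + a2, a0:] * [:b3 * x^2 + b4 * x + b5, b1 * x + b2, b0:]
      = [:(x^2 + x + 1)^2, x^2 + x, x^2 + x + 1, 0, 1:]" for x
  proof (rule poly_eq_infinite[OF inf_F2bar])
    fix y
    have "i4 (vector [x, y, 1]) = y^4 + (x^2 + x + 1) * y^2 + (x^2 + x) * y + (x^2 + x + 1)^2"
      by (simp add: i4_def vector_3 F2bar_square_add)
         (simp add: algebra_simps power2_eq_square power4_eq_xxxx)
    then show "poly ([:a3 * x^2 + a4 * x + a5, a1 * x + a2, a0:] * [:b3 * x^2 + b4 * x + b5, b1 * x + b2, b0:]) y
      = poly [:(x^2 + x + 1)^2, x^2 + x, x^2 + x + 1, 0, 1:] y"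
      using ab[of "vector [x, y, 1]"] a[of x y 1] b[of x y 1]
      by (simp add: algebra_simps power2_eq_square power4_eq_xxxx)
  qed
  have a0: "a0 * b0 = 1" using pol[of 0] by (simp add: mult.commute)
  then have nz: "a0 \<noteq> 0" "b0 \<noteq> 0" by auto
  then have b0: "b0 = 1 / a0" using a0 by (simp add: field_simps)
  define \<alpha> \<beta> where "\<alpha> = a1 / a0" and "\<beta> = a2 / a0"
  define c1 c2 c3 where "c1 = a3 / a0" and "c2 = a4 / a0" and "c3 = a5 / a0"
  have split: "\<exists>q'. \<alpha> * x + \<beta> = (b1 * x + b2) * a0 \<and> q + q' + (\<alpha> * x + \<beta>)^2 = x^2 + x + 1 \<and>
      (\<alpha> * x + \<beta>) * (q + q') = x^2 + x \<and> q * q' = (x^2 + x + 1)^2"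
    if q: "q = c1 * x^2 + c2 * x + c3" for x q
  proof -
    define q' where "q' = a0 * (b3 * x^2 + b4 * x + b5)"
    have "a0 * (b1 * x + b2) + (a1 * x + a2) * b0 = 0" using pol[of x] by (simp add: algebra_simps)
    then have p: "\<alpha> * x + \<beta> = (b1 * x + b2) * a0"
      by (simp add: F2bar_add_eq_0 b0 \<alpha>_def \<beta>_def add_divide_distrib algebra_simps)
    have p': "a1 * x + a2 = a0 * (\<alpha> * x + \<beta>)" "b1 * x + b2 = (\<alpha> * x + \<beta>) / a0"
      using nz p by (simp_all add: \<alpha>_def \<beta>_def field_simps)
    have q1: "a3 * x^2 + a4 * x + a5 = a0 * q" "b3 * x^2 + b4 * x + b5 = q' / a0"
      using nz by (simp_all add: q q'_def c1_def c2_def c3_def field_simps)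
    show ?thesis
    proof (intro exI conjI)
      show "\<alpha> * x + \<beta> = (b1 * x + b2) * a0" by (rule p)
      show "q + q' + (\<alpha> * x + \<beta>)^2 = x^2 + x + 1" "(\<alpha> * x + \<beta>) * (q + q') = x^2 + x"
        "q * q' = (x^2 + x + 1)^2"
        using pol[of x, unfolded p' q1 b0] nz
        by (simp_all add: field_simps power2_eq_square)
    qed
  qed
  have "(\<alpha> * x + \<beta>) * (x^2 + x + 1 + (\<alpha> * x + \<beta>)^2) = x^2 + x" for x
    using split[OF refl, of x] by (metis (no_types, lifting) F2bar_diff add_diff_cancel_right')
  then have "[:\<beta> + \<beta> * \<beta>^2, \<alpha> + \<alpha> * \<beta>^2 + \<beta>, \<alpha> + \<beta> + \<beta> * \<alpha>^2, \<alpha> + \<alpha> * \<alpha>^2:] = [:0, 1, 1:]"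
    by (intro poly_eq_infinite[OF inf_F2bar])
       (simp add: F2bar_square_add, simp add: algebra_simps power2_eq_square)
  then have e: "\<beta> + \<beta> * \<beta>^2 = 0" "\<alpha> + \<alpha> * \<beta>^2 + \<beta> = 1" "\<alpha> + \<beta> + \<beta> * \<alpha>^2 = 1" "\<alpha> + \<alpha> * \<alpha>^2 = 0"
    by auto
  have "\<beta> = 0 \<or> \<beta>^2 = 1" "\<alpha> = 0 \<or> \<alpha>^2 = 1" using e(1,4) by (auto simp: F2bar_add_eq_0)
  moreover have one: "x = 1" if "x^2 = 1" for x :: F2bar
    using that F2bar_square_add[of x 1] by (simp add: F2bar_add_eq_0)
  ultimately have ab01: "\<beta> = 0 \<or> \<beta> = 1" "\<alpha> = 0 \<or> \<alpha> = 1" by auto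
  \<comment> \<open>\<open>q'\<close> is eliminated through
    \<open>q + q' = x^2 + x + 1 + p^2\<close>.\<close>
  have Q: "(c1 * x^2 + c2 * x + c3) * (x^2 + x + 1 + (\<alpha> * x + \<beta>)^2 + (c1 * x^2 + c2 * x + c3))
      = (x^2 + x + 1)^2" for x
  proof -
    let ?q = "c1 * x^2 + c2 * x + c3"
    obtain q' where "?q + q' + (\<alpha> * x + \<beta>)^2 = x^2 + x + 1" "?q * q' = (x^2 + x + 1)^2"
      using split[OF refl, of x] by blast
    moreover from this have "q' = x^2 + x + 1 + (\<alpha> * x + \<beta>)^2 + ?q"
      by (metis F2bar_diff add_diff_cancel_right' add_diff_cancel_left')
    ultimately show ?thesis by simp
  qed
  have "[:c3 * (1 + \<beta>^2 + c3), c2 * (1 + \<beta>^2) + c3, c1 * (1 + \<beta>^2) + c2 + c2^2 + c3 * (1 + \<alpha>^2),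
      c1 + c2 * (1 + \<alpha>^2), c1 * (1 + \<alpha>^2 + c1):] = [:1, 0, 1, 0, 1:]"
    by (rule poly_eq_infinite[OF inf_F2bar])
       (use Q in \<open>simp add: F2bar_square_add\<close>, simp add: algebra_simps power2_eq_square power4_eq_xxxx)
  then have "c3 * (1 + \<beta>^2 + c3) = 1" "c2 * (1 + \<beta>^2) + c3 = 0" "c1 + c2 * (1 + \<alpha>^2) = 0"
      "c1 * (1 + \<alpha>^2 + c1) = 1" by auto
  then show False using ab01 e by auto
qed

lemma irreducible_i4: "irreducible_form i4"
  unfolding irreducible_form_def
proof (intro allI impI)
  fix i j a b assume a: "form i a" and b: "form j b" and ab: "\<forall>v. i4 v = a v * b v"
  have "form (i + j) i4" using form_mult[OF a b] ab by (simp add: ext[of i4 "\<lambda>v. a v * b v"])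
  then have ij: "i + j = 4" using form_degree_unique[OF inf_F2bar _ form_i4, of "i + j" "axis 2 1"] by simp
  consider "i = 0" | "j = 0" | "i = 1" | "j = 1" | "i = 2" "j = 2" using ij by linarith
  then show "i = 0 \<or> j = 0"
  proof cases
    case 3
    then obtain l where "\<forall>v. a v = lin_form l v" using form_1 a by blast
    then show ?thesis using i4_no_linear_factor[of l b] ab by simp
  next
    case 4
    then obtain l where "\<forall>v. b v = lin_form l v" using form_1 b by blast
    then show ?thesis using i4_no_linear_factor[of l a] ab by (simp add: mult.commute)
  next
    case 5
    then show ?thesis using i4_no_quadratic_factor[of a b] a b ab by simp
  qed auto
qed

section \<open>The cone over the invariant quartic and its vanishing ideal\<close>

definition on_D :: "F2bar^3 \<Rightarrow> bool" where
  "on_D v \<longleftrightarrow> v \<noteq> 0 \<and> i4 v = 0"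

lemma split_form_mult: "split_form w m r \<Longrightarrow> split_form w n s \<Longrightarrow> split_form w (m + n) (\<lambda>v. r v * s v)"
proof (induction rule: split_form.induct)
  case (split_const c)
  show ?case using split_const(2)
  proof (induction rule: split_form.induct)
    case (split_const d)
    then show ?case using split_form.split_const[of "c * d" w] \<open>c \<noteq> 0\<close> by simp
  next
    case (split_mult l n r)
    then show ?case using split_form.split_mult[OF split_mult(1,2,4)] by (simp add: mult_ac)
  qed
next
  case (split_mult l n r)
  then show ?case using split_form.split_mult[OF split_mult(1,2) split_mult(4)] by (simp add: mult_ac)
qed

lemma split_form_translate: "split_form w n r \<Longrightarrow> r (v + t *s w) = r v"
  by (induction rule: split_form.induct) (simp_all add: lin_form_simps)

lemma split_form_nonzero: "split_form (w :: F2bar^3) n r \<Longrightarrow> \<exists>v. r v \<noteq> 0"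
proof (induction rule: split_form.induct)
  case (split_mult l n r)
  obtain u where "lin_form l u = 1" using lin_form_normalise[OF split_mult(1)] .
  then show ?case
    using form_mult_zero[OF inf_F2bar form_lin[of l] split_form_form[OF split_mult(3)]] split_mult(4)
    by (metis zero_neq_one)
qed auto

text \<open>The form is constant in the direction \<open>(0,1,0)\<close>, and every line in this
  direction meets the quartic by \<open>i4_root\<close>. The extra factor \<open>v $ 1\<close> keeps
  the point found away from the zero vector.\<close>

lemma split_form_on_D:
  assumes "split_form (axis 2 1) n r" shows "\<exists>v. on_D v \<and> r v \<noteq> 0"
proof -
  obtain v where v: "v $ 1 * r v \<noteq> 0"
    using form_mult_zero[OF inf_F2bar form_coord[of 1] split_form_form[OF assms]]
      split_form_nonzero[OF assms] by (metis (no_types) axis_nth zero_neq_one)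
  obtain t where t: "i4 (v + t *s axis 2 1) = 0" using i4_root[of "axis 2 1" v] by auto
  have "(v + t *s axis 2 1) $ 1 \<noteq> 0" using v by (simp add: axis_def)
  then have "v + t *s axis 2 1 \<noteq> 0" by (metis zero_index)
  then show ?thesis using v t split_form_translate[OF assms, of v t] unfolding on_D_def
    by (intro exI[of _ "v + t *s axis 2 1"]) auto
qed

lemma on_D_exists: "\<exists>v. on_D v"
  using split_form_on_D[OF split_const[of 1]] by auto

lemma i4_bezout:
  assumes "form n W"
  shows "(\<exists>U. form (n - 4) U \<and> (n < 4 \<longrightarrow> (\<forall>v. U v = 0)) \<and> (\<forall>v. W v = i4 v * U v)) \<or>
    (\<exists>m r i s j t. split_form (axis 2 1) m r \<and> form i s \<and> form j t \<and> i + 4 = m \<and> j + n = m \<and>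
      (\<forall>v. r v = s v * i4 v + t v * W v))"
  by (rule form_bezout[OF form_i4 _ _ irreducible_i4 assms]) auto

text \<open>The Nullstellensatz for the quartic: otherwise elimination would produce a product of
  lines through \<open>(0,1,0)\<close> that vanishes on the whole curve.\<close>

lemma vanish_on_D:
  assumes "form n f" and 0: "\<And>v. on_D v \<Longrightarrow> f v = 0"
  shows "\<exists>u. form (n - 4) u \<and> (n < 4 \<longrightarrow> (\<forall>v. u v = 0)) \<and> (\<forall>v. f v = i4 v * u v)"
  using i4_bezout[OF assms(1)]
proof
  assume "\<exists>m r i s j t. split_form (axis 2 1) m r \<and> form i s \<and> form j t \<and> i + 4 = m \<and> j + n = m \<and>
      (\<forall>v. r v = s v * i4 v + t v * f v)"
  then obtain m r s t where r: "split_form (axis 2 1) m r" "\<And>v. r v = s v * i4 v + t v * f v" by blast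
  then obtain v where "on_D v" "r v \<noteq> 0" using split_form_on_D by blast
  then show ?thesis using r(2)[of v] 0[of v] by (simp add: on_D_def)
qed

lemma vanish_on_D_low_degree:
  assumes "form n f" "n < 4" "\<And>v. on_D v \<Longrightarrow> f v = 0" shows "f v = 0"
  using vanish_on_D[OF assms(1,3)] assms(2) by auto

text \<open>Irreducibility of the curve. If neither factor vanishes on it, each has a multiple that
  agrees on the curve with a product of lines through \<open>(0,1,0)\<close>, and the product of
  these two is again of this kind.\<close>

lemma mult_vanish_on_D:
  assumes f: "form m f" and g: "form n g" and 0: "\<And>v. on_D v \<Longrightarrow> f v * g v = 0"
  shows "(\<forall>v. on_D v \<longrightarrow> f v = 0) \<or> (\<forall>v. on_D v \<longrightarrow> g v = 0)"
proof (rule ccontr)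
  assume neg: "\<not> ?thesis"
  have "\<exists>k r t. split_form (axis 2 1) k r \<and> (\<forall>v. on_D v \<longrightarrow> r v = t v * h v)"
    if h: "form l h" and nz: "\<not> (\<forall>v. on_D v \<longrightarrow> h v = 0)" for l h
  proof -
    from i4_bezout[OF h] show ?thesis
    proof
      assume "\<exists>U. form (l - 4) U \<and> (l < 4 \<longrightarrow> (\<forall>v. U v = 0)) \<and> (\<forall>v. h v = i4 v * U v)"
      then have "\<forall>v. on_D v \<longrightarrow> h v = 0" by (auto simp: on_D_def)
      with nz show ?thesis by blast
    next
      assume "\<exists>m r i s j t. split_form (axis 2 1) m r \<and> form i s \<and> form j t \<and> i + 4 = m \<and>
        j + l = m \<and> (\<forall>v. r v = s v * i4 v + t v * h v)"
      then obtain m r s t where r: "split_form (axis 2 1) m r" "\<And>v. r v = s v * i4 v + t v * h v"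
        by blast
      have "\<forall>v. on_D v \<longrightarrow> r v = t v * h v" using r(2) by (simp add: on_D_def)
      then show ?thesis using r(1) by blast
    qed
  qed
  note split = this
  obtain k r t where r: "split_form (axis 2 1) k r" "\<And>v. on_D v \<Longrightarrow> r v = t v * f v"
    using split[OF f] neg by blast
  obtain l s u where s: "split_form (axis 2 1) l s" "\<And>v. on_D v \<Longrightarrow> s v = u v * g v"
    using split[OF g] neg by blast
  obtain v where "on_D v" "r v * s v \<noteq> 0" using split_form_on_D[OF split_form_mult[OF r(1) s(1)]] by blast
  then show False using r(2) s(2) 0[of v] by auto
qed

text \<open>Density: an identity on a nonempty open part of the curve holds on all of it.\<close>

lemma cancel_on_D:
  assumes "form m f" "form n g" "form n h" and "on_D p" "f p \<noteq> 0"
    and "\<And>v. on_D v \<Longrightarrow> f v \<noteq> 0 \<Longrightarrow> g v = h v" and "on_D v"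
  shows "g v = h v"
  using mult_vanish_on_D[OF assms(1) form_diff[OF assms(2,3)]] assms(4-7) by force

subsection \<open>Regular functions are forms\<close>

text \<open>These are the sections of \<open>O(e)\<close>, seen as functions on the cone: locally
  quotients of forms whose degrees differ by \<open>e\<close>, written without division.\<close>

definition regular :: "nat \<Rightarrow> (F2bar^3 \<Rightarrow> F2bar) \<Rightarrow> bool" where
  "regular e h \<longleftrightarrow> (\<forall>p. on_D p \<longrightarrow> (\<exists>n a b. form (n + e) a \<and> form n b \<and> b p \<noteq> 0 \<and>
     (\<forall>v. on_D v \<longrightarrow> b v * h v = a v)))"

lemma regularI:
  assumes "\<And>p. on_D p \<Longrightarrow> \<exists>n a b. form (n + e) a \<and> form n b \<and> b p \<noteq> 0 \<and>
     (\<forall>v. on_D v \<longrightarrow> b v \<noteq> 0 \<longrightarrow> b v * h v = a v)"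
  shows "regular e h"
  unfolding regular_def
proof (intro allI impI)
  fix p assume p: "on_D p"
  obtain n a b where ab: "form (n + e) a" "form n b" "b p \<noteq> 0"
    "\<forall>v. on_D v \<longrightarrow> b v \<noteq> 0 \<longrightarrow> b v * h v = a v" using assms[OF p] by (elim exE conjE)
  \<comment> \<open>One more factor \<open>b\<close> makes the identity true at the zeros of
    \<open>b\<close> as well.\<close>
  have "form (n + n + e) (\<lambda>v. b v * a v)" by (rule form_cong[OF form_mult[OF ab(2,1)]]) auto
  moreover have "form (n + n) (\<lambda>v. b v * b v)" by (rule form_mult[OF ab(2,2)])
  moreover have "\<forall>v. on_D v \<longrightarrow> b v * b v * h v = b v * a v"
    using ab(4) by (metis mult.assoc mult_zero_left)
  ultimately show "\<exists>n a b. form (n + e) a \<and> form n b \<and> b p \<noteq> 0 \<and> (\<forall>v. on_D v \<longrightarrow> b v * h v = a v)"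
    using ab(3) by (intro exI[of _ "n + n"] exI[of _ "\<lambda>v. b v * a v"] exI[of _ "\<lambda>v. b v * b v"]) simp
qed

lemma regularD:
  assumes "regular e h" "on_D p"
  shows "\<exists>n a b. form (n + e) a \<and> form n b \<and> b p \<noteq> 0 \<and> (\<forall>v. on_D v \<longrightarrow> b v * h v = a v)"
  using assms unfolding regular_def by simp

lemma regular_mult_form:
  assumes "regular e h" and r: "form k r" shows "regular (e + k) (\<lambda>v. r v * h v)"
  unfolding regular_def
proof (intro allI impI)
  fix p assume p: "on_D p"
  obtain n a b where ab: "form (n + e) a" "form n b" "b p \<noteq> 0"
    "\<forall>v. on_D v \<longrightarrow> b v * h v = a v"
      using regularD[OF assms(1) p] by (elim exE conjE)
  have "form (n + (e + k)) (\<lambda>v. r v * a v)" by (rule form_cong[OF form_mult[OF r ab(1)]]) auto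
  moreover have "\<forall>v. on_D v \<longrightarrow> b v * (r v * h v) = r v * a v" using ab(4) by (simp add: mult.left_commute)
  ultimately show "\<exists>n a b. form (n + (e + k)) a \<and> form n b \<and> b p \<noteq> 0 \<and>
      (\<forall>v. on_D v \<longrightarrow> b v * (r v * h v) = a v)" using ab(2,3) by blast
qed

text \<open>On the affine line \<open>w + t e2\<close> the coordinate \<open>v $ 2\<close> is
  \<open>t\<close> and \<open>l\<close> is 1, so \<open>l\<close> serves to homogenize.\<close>

lemma form_lift:
  assumes w: "w $ 2 = 0" "lin_form l w = 1" "l $ 2 = 0" and "degree q \<le> n"
  shows "\<exists>Q. form n Q \<and> (\<forall>t. Q (w + t *s axis 2 1) = poly q t)"
  using assms(4)
proof (induction q arbitrary: n)
  case 0
  then show ?case using form_zero[of n] by (intro exI[of _ "\<lambda>v. 0"]) auto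
next
  case (pCons c q)
  have l: "lin_form l (w + t *s axis 2 1) = 1" for t
    using w by (simp add: lin_form_simps lin_form_axis)
  show ?case
  proof (cases "q = 0")
    case True
    then show ?thesis using l form_cmult[OF form_linpow[of n l], of c]
      by (intro exI[of _ "\<lambda>v. c * lin_form l v ^ n"]) simp
  next
    case False
    then obtain n' where n: "n = Suc n'" "degree q \<le> n'" using pCons.prems by (cases n) auto
    then obtain Q where Q: "form n' Q" "\<forall>t. Q (w + t *s axis 2 1) = poly q t" using pCons.IH by blast
    have "form n (\<lambda>v. v $ 2 * Q v)" by (rule form_cong[OF form_mult[OF form_coord Q(1)]]) (use n in auto)
    from form_add[OF form_cmult[OF form_linpow[of n l], of c] this]
    show ?thesis using l Q(2) w(1)
      by (intro exI[of _ "\<lambda>v. c * lin_form l v ^ n + v $ 2 * Q v"]) simp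
  qed
qed

text \<open>Divisibility may be tested in the local rings at the roots of \<open>p\<close>: after
  division by the gcd, a root left over in \<open>p\<close> would also be a root of the local
  denominator \<open>b\<close>.\<close>

lemma poly_dvd_by_local_multiples:
  fixes p q :: "'a::{alg_closed_field, field_gcd} poly"
  assumes p: "p \<noteq> 0" and loc: "\<And>t. poly p t = 0 \<Longrightarrow> \<exists>b c. poly b t \<noteq> 0 \<and> b * q = p * c"
  shows "p dvd q"
proof -
  define g where "g = gcd p q"
  have g0: "g \<noteq> 0" using p by (simp add: g_def)
  obtain d e where de: "p = d * g" "q = e * g" "coprime d e"
    using gcd_coprime_exists[of p q] p unfolding g_def by auto
  have "degree d = 0"
  proof (rule ccontr)
    assume "degree d \<noteq> 0"
    then obtain t where t: "poly d t = 0" using alg_closed_imp_poly_has_root by blast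
    then obtain b c where bc: "poly b t \<noteq> 0" "b * q = p * c" using loc[of t] de(1) by auto
    have "(b * e) * g = (d * c) * g" using bc(2) by (simp add: de(1,2) mult_ac)
    then have "b * e = d * c" using g0 by simp
    then have "d dvd e * b" by (metis dvd_triv_left mult.commute)
    then have "d dvd b" using de(3) by (simp add: coprime_dvd_mult_right_iff)
    then show False using t bc(1) by (auto elim!: dvdE)
  qed
  then have "d dvd 1" using p de(1) by (auto elim!: degree_eq_zeroE simp: is_unit_const_poly_iff dvd_field_iff)
  then show ?thesis using de by (metis dvd_triv_right mult_unit_dvd_iff')
qed

text \<open>Since \<open>h\<close> is regular, \<open>a\<close> vanishes on the intersection of the
  line \<open>m = 0\<close> with the quartic, multiplicities included. So \<open>a\<close> agrees
  with some \<open>i4 Q\<close> on this line; subtracting it leaves a multiple of \<open>m\<close>,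
  and the quotient is the form sought.\<close>

lemma regular_divide_linear:
  assumes h: "regular e h" and a: "form (e + 1) a" and m: "m \<noteq> 0" "lin_form m (axis 2 1) = 0"
    and eq: "\<And>v. on_D v \<Longrightarrow> lin_form m v * h v = a v"
  shows "\<exists>H. form e H \<and> (\<forall>v. on_D v \<longrightarrow> h v = H v)"
proof -
  let ?e2 = "axis 2 1 :: F2bar^3"
  have m2: "m $ 2 = 0" using m(2) by (simp add: lin_form_axis)
  define w :: "F2bar^3" where "w = vector [m $ 3, 0, m $ 1]"
  have w2: "w $ 2 = 0" and mw: "lin_form m w = 0" using m2 by (simp_all add: w_def vector_3 lin_form_3 mult.commute)
  have "w \<noteq> 0" using m(1) m2 by (auto simp: w_def vec_eq_iff forall_3 vector_3)
  then obtain u where u: "lin_form w u = 1" using lin_form_normalise by blast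
  define l where "l = u - u $ 2 *s ?e2"
  have l: "lin_form l w = 1" "l $ 2 = 0" "lin_form l ?e2 = 0"
    using u w2 by (simp_all add: l_def lin_form_axis lin_form_simps lin_form_diff_left lin_form_commute[of u])
  have span: "v = lin_form l v *s w + v $ 2 *s ?e2" if v: "lin_form m v = 0" for v
  proof -
    have eqs: "m $ 1 * v $ 1 = m $ 3 * v $ 3" using v m2 by (simp add: lin_form_3 F2bar_add_eq_0)
    have "m $ 1 \<noteq> 0 \<or> m $ 3 \<noteq> 0" using m(1) m2 by (auto simp: vec_eq_iff forall_3)
    then obtain k where k: "v $ 1 = k * m $ 3" "v $ 3 = k * m $ 1"
    proof
      assume "m $ 1 \<noteq> 0"
      then show ?thesis using eqs by (intro that[of "v $ 3 / m $ 1"]) (auto simp: field_simps)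
    next
      assume "m $ 3 \<noteq> 0"
      then show ?thesis using eqs by (intro that[of "v $ 1 / m $ 3"]) (auto simp: field_simps)
    qed
    have kv: "v = k *s w + v $ 2 *s ?e2"
      by (simp add: vec_eq_iff forall_3 w_def vector_3 k axis_def)
    have "lin_form l v = k" by (subst kv) (simp add: lin_form_simps l)
    then show ?thesis using kv by simp
  qed
  have ne: "w + t *s ?e2 \<noteq> 0" for t
  proof
    assume "w + t *s ?e2 = 0"
    then have "lin_form l (w + t *s ?e2) = 0" by simp
    then show False by (simp add: lin_form_simps l)
  qed
  define pI where "pI = i4_line w ?e2"
  have pI: "poly pI t = i4 (w + t *s ?e2)" for t by (simp add: pI_def i4_line)
  have degI: "degree pI = 4" by (simp add: pI_def i4_line_def)
  obtain pa where pa: "degree pa \<le> e + 1" "\<And>t. poly pa t = a (w + t *s ?e2)" using form_line[OF a] by blast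
  have "pI dvd pa"
  proof (rule poly_dvd_by_local_multiples)
    fix t assume "poly pI t = 0"
    then have D: "on_D (w + t *s ?e2)" using ne by (simp add: on_D_def pI)
    obtain n c b where b: "form (n + e) c" "form n b" "b (w + t *s ?e2) \<noteq> 0"
      "\<forall>v. on_D v \<longrightarrow> b v * h v = c v"
      using regularD[OF h D] by (elim exE conjE)
    have "form (n + (e + 1)) (\<lambda>v. b v * a v)" by (rule form_mult[OF b(2) a])
    moreover have "form (n + (e + 1)) (\<lambda>v. lin_form m v * c v)"
      by (rule form_cong[OF form_mult[OF form_lin b(1)]]) auto
    ultimately have "form (n + (e + 1)) (\<lambda>v. b v * a v - lin_form m v * c v)" by (rule form_diff)
    moreover have "b v * a v - lin_form m v * c v = 0" if "on_D v" for v
      using b(4)[rule_format, OF that] eq[OF that] by (metis mult.left_commute right_minus_eq)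
    ultimately obtain k g where g: "form k g" "\<forall>v. b v * a v - lin_form m v * c v = i4 v * g v"
      using vanish_on_D by meson
    obtain pb where pb: "\<And>t. poly pb t = b (w + t *s ?e2)" using form_line[OF b(2)] by blast
    obtain pg where pg: "\<And>t. poly pg t = g (w + t *s ?e2)" using form_line[OF g(1)] by blast
    have "pb * pa = pI * pg"
    proof (rule poly_eq_infinite[OF inf_F2bar])
      fix s show "poly (pb * pa) s = poly (pI * pg) s"
        using g(2)[rule_format, of "w + s *s ?e2"] by (simp add: pa pb pg pI lin_form_simps mw m(2))
    qed
    moreover have "poly pb t \<noteq> 0" using b(3) pb by simp
    ultimately show "\<exists>b c. poly b t \<noteq> 0 \<and> b * pa = pI * c" by blast
  qed (use degI in auto)
  then obtain q where q: "pa = pI * q" by (elim dvdE)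
  \<comment> \<open>If \<open>q\<close> is nonzero, the degree 4 of \<open>pI\<close> forces
    \<open>degree q \<le> e - 3\<close>; the zero case is separate because \<open>e\<close> may then
    be smaller than 3.\<close>
  obtain Q where Q: "form (e + 1) (\<lambda>v. i4 v * Q v)" "\<And>t. Q (w + t *s ?e2) = poly q t"
  proof (cases "q = 0")
    case True
    then show ?thesis using form_zero[of "e + 1"] by (intro that[of "\<lambda>v. 0"]) auto
  next
    case False
    moreover have "pI \<noteq> 0" using degI by auto
    ultimately have "degree pa = 4 + degree q" using degI by (simp add: q degree_mult_eq)
    then have d: "degree q \<le> e - 3" "3 \<le> e" using pa(1) by auto
    then obtain Q where Q: "form (e - 3) Q" "\<forall>t. Q (w + t *s ?e2) = poly q t"
      using form_lift[OF w2 l(1,2)] by blast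
    have "form (e + 1) (\<lambda>v. i4 v * Q v)"
      by (rule form_cong[OF form_mult[OF form_i4 Q(1)]]) (use d in auto)
    then show ?thesis using Q(2) that by blast
  qed
  define f where "f = (\<lambda>v. a v - i4 v * Q v)"
  have f: "form (e + 1) f" unfolding f_def by (rule form_diff[OF a Q(1)])
  have f1: "f (w + t *s ?e2) = 0" for t
    using pa(2)[of t] pI[of t] Q(2)[of t] by (simp add: f_def q)
  \<comment> \<open>The affine line misses its direction vector \<open>e2\<close>; homogeneity and
    the infinitude of the field reach it.\<close>
  have f2: "f ?e2 = 0"
  proof -
    obtain p where p: "\<And>t. poly p t = f (?e2 + t *s w)" using form_line[OF f] by blast
    have "p = 0"
    proof (rule poly_eq_infinite[OF inf_F2bar, of 0])
      fix t :: F2bar assume "t \<noteq> 0"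
      then have "?e2 + t *s w = t *s (w + (1 / t) *s ?e2)" by (simp add: vector_add_ldistrib)
      then have "f (?e2 + t *s w) = t ^ (e + 1) * f (w + (1 / t) *s ?e2)"
        using form_homog[OF f] by metis
      then show "poly p t = poly 0 t" using p[of t] f1 by simp
    qed
    then show ?thesis using p[of 0] by simp
  qed
  have fL: "f v = 0" if "lin_form m v = 0" for v
  proof (cases "lin_form l v = 0")
    case True
    then have "v = v $ 2 *s ?e2" using span[OF that] by simp
    then show ?thesis using form_homog[OF f, of "v $ 2" ?e2] f2 by simp
  next
    case False
    then have "v = lin_form l v *s (w + (v $ 2 / lin_form l v) *s ?e2)"
      using span[OF that] by (simp add: vector_add_ldistrib)
    then show ?thesis using form_homog[OF f] f1 by (metis mult_zero_right)
  qed
  obtain H where H: "form e H" "\<And>v. f v = lin_form m v * H v"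
    using form_lin_dvd[OF f m(1) fL] by auto
  have mH: "lin_form m v * h v = lin_form m v * H v" if "on_D v" for v
    using eq[OF that] H(2)[of v] that by (simp add: f_def on_D_def)
  obtain p0 where p0: "on_D p0" "lin_form m p0 \<noteq> 0"
    using vanish_on_D_low_degree[OF form_lin] lin_form_normalise[OF m(1)] 
    by (metis one_less_numeral_iff semiring_norm(76) zero_neq_one)
  have "h p = H p" if p: "on_D p" for p
  proof -
    obtain n c b where b: "form (n + e) c" "form n b" "b p \<noteq> 0"
      "\<forall>v. on_D v \<longrightarrow> b v * h v = c v"
      using regularD[OF h p] by (elim exE conjE)
    have "b p * H p = c p"
    proof (rule cancel_on_D[OF form_lin form_mult[OF b(2) H(1)] b(1) p0])
      fix v assume "on_D v" "lin_form m v \<noteq> 0"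
      then show "b v * H v = c v" using mH[of v] b(4)[rule_format, of v] by simp
    qed (rule p)
    then show ?thesis using b(3) b(4)[rule_format, OF p] by (metis mult_left_cancel)
  qed
  then show ?thesis using H(1) by blast
qed

lemma regular_divide_split:
  assumes "split_form (axis 2 1) m r" "regular e h" "form (m + e) a" "\<And>v. on_D v \<Longrightarrow> r v * h v = a v"
  shows "\<exists>H. form e H \<and> (\<forall>v. on_D v \<longrightarrow> h v = H v)"
  using assms
proof (induction arbitrary: a rule: split_form.induct)
  case (split_const c)
  then have "form e (\<lambda>v. (1 / c) * a v)" using form_cmult[of e a "1 / c"] by simp
  moreover have "\<forall>v. on_D v \<longrightarrow> h v = (1 / c) * a v" using split_const by (auto simp: field_simps)
  ultimately show ?case by blast
next
  case (split_mult l n r)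
  have "regular (e + n) (\<lambda>v. r v * h v)"
    by (rule regular_mult_form[OF split_mult.prems(1) split_form_form[OF split_mult.hyps(3)]])
  then obtain H where H: "form (e + n) H" "\<forall>v. on_D v \<longrightarrow> r v * h v = H v"
    using regular_divide_linear[of "e + n" "\<lambda>v. r v * h v" a l] split_mult by (auto simp: add.commute mult.assoc)
  then show ?case using split_mult.IH[OF split_mult.prems(1), of H] by (auto simp: add.commute)
qed

text \<open>Elimination turns one local denominator \<open>b\<close> into a global one that is a
  product of lines through \<open>(0,1,0)\<close>; \<open>regular_divide_split\<close> cancels these
  lines one at a time.\<close>

theorem regular_imp_form:
  assumes h: "regular e h" shows "\<exists>H. form e H \<and> (\<forall>v. on_D v \<longrightarrow> h v = H v)"
proof -
  obtain p where p: "on_D p" using on_D_exists by blast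
  obtain n a b where b: "form (n + e) a" "form n b" "b p \<noteq> 0"
      "\<forall>v. on_D v \<longrightarrow> b v * h v = a v"
      using regularD[OF h p] by (elim exE conjE)
  have "\<not> (\<forall>v. b v = i4 v * U v)" for U using p b(3) by (auto simp: on_D_def intro!: exI[of _ p])
  then obtain m r i s j t where r: "split_form (axis 2 1) m r" "form j t" "j + n = m"
      "\<And>v. r v = s v * i4 v + t v * b v" using i4_bezout[OF b(2)] by blast
  have "form (m + e) (\<lambda>v. t v * a v)"
    by (rule form_cong[OF form_mult[OF r(2) b(1)]]) (use r(3) in auto)
  moreover have "r v * h v = t v * a v" if "on_D v" for v
    using r(4)[of v] b(4)[rule_format, OF that] that by (simp add: on_D_def mult.assoc)
  ultimately show ?thesis using regular_divide_split[OF r(1) h] by blast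
qed

section \<open>Isomorphisms onto plane quartics are linear\<close>

subsection \<open>Points and cross products\<close>

lemma point_eq_iff:
  assumes "u \<noteq> 0" "v \<noteq> 0" shows "point u = point v \<longleftrightarrow> (\<exists>c. v = c *s u)"
proof -
  have "proportional u u" "proportional v v"
    using assms unfolding proportional_def by (auto intro: exI[of _ 1])
  then have "point u = point v \<longleftrightarrow> proportional u v"
    using Quotient3_rel[OF Quotient3_proj2, of u v] by blast
  then show ?thesis using assms unfolding proportional_def by blast
qed

lemma coords_nonzero [simp]: "coords p \<noteq> 0"
  using Quotient3_rep_reflp[OF Quotient3_proj2, of p] unfolding proportional_def by blast

lemma point_coords [simp]: "point (coords p) = p"
  by (rule Quotient3_abs_rep[OF Quotient3_proj2])

lemma cross_scale: "cross (a *s u) v = a *s cross u v" "cross u (a *s v) = a *s cross u v"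
  by (simp_all add: vec_eq_iff forall_3 algebra_simps)

lemma cross_self [simp]: "cross u u = 0"
  by (simp add: vec_eq_iff forall_3 algebra_simps)

lemma lin_form_cross: "lin_form (cross u v) u = 0" "lin_form (cross u v) v = 0"
  by (simp_all add: lin_form_3 algebra_simps)

lemma cross_cross: "cross (cross a b) x = lin_form a x *s b - lin_form b x *s a"
  by (simp add: vec_eq_iff forall_3 lin_form_3 algebra_simps)

lemma cross_eq_0_iff:
  fixes u v :: "'a::field^3"
  assumes "u \<noteq> 0" shows "cross u v = 0 \<longleftrightarrow> (\<exists>c. v = c *s u)"
proof
  assume 0: "cross u v = 0"
  obtain x where x: "lin_form u x = 1" using lin_form_normalise[OF assms] .
  have "cross (cross u v) x = v - lin_form v x *s u" by (simp add: cross_cross x)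
  moreover have "cross (cross u v) x = 0" by (simp add: 0 vec_eq_iff forall_3)
  ultimately show "\<exists>c. v = c *s u" by (intro exI[of _ "lin_form v x"]) simp
qed (auto simp: cross_scale)

lemma orthogonal_imp_cross:
  fixes a b x :: "'a::field^3"
  assumes "cross a b \<noteq> 0" "lin_form x a = 0" "lin_form x b = 0" shows "\<exists>k. x = k *s cross a b"
  using cross_cross[of a b x] assms cross_eq_0_iff[OF assms(1)]
  by (simp add: lin_form_commute[of x])

lemma vpow_scale: "vpow n (c *s v) = c ^ n *s vpow n (v :: 'a::comm_semiring_1^3)"
  by (simp add: vec_eq_iff power_mult_distrib)

lemma i4_sq: "i4 (sq v) = (i4 v)\<^sup>2"
  by (simp add: i4_def F2bar_square_add power_mult_distrib flip: power_mult)

lemma sq_nonzero: "v \<noteq> 0 \<Longrightarrow> sq (v :: F2bar^3) \<noteq> 0"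
  by (auto simp: vec_eq_iff)

lemma on_D_sq: "on_D v \<Longrightarrow> on_D (sq v)"
  by (simp add: on_D_def i4_sq sq_nonzero)

lemma i4_smooth_aux:
  fixes x y z :: F2bar
  assumes "y = 0 \<or> z = 0 \<or> y = z" "z = 0 \<or> x = 0 \<or> z = x" "x = 0 \<or> y = 0 \<or> x = y"
    and "x^4 + y^4 + z^4 + x^2 * y^2 + y^2 * z^2 + z^2 * x^2
     + x^2 * y * z + x * y^2 * z + x * y * z^2 = 0"
  shows "x = 0 \<and> y = 0 \<and> z = 0"
  using assms(1-3)
proof (elim disjE)
qed (use assms(4) in \<open>auto simp: power2_eq_square power4_eq_xxxx mult.assoc\<close>)

text \<open>If \<open>v\<close> and \<open>v^2\<close> are proportional, all nonzero coordinates of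
  \<open>v\<close> agree, so \<open>v\<close> is a multiple of a vector over \<open>F_2\<close>. The
  quartic takes the value 1 at each of the seven such vectors.\<close>

lemma on_D_smooth: "on_D v \<Longrightarrow> cross v (sq v) \<noteq> 0"
proof
  assume v: "on_D v" and 0: "cross v (sq v) = 0"
  have eq: "x * y^2 = y * x^2 \<longleftrightarrow> x = 0 \<or> y = 0 \<or> x = y" for x y :: F2bar
    by (auto simp: power2_eq_square)
  have "v$2 * v$3^2 = v$3 * v$2^2" "v$3 * v$1^2 = v$1 * v$3^2" "v$1 * v$2^2 = v$2 * v$1^2"
    using 0 by (auto simp: vec_eq_iff forall_3)
  then have "v$1 = 0 \<and> v$2 = 0 \<and> v$3 = 0"
    using v unfolding eq on_D_def i4_def by (intro i4_smooth_aux) auto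
  then show False using v by (simp add: on_D_def vec_eq_iff forall_3)
qed

lemma frame_of_cross:
  fixes p q :: "'a::{alg_closed_field, field_gcd}^3"
  assumes "cross p q \<noteq> 0"
  obtains r where "frame q p r (cross r p) (cross q r) (cross p q)"
proof -
  obtain r where r: "lin_form (cross p q) r = 1" using lin_form_normalise[OF assms] .
  have "lin_form (cross p q) r *s v =
    lin_form (cross r p) v *s q + lin_form (cross q r) v *s p + lin_form (cross p q) v *s r" for v
    by (simp add: vec_eq_iff forall_3 lin_form_3 algebra_simps)
  then have "v = lin_form (cross r p) v *s q + lin_form (cross q r) v *s p + lin_form (cross p q) v *s r" for v
    by (simp add: r)
  moreover have "lin_form (cross r p) q = 1" "lin_form (cross q r) p = 1"
    using r by (simp_all add: lin_form_3 algebra_simps)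
  ultimately have "frame q p r (cross r p) (cross q r) (cross p q)"
    by unfold_locales (simp_all add: lin_form_cross r)
  then show ?thesis using that by blast
qed

subsection \<open>Derivations of composite forms\<close>

lemma jac_component: "jac f v w $ i = lin_form (grad (\<lambda>v. f v $ i) v) w" for f :: "F2bar^3 \<Rightarrow> F2bar^3"
  by (simp add: jac_def[OF inf_F2bar])

lemma jac_compose:
  assumes "\<And>i. form n (\<lambda>v::F2bar^3. (u v :: F2bar^3) $ i)" "\<And>i. form d (\<lambda>v::F2bar^3. (f v :: F2bar^3) $ i)"
  shows "jac (\<lambda>v. u (f v)) v w = jac u (f v) (jac f v w)"
  by (simp add: vec_eq_iff jac_component grad_compose[OF inf_F2bar assms])

lemma jac_id: "jac (\<lambda>v::F2bar^3. v) v w = w"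
  by (simp add: vec_eq_iff jac_component grad_coord[OF inf_F2bar])

lemma form_cross:
  assumes f: "\<And>i. form m (\<lambda>v. f v $ i)" and g: "\<And>i. form n (\<lambda>v. g v $ i)"
  shows "form (m + n) (\<lambda>v. cross (f v) (g v) $ i)"
  using exhaust_3[of i] form_diff[OF form_mult[OF f g] form_mult[OF f g]] by auto

lemma jac_cross:
  assumes f: "\<And>i. form m (\<lambda>v::F2bar^3. (f v :: F2bar^3) $ i)" and g: "\<And>i. form n (\<lambda>v. g v $ i)"
  shows "jac (\<lambda>v. cross (f v) (g v)) v w = cross (jac f v w) (g v) + cross (f v) (jac g v w)"
proof -
  have "lin_form (grad (\<lambda>v. f v $ i * g v $ j - f v $ k * g v $ l) v) w =
    f v $ i * jac g v w $ j + g v $ j * jac f v w $ i - (f v $ k * jac g v w $ l + g v $ l * jac f v w $ k)"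
    for i j k l
    by (simp add: jac_component grad_diff[OF inf_F2bar form_mult[OF f g] form_mult[OF f g]]
        grad_mult[OF inf_F2bar f g])
  note eq = this
  show ?thesis unfolding vec_eq_iff forall_3
    by (simp only: jac_component[of "\<lambda>v. cross (f v) (g v)"] cross_component eq vector_add_component)
       (simp add: algebra_simps)
qed

text \<open>This makes differentiation along \<open>sq v\<close> well defined for functions on the
  curve: the derivative of \<open>i4\<close> itself is zero there.\<close>

lemma grad_vanish_on_D:
  assumes "form n f" "\<And>v. on_D v \<Longrightarrow> f v = 0" "on_D v"
  shows "lin_form (grad f v) (sq v) = 0"
proof -
  obtain u where u: "form (n - 4) u" "\<forall>v. f v = i4 v * u v" using vanish_on_D[OF assms(1,2)] by blast
  have "lin_form (grad f v) (sq v) = i4 v * lin_form (grad u v) (sq v) + u v * lin_form (grad i4 v) (sq v)"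
    using grad_mult[OF inf_F2bar form_i4 u(1), of v "sq v"] u(2) by (simp add: ext[of f "\<lambda>v. i4 v * u v"])
  then show ?thesis using assms(3) by (simp add: grad_i4 lin_form_cross on_D_def)
qed

lemma grad_mult_at_common_zero:
  assumes "form m f" "form n g" "f v = 0" "g v = 0"
  shows "lin_form (grad (\<lambda>v. f v * g v :: F2bar) v) w = 0"
  by (simp add: grad_mult[OF inf_F2bar assms(1,2)] assms)

context frame
begin

text \<open>The ideal of the point \<open>ey\<close> is generated by \<open>lz\<close> and
  \<open>lx\<close>: removing the two coordinates in turn leaves \<open>ly ^ n\<close> times
  \<open>a ey\<close>, which is zero.\<close>

lemma decompose_at_zero:
  assumes a: "form n a" and 0: "a ey = 0"
  shows "\<exists>U V. form (n - 1) U \<and> form (n - 1) V \<and> (n = 0 \<longrightarrow> (\<forall>v. U v = 0) \<and> (\<forall>v. V v = 0)) \<and>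
    (\<forall>v. a v = lin_form lz v * U v + lin_form lx v * V v)"
proof -
  obtain g where g: "form (n - 1) g" "n = 0 \<longrightarrow> (\<forall>v. g v = 0)"
    "\<And>v. a v = a (v - lin_form lz v *s ez) + lin_form lz v * g v" using form_project[OF a] by metis
  obtain h where h: "form (n - 1) h" "n = 0 \<longrightarrow> (\<forall>v. h v = 0)"
    "\<And>v. a v = a (v - lin_form lx v *s ex) + lin_form lx v * h v" using form_project[OF a] by metis
  have "form 1 (\<lambda>v. (v - lin_form lx v *s ex) $ i)" for i
    using form_diff[OF form_coord form_cmult[OF form_lin[of lx], of "ex $ i"]]
    by (simp add: mult.commute)
  from form_compose[OF g(1) this] have gx: "form (n - 1) (\<lambda>v. g (v - lin_form lx v *s ex))" by simp
  have "a v = lin_form lz v * g (v - lin_form lx v *s ex) + lin_form lx v * h v" for v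
  proof -
    have z: "lin_form lz (v - lin_form lx v *s ex) = lin_form lz v" by (simp add: lin_form_simps)
    have "v - lin_form lx v *s ex - lin_form lz v *s ez = lin_form ly v *s ey"
      by (subst (1) expand[of v]) simp
    then have "a (v - lin_form lx v *s ex - lin_form lz v *s ez) = 0"
      using form_homog[OF a, of "lin_form ly v" ey] 0 by simp
    then have "a (v - lin_form lx v *s ex) = lin_form lz v * g (v - lin_form lx v *s ex)"
      using g(3)[of "v - lin_form lx v *s ex"] z by simp
    then show ?thesis using h(3)[of v] by simp
  qed
  then show ?thesis using gx h(1,2) g(2)
    by (intro exI[of _ "\<lambda>v. g (v - lin_form lx v *s ex)"] exI[of _ h]) auto
qed

text \<open>If \<open>lz\<close> is the tangent at \<open>ey\<close> and \<open>lx\<close> a local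
  parameter, this is the expansion of a function that vanishes to second order along the
  curve.\<close>

lemma decompose_at_double_zero:
  assumes a: "form n a" and 0: "a ey = 0" "lin_form (grad a ey) ex = 0"
  shows "\<exists>U V. form (n - 1) U \<and> form (n - 2) V \<and> (\<forall>v. a v = lin_form lz v * U v + (lin_form lx v)\<^sup>2 * V v)"
proof -
  note inf = infinite_alg_closed[where 'a = 'a]
  obtain U V where UV: "form (n - 1) U" "form (n - 1) V"
    "\<And>v. a v = lin_form lz v * U v + lin_form lx v * V v"
    and UV0: "n = 0 \<Longrightarrow> (\<forall>v. U v = 0) \<and> (\<forall>v. V v = 0)"
    using decompose_at_zero[OF a 0(1)] by metis
  show ?thesis
  proof (cases "n = 0")
    case True
    then show ?thesis using UV UV0 by (intro exI[of _ U] exI[of _ V]) simp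
  next
    case False
    have "lin_form (grad a ey) ex = lin_form (grad (\<lambda>v. lin_form lz v * U v + lin_form lx v * V v) ey) ex"
      using UV(3) by (simp add: ext[of a "\<lambda>v. lin_form lz v * U v + lin_form lx v * V v"])
    also have "\<dots> = V ey"
      by (simp add: grad_add[OF inf form_mult[OF form_lin UV(1)] form_mult[OF form_lin UV(2)]]
          grad_mult[OF inf form_lin UV(1)] grad_mult[OF inf form_lin UV(2)] grad_lin[OF inf])
    finally have "V ey = 0" using 0(2) by simp
    then obtain U' V' where UV': "form (n - 1 - 1) U'" "form (n - 1 - 1) V'"
      "\<And>v. V v = lin_form lz v * U' v + lin_form lx v * V' v"
      and UV0': "n - 1 = 0 \<Longrightarrow> (\<forall>v. U' v = 0) \<and> (\<forall>v. V' v = 0)"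
      using decompose_at_zero[OF UV(2)] by metis
    have "form (n - 1) (\<lambda>v. lin_form lx v * U' v)"
    proof (cases "n = 1")
      case True
      then show ?thesis using UV0' form_zero by simp
    next
      case False
      show ?thesis by (rule form_cong[OF form_mult[OF form_lin UV'(1)]]) (use False \<open>n \<noteq> 0\<close> in auto)
    qed
    then have "form (n - 1) (\<lambda>v. U v + lin_form lx v * U' v)" by (intro form_add UV)
    moreover have "a v = lin_form lz v * (U v + lin_form lx v * U' v) + (lin_form lx v)\<^sup>2 * V' v" for v
      by (simp add: UV(3) UV'(3) power2_eq_square algebra_simps)
    moreover have "form (n - 2) V'" using UV'(2) by (simp add: numeral_2_eq_2)
    ultimately show ?thesis by blast
  qed
qed

end

subsection \<open>The ideal of the image\<close>

text \<open>Only the zero set of \<open>F\<close> matters here. A proper equation of the image is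
  found in \<open>quartic_iso_min\<close>.\<close>

locale quartic_iso =
  fixes F :: "F2bar^3 \<Rightarrow> F2bar" and psi phi :: "F2bar proj2 \<Rightarrow> F2bar proj2"
  assumes F: "form 4 F" and F_nonzero: "\<exists>v. F v \<noteq> 0"
    and psi_local: "on_D p \<Longrightarrow> \<exists>e d g f. form e g \<and> (\<forall>i. form d (\<lambda>v. (f v :: F2bar^3) $ i)) \<and> g p \<noteq> 0 \<and>
      (\<forall>v. on_D v \<longrightarrow> g v \<noteq> 0 \<longrightarrow> f v \<noteq> 0 \<and> F (f v) = 0 \<and> psi (point v) = point (f v))"
    and phi_local: "y \<noteq> 0 \<Longrightarrow> F y = 0 \<Longrightarrow>
      \<exists>e d g u. form e g \<and> (\<forall>i. form d (\<lambda>v. (u v :: F2bar^3) $ i)) \<and> g y \<noteq> 0 \<and>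
      (\<forall>w. w \<noteq> 0 \<longrightarrow> F w = 0 \<longrightarrow> g w \<noteq> 0 \<longrightarrow> on_D (u w) \<and> phi (point w) = point (u w))"
    and phi_psi: "on_D v \<Longrightarrow> phi (psi (point v)) = point v"
    and psi_phi: "y \<noteq> 0 \<Longrightarrow> F y = 0 \<Longrightarrow> psi (phi (point y)) = point y"
begin

text \<open>The bound \<open>2 \<le> d\<close> keeps the subtractions \<open>d - 1\<close> and
  \<open>d - 2\<close> in later degree counts from being truncated; \<open>chart_exists\<close>
  gains it by multiplying with the square of a linear form.\<close>

definition chart :: "nat \<Rightarrow> nat \<Rightarrow> (F2bar^3 \<Rightarrow> F2bar) \<Rightarrow> (F2bar^3 \<Rightarrow> F2bar^3) \<Rightarrow> bool" where
  "chart e d g f \<longleftrightarrow> form e g \<and> (\<forall>i. form d (\<lambda>v. f v $ i)) \<and> 2 \<le> d \<and>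
    (\<forall>v. on_D v \<longrightarrow> g v \<noteq> 0 \<longrightarrow> f v \<noteq> 0 \<and> F (f v) = 0 \<and> psi (point v) = point (f v))"

lemma chartD:
  assumes "chart e d g f"
  shows "form e g" "form d (\<lambda>v. f v $ i)" "2 \<le> d"
    "on_D v \<Longrightarrow> g v \<noteq> 0 \<Longrightarrow> f v \<noteq> 0" "on_D v \<Longrightarrow> g v \<noteq> 0 \<Longrightarrow> F (f v) = 0"
    "on_D v \<Longrightarrow> g v \<noteq> 0 \<Longrightarrow> psi (point v) = point (f v)"
  using assms unfolding chart_def by auto

lemma chart_exists:
  assumes p: "on_D p" shows "\<exists>e d g f. chart e d g f \<and> g p \<noteq> 0"
proof -
  obtain e d g f where f: "form e g" "\<forall>i. form d (\<lambda>v. (f v :: F2bar^3) $ i)" "g p \<noteq> 0"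
    "\<forall>v. on_D v \<longrightarrow> g v \<noteq> 0 \<longrightarrow> f v \<noteq> 0 \<and> F (f v) = 0 \<and> psi (point v) = point (f v)"
    using psi_local[OF p] by (elim exE conjE)
  obtain l where l: "lin_form p l = 1" using p lin_form_normalise unfolding on_D_def by blast
  have lp: "lin_form l p = 1" using l by (simp add: lin_form_commute)
  let ?g = "\<lambda>v. lin_form l v * g v" and ?f = "\<lambda>v. lin_form l v ^ 2 *s f v"
  have "chart (1 + e) (2 + d) ?g ?f"
    unfolding chart_def
  proof (intro conjI allI impI)
    show "form (1 + e) ?g" by (rule form_mult[OF form_lin f(1)])
    fix i show "form (2 + d) (\<lambda>v. ?f v $ i)"
      using form_mult[OF form_linpow[of 2 l] f(2)[rule_format, of i]] by simp
  next
    fix v assume v: "on_D v" "?g v \<noteq> 0"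
    then have fv: "f v \<noteq> 0" "F (f v) = 0" "psi (point v) = point (f v)" using f(4) by auto
    then show "?f v \<noteq> 0" "F (?f v) = 0" using v form_homog[OF F] by auto
    then show "psi (point v) = point (?f v)" using fv point_eq_iff[of "f v" "?f v"] by auto
  qed simp
  moreover have "?g p \<noteq> 0" using f(3) lp by simp
  ultimately show ?thesis by blast
qed

definition vanish :: "(F2bar^3 \<Rightarrow> F2bar) \<Rightarrow> bool" where
  "vanish W \<longleftrightarrow> (\<forall>y. y \<noteq> 0 \<longrightarrow> F y = 0 \<longrightarrow> W y = 0)"

lemma chart_compatible:
  assumes f: "chart e d g f" and f': "chart e' d' g' f'" and v: "on_D v" "g v \<noteq> 0" "g' v \<noteq> 0"
  obtains c where "c \<noteq> 0" "f' v = c *s f v"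
proof -
  have "point (f v) = point (f' v)" using chartD(6)[OF f v(1,2)] chartD(6)[OF f' v(1,3)] by simp
  then obtain c where "f' v = c *s f v"
    using point_eq_iff[OF chartD(4)[OF f v(1,2)] chartD(4)[OF f' v(1,3)]] by blast
  moreover have "c \<noteq> 0" using calculation chartD(4)[OF f' v(1,3)] by auto
  ultimately show ?thesis using that by blast
qed

lemma chart_onto:
  assumes y: "y \<noteq> 0" "F y = 0"
  obtains p e d g f c where "on_D p" "chart e d g f" "g p \<noteq> 0" "phi (point y) = point p" "c \<noteq> 0" "y = c *s f p"
proof -
  obtain e d g u where u: "form e g" "\<forall>i. form d (\<lambda>v. (u v :: F2bar^3) $ i)" "g y \<noteq> 0"
      "\<forall>w. w \<noteq> 0 \<longrightarrow> F w = 0 \<longrightarrow> g w \<noteq> 0 \<longrightarrow> on_D (u w) \<and> phi (point w) = point (u w)"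
    using phi_local[OF y] by (elim exE conjE)
  define p where "p = u y"
  have p: "on_D p" "phi (point y) = point p" using u y by (auto simp: p_def)
  obtain e d g f where f: "chart e d g f" "g p \<noteq> 0" using chart_exists[OF p(1)] by blast
  have "point (f p) = point y" using chartD(6)[OF f(1) p(1) f(2)] psi_phi[OF y] p(2) by simp
  then obtain c where "y = c *s f p" using point_eq_iff[OF chartD(4)[OF f(1) p(1) f(2)] y(1)] by blast
  moreover have "c \<noteq> 0" using calculation y by auto
  ultimately show ?thesis using that p f by blast
qed

text \<open>The source curve is irreducible, so vanishing spreads from one chart to all others; on
  overlaps two charts differ by a nonzero scalar.\<close>

lemma vanish_of_chart:
  assumes f: "chart e d g f" and p: "on_D p" "g p \<noteq> 0" and W: "form n W"
    and 0: "\<And>v. on_D v \<Longrightarrow> g v \<noteq> 0 \<Longrightarrow> W (f v) = 0"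
  shows "vanish W"
  unfolding vanish_def
proof (intro allI impI)
  fix y :: "F2bar^3" assume y: "y \<noteq> 0" "F y = 0"
  obtain q e' d' g' f' c where q: "on_D q" "chart e' d' g' f'" "g' q \<noteq> 0" "phi (point y) = point q"
    "c \<noteq> 0" "y = c *s f' q" by (rule chart_onto[OF y])
  have A: "g' v * W (f' v) = 0" if v: "on_D v" for v
  proof (rule cancel_on_D[OF chartD(1)[OF f] form_mult[OF chartD(1)[OF q(2)]
        form_compose[OF W chartD(2)[OF q(2)]]] form_zero p _ v])
    fix v assume v: "on_D v" "g v \<noteq> 0"
    show "g' v * W (f' v) = 0"
    proof (cases "g' v = 0")
      case False
      then obtain c where "f' v = c *s f v" using chart_compatible[OF f q(2) v] by blast
      then show ?thesis using form_homog[OF W] 0[OF v] by simp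
    qed simp
  qed
  have "W (f' q) = 0"
  proof (rule cancel_on_D[OF chartD(1)[OF q(2)] form_compose[OF W chartD(2)[OF q(2)]] form_zero q(1,3) _ q(1)])
    fix v assume "on_D v" "g' v \<noteq> 0"
    then show "W (f' v) = 0" using A[of v] by simp
  qed
  then show "W y = 0" using q(6) form_homog[OF W] by simp
qed

end

lemma cross_commute: "cross u v = - cross v u"
  by (simp add: vec_eq_iff forall_3)

context quartic_iso
begin

lemma image_exists: "\<exists>y. y \<noteq> 0 \<and> F y = 0"
proof -
  obtain p where p: "on_D p" using on_D_exists by blast
  obtain e d g f where f: "chart e d g f" "g p \<noteq> 0" using chart_exists[OF p] by blast
  show ?thesis using chartD(4,5)[OF f(1) p f(2)] by blast
qed

lemma vanish_prime:
  assumes a: "form m a" and b: "form n b" and ab: "vanish (\<lambda>y. a y * b y)"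
  shows "vanish a \<or> vanish b"
proof -
  obtain p where p: "on_D p" using on_D_exists by blast
  obtain e d g f where f: "chart e d g f" "g p \<noteq> 0" using chart_exists[OF p] by blast
  have "(g v * a (f v)) * b (f v) = 0" if "on_D v" for v
    using ab chartD(4,5)[OF f(1) that] unfolding vanish_def by (cases "g v = 0") (auto simp: mult.assoc)
  from mult_vanish_on_D[OF form_mult[OF chartD(1)[OF f(1)] form_compose[OF a chartD(2)[OF f(1)]]]
      form_compose[OF b chartD(2)[OF f(1)]] this]
  show ?thesis
  proof
    assume "\<forall>v. on_D v \<longrightarrow> g v * a (f v) = 0"
    then have "vanish a" by (intro vanish_of_chart[OF f(1) p f(2) a]) auto
    then show ?thesis ..
  next
    assume "\<forall>v. on_D v \<longrightarrow> b (f v) = 0"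
    then have "vanish b" by (intro vanish_of_chart[OF f(1) p f(2) b]) auto
    then show ?thesis ..
  qed
qed

text \<open>If two different lines contained the image, \<open>psi\<close> would be constant. But
  \<open>psi\<close> is injective, and \<open>p\<close> and \<open>sq p\<close> are different points
  of the curve.\<close>

lemma image_not_point:
  assumes l: "vanish (lin_form l)" and m: "vanish (lin_form m)" shows "cross l m = 0"
proof (rule ccontr)
  assume lm: "cross l m \<noteq> 0"
  have im: "\<exists>y k. psi (point v) = point y \<and> y \<noteq> 0 \<and> y = k *s cross l m" if v: "on_D v" for v
  proof -
    obtain e d g f where f: "chart e d g f" "g v \<noteq> 0" using chart_exists[OF v] by blast
    note fv = chartD(4-6)[OF f(1) v f(2)]
    have "lin_form (f v) l = 0" "lin_form (f v) m = 0"
      using l m fv(1,2) unfolding vanish_def by (simp_all add: lin_form_commute[of "f v"])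
    then show ?thesis using orthogonal_imp_cross[OF lm] fv by blast
  qed
  have same: "psi (point v) = point (cross l m)" if "on_D v" for v
    using im[OF that] point_eq_iff[of "cross l m"] lm by metis
  obtain p where p: "on_D p" using on_D_exists by blast
  have "point p = point (sq p)"
    using same[OF p] same[OF on_D_sq[OF p]] phi_psi[OF p] phi_psi[OF on_D_sq[OF p]] by simp
  then have "cross p (sq p) = 0"
    using p on_D_sq[OF p] point_eq_iff[of p "sq p"] cross_eq_0_iff[of p "sq p"] unfolding on_D_def by blast
  then show False using on_D_smooth[OF p] by simp
qed

lemma split_form_vanish:
  assumes "split_form w n r" "vanish r" shows "\<exists>l. l \<noteq> 0 \<and> lin_form l w = 0 \<and> vanish (lin_form l)"
  using assms
proof (induction rule: split_form.induct)
  case (split_const c)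
  then show ?case using image_exists unfolding vanish_def by blast
next
  case (split_mult l n r)
  then show ?case using vanish_prime[OF form_lin split_form_form[OF split_mult(3)]] by blast
qed

text \<open>Differentiate \<open>u (f v) \<times> v = 0\<close> for a local inverse
  \<open>u\<close>. If the derivative of \<open>f\<close> at \<open>p\<close> were a multiple of
  \<open>f p\<close>, Euler's formula would make the derivative of \<open>u (f v)\<close> a multiple
  of \<open>p\<close>, and \<open>p \<times> p^2 = 0\<close> would remain.\<close>

lemma immersion:
  assumes f: "chart e d g f" and p: "on_D p" "g p \<noteq> 0"
  shows "cross (f p) (jac f p (sq p)) \<noteq> 0"
proof
  assume 0: "cross (f p) (jac f p (sq p)) = 0"
  note fp = chartD(4-6)[OF f p] and ff = chartD(2)[OF f]
  obtain e2 d2 g2 u where g2: "form e2 g2" and u: "\<forall>i. form d2 (\<lambda>v. (u v :: F2bar^3) $ i)" and g2p: "g2 (f p) \<noteq> 0"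
    and up: "\<forall>w. w \<noteq> 0 \<longrightarrow> F w = 0 \<longrightarrow> g2 w \<noteq> 0 \<longrightarrow> on_D (u w) \<and> phi (point w) = point (u w)"
    using phi_local[OF fp(1,2)] by (elim exE conjE)
  have uu: "form d2 (\<lambda>v. u v $ i)" for i using u by blast
  have inv: "\<exists>c. u (f v) = c *s v" if v: "on_D v" "g v \<noteq> 0" "g2 (f v) \<noteq> 0" for v
  proof -
    note fv = chartD(4-6)[OF f v(1,2)]
    have "on_D (u (f v))" "point v = point (u (f v))" using up fv v(3) phi_psi[OF v(1)] by auto
    then show ?thesis using point_eq_iff[of v "u (f v)"] v(1) unfolding on_D_def by blast
  qed
  obtain c where c: "u (f p) = c *s p" using inv[OF p g2p] by blast
  have c0: "c \<noteq> 0" using up fp g2p c unfolding on_D_def by fastforce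
  have uf: "form (d2 * d) (\<lambda>v. u (f v) $ i)" for i by (rule form_compose[OF uu ff])
  have fm: "form (d2 * d + 1) (\<lambda>v. cross (u (f v)) v $ i)" for i by (rule form_cross[OF uf form_coord])
  have "cross (u (f v)) v $ i = 0" if "on_D v" for v i
  proof (rule cancel_on_D[OF form_mult[OF chartD(1)[OF f] form_compose[OF g2 ff]] fm form_zero p(1) _ _ that])
    show "g p * g2 (f p) \<noteq> 0" using p g2p by simp
    fix v assume "on_D v" "g v * g2 (f v) \<noteq> 0"
    then obtain c where "u (f v) = c *s v" using inv by auto
    then show "cross (u (f v)) v $ i = 0" by (simp add: cross_scale)
  qed
  then have "jac (\<lambda>v. cross (u (f v)) v) p (sq p) = 0"
    by (simp add: vec_eq_iff jac_component del: cross_component) (blast intro: grad_vanish_on_D[OF fm _ p(1)])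
  then have eq: "cross (jac u (f p) (jac f p (sq p))) p + cross (u (f p)) (sq p) = 0"
    by (simp add: jac_cross[OF uf form_coord] jac_compose[OF uu ff] jac_id)
  obtain s where s: "jac f p (sq p) = s *s f p" using 0 cross_eq_0_iff[OF fp(1)] by blast
  have "jac u (f p) (jac f p (sq p)) = s *s (of_nat d2 *s u (f p))"
    by (simp only: s jac_scale[OF inf_F2bar] jac_euler[OF inf_F2bar uu])
  then have "cross (jac u (f p) (jac f p (sq p))) p = 0" by (simp add: c cross_scale)
  then have "c *s cross p (sq p) = 0" using eq by (simp add: c cross_scale)
  then show False using c0 on_D_smooth[OF p(1)] by simp
qed

end

section \<open>An equation of least degree for the image\<close>

locale quartic_iso_min = quartic_iso +
  fixes c G
  assumes G: "form c G" and G_nonzero: "\<exists>v. G v \<noteq> 0" and G_vanish: "vanish G" and c4: "c \<le> 4"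
    and G_min: "\<And>n W. form n W \<Longrightarrow> vanish W \<Longrightarrow> (\<exists>v. W v \<noteq> 0) \<Longrightarrow> c \<le> n"
begin

lemma c_pos: "0 < c"
proof (rule ccontr)
  assume "\<not> 0 < c"
  then have "G v = G w" for v w using form_0[of G v w] G by simp
  then show False using G_nonzero G_vanish image_exists unfolding vanish_def by metis
qed

lemma irreducible_G: "irreducible_form G"
  unfolding irreducible_form_def
proof (intro allI impI)
  fix i j a b assume a: "form i a" and b: "form j b" and ab: "\<forall>v. G v = a v * b v"
  obtain v where v: "G v \<noteq> 0" using G_nonzero by blast
  then have nz: "\<exists>v. a v \<noteq> 0" "\<exists>v. b v \<noteq> 0" using ab by auto
  have "form (i + j) G" by (rule form_cong[OF form_mult[OF a b]]) (use ab in auto)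
  then have "i + j = c" using form_degree_unique[OF inf_F2bar _ G v] by blast
  moreover have "vanish a \<or> vanish b"
    by (rule vanish_prime[OF a b]) (use G_vanish ab in \<open>simp add: vanish_def\<close>)
  then have "c \<le> i \<or> c \<le> j" using G_min a b nz by blast
  ultimately show "i = 0 \<or> j = 0" by linarith
qed

text \<open>Otherwise elimination gives a product of lines through \<open>w\<close> that vanishes on
  the image, hence one such line, so \<open>c = 1\<close> and \<open>G\<close> is a line too. By
  \<open>image_not_point\<close> the two lines coincide, against
  \<open>G w \<noteq> 0\<close>.\<close>

lemma vanish_imp_multiple:
  assumes W: "form n W" and 0: "vanish W"
  shows "\<exists>U. form (n - c) U \<and> (\<forall>v. W v = G v * U v)"
proof -
  obtain w where w: "G w \<noteq> 0" using G_nonzero by blast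
  from form_bezout[OF G c_pos w irreducible_G W] show ?thesis
  proof
    assume "\<exists>m r i s j t. split_form w m r \<and> form i s \<and> form j t \<and> i + c = m \<and> j + n = m \<and>
      (\<forall>v. r v = s v * G v + t v * W v)"
    then obtain m r s t where r: "split_form w m r" "\<forall>v. r v = s v * G v + t v * W v" by blast
    then have "vanish r" using G_vanish 0 unfolding vanish_def by simp
    then obtain l where l: "l \<noteq> 0" "lin_form l w = 0" "vanish (lin_form l)"
      using split_form_vanish[OF r(1)] by blast
    have "\<exists>v. lin_form l v \<noteq> 0" using lin_form_normalise[OF l(1)] by (metis zero_neq_one)
    then have "c \<le> 1" using G_min[OF form_lin l(3)] by blast
    then have "c = 1" using c_pos by simp
    then obtain m where m: "\<forall>v. G v = lin_form m v" using form_1 G by blast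
    then have "vanish (lin_form m)" using G_vanish unfolding vanish_def by simp
    then have "cross l m = 0" using image_not_point l(3) by blast
    then obtain k where "m = k *s l" using cross_eq_0_iff[OF l(1)] by blast
    then have "G w = 0" using m l(2) by (simp add: lin_form_simps)
    then show ?thesis using w by simp
  qed blast
qed

text \<open>The inverse isomorphism provides a form that vanishes on the image and has a nonzero gradient
  at the given point; it is a multiple of \<open>G\<close>.\<close>

lemma gradient_G_nonzero:
  assumes f: "chart e d g f" and p: "on_D p" "g p \<noteq> 0"
  shows "grad G (f p) \<noteq> 0"
proof
  assume gradG: "grad G (f p) = 0"
  note fp = chartD(4-6)[OF f p] and ff = chartD(2)[OF f]
  \<comment> \<open>The expected tangent of the image at \<open>f p\<close>.\<close>
  define l where "l = cross (f p) (jac f p (sq p))"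
  have l0: "l \<noteq> 0" unfolding l_def by (rule immersion[OF f p])
  obtain e2 d2 g2 u where g2: "form e2 g2" and u: "\<forall>i. form d2 (\<lambda>v. (u v :: F2bar^3) $ i)" and g2p: "g2 (f p) \<noteq> 0"
    and up: "\<forall>w. w \<noteq> 0 \<longrightarrow> F w = 0 \<longrightarrow> g2 w \<noteq> 0 \<longrightarrow> on_D (u w) \<and> phi (point w) = point (u w)"
    using phi_local[OF fp(1,2)] by (elim exE conjE)
  have uu: "form d2 (\<lambda>v. u v $ i)" for i using u by blast
  have "on_D (u (f p))" "point p = point (u (f p))" using up fp g2p phi_psi[OF p(1)] by auto
  then obtain k where k: "u (f p) = k *s p" using point_eq_iff[of p "u (f p)"] p(1) unfolding on_D_def by blast
  have k0: "k \<noteq> 0" using \<open>on_D (u (f p))\<close> k unfolding on_D_def by auto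
  obtain ez where "frame (sq p) p ez (cross ez p) (cross (sq p) ez) (cross p (sq p))"
    by (rule frame_of_cross[OF on_D_smooth[OF p(1)]])
  then interpret fr: frame "sq p" p ez "cross ez p" "cross (sq p) ez" "cross p (sq p)" .
  define lx lz where "lx = cross ez p" and "lz = cross p (sq p)"
  have "i4 p = 0" "lin_form (grad i4 p) (sq p) = 0"
    using p(1) by (simp_all add: on_D_def grad_i4)
  from fr.decompose_at_double_zero[OF form_i4 this] obtain U V where
    U: "form 3 U" and V: "form 2 V" and UV: "\<And>v. i4 v = lin_form lz v * U v + (lin_form lx v)\<^sup>2 * V v"
    unfolding lx_def lz_def by auto
  have lin: "lin_form lx p = 0" "lin_form lz p = 0" "lin_form lz ez = 1" by (simp_all add: lx_def lz_def)
  \<comment> \<open>Differentiation in the direction \<open>ez\<close>, transverse to the tangent,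
    shows that \<open>U\<close> is a local unit at \<open>p\<close>.\<close>
  have "1 = lin_form (grad i4 p) ez" by (simp add: grad_i4)
  also have "\<dots> = lin_form (grad (\<lambda>v. lin_form lz v * U v + lin_form lx v * (lin_form lx v * V v)) p) ez"
    using UV by (simp add: ext[of i4 "\<lambda>v. lin_form lz v * U v + lin_form lx v * (lin_form lx v * V v)"]
      power2_eq_square mult.assoc)
  also have "\<dots> = lin_form (grad (\<lambda>v. lin_form lz v * U v) p) ez
      + lin_form (grad (\<lambda>v. lin_form lx v * (lin_form lx v * V v)) p) ez"
    by (intro grad_add[OF inf_F2bar, of 4] form_cong[OF form_mult[OF form_lin U]]
        form_cong[OF form_mult[OF form_lin form_mult[OF form_lin V]]]) auto
  also have "\<dots> = U p"
    using lin by (simp add: grad_mult[OF inf_F2bar form_lin U] grad_lin[OF inf_F2bar]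
        grad_mult_at_common_zero[OF form_lin form_mult[OF form_lin V]])
  finally have Up: "U p = 1" by simp
  define a where "a = (\<lambda>v. lin_form l (f v))"
  have a: "form d a" unfolding a_def using form_compose[OF form_lin ff] by simp
  have "a p = 0" by (simp add: a_def l_def lin_form_cross)
  moreover have "lin_form (grad a p) (sq p) = 0"
    unfolding a_def by (simp add: grad_compose[OF inf_F2bar form_lin ff] grad_lin[OF inf_F2bar])
       (simp add: l_def lin_form_cross)
  ultimately obtain U' V' where U': "form (d - 1) U'" and V': "form (d - 2) V'"
    and UV': "\<And>v. a v = lin_form lz v * U' v + (lin_form lx v)\<^sup>2 * V' v"
    using fr.decompose_at_double_zero[OF a] unfolding lx_def lz_def by metis
  \<comment> \<open>On the curve \<open>lz U = lx^2 V\<close>, so multiplication by the local unit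
    \<open>U\<close> makes the pulled back line \<open>a\<close> divisible by
    \<open>lx^2\<close>.\<close>
  define B where "B = (\<lambda>v. V' v * U v + U' v * V v)"
  have d2: "2 \<le> d" by (rule chartD(3)[OF f])
  have B: "form (d + 1) B"
    unfolding B_def by (intro form_add form_cong[OF form_mult[OF V' U]] form_cong[OF form_mult[OF U' V]])
      (use d2 in auto)
  have aU: "a v * U v = (lin_form lx v)\<^sup>2 * B v" if "on_D v" for v
  proof -
    have "lin_form lz v * U v = (lin_form lx v)\<^sup>2 * V v"
      using UV[of v] that by (simp add: on_D_def F2bar_add_eq_0)
    then have "lin_form lz v * U' v * U v = (lin_form lx v)\<^sup>2 * V v * U' v"
      by (metis mult.commute mult.left_commute)
    then show ?thesis by (simp add: UV' B_def algebra_simps)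
  qed
  obtain m where m: "lin_form m (f p) = 1"
    using lin_form_normalise[OF fp(1)] by (metis lin_form_commute)
  \<comment> \<open>\<open>W\<close> is the relation \<open>a U = lx^2 B\<close> transported by the
    inverse \<open>u\<close>. As \<open>f (u y)\<close> is only proportional to \<open>y\<close>,
    the factors \<open>m (f (u y))\<close> and \<open>m y\<close> balance the unknown
    scalar.\<close>
  define T1 where "T1 = (\<lambda>y. U (u y) * lin_form m (f (u y)))"
  define T2 where "T2 = (\<lambda>y. lin_form lx (u y) * (B (u y) * lin_form m y))"
  define W where "W = (\<lambda>y. T1 y * lin_form l y - lin_form lx (u y) * T2 y)"
  have fu: "form (d * d2) (\<lambda>y. f (u y) $ i)" for i by (rule form_compose[OF ff uu])
  have T1: "form (3 * d2 + d * d2) T1"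
    unfolding T1_def using form_mult[OF form_compose[OF U uu] form_compose[OF form_lin fu, of m]] by simp
  have lxu: "form d2 (\<lambda>y. lin_form lx (u y))" using form_compose[OF form_lin uu] by simp
  have T2: "form (d2 + ((d + 1) * d2 + 1)) T2"
    unfolding T2_def by (intro form_mult lxu form_compose[OF B uu] form_lin)
  define n where "n = 3 * d2 + d * d2 + 1"
  have W1: "form n (\<lambda>y. T1 y * lin_form l y)" unfolding n_def by (rule form_mult[OF T1 form_lin])
  have W2: "form n (\<lambda>y. lin_form lx (u y) * T2 y)"
    by (rule form_cong[OF form_mult[OF lxu T2]]) (auto simp: n_def algebra_simps)
  have W: "form n W" unfolding W_def by (rule form_diff[OF W1 W2])
  have T2p: "T2 (f p) = 0" "lin_form lx (u (f p)) = 0"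
    using lin by (simp_all add: T2_def k lin_form_simps)
  \<comment> \<open>In the second summand both factors vanish at \<open>f p\<close>, so only the
    line \<open>l\<close> contributes to the gradient.\<close>
  have gradW: "lin_form (grad W (f p)) x = T1 (f p) * lin_form l x" for x
  proof -
    have "lin_form (grad W (f p)) x = lin_form (grad (\<lambda>y. T1 y * lin_form l y) (f p)) x"
      unfolding W_def
      by (simp add: grad_diff[OF inf_F2bar W1 W2] grad_mult_at_common_zero[OF lxu T2 T2p(2,1)])
    also have "lin_form l (f p) = 0" by (simp add: l_def lin_form_cross)
    then have "lin_form (grad (\<lambda>y. T1 y * lin_form l y) (f p)) x = T1 (f p) * lin_form l x"
      by (simp add: grad_mult[OF inf_F2bar T1 form_lin] grad_lin[OF inf_F2bar])
    finally show ?thesis .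
  qed
  have W0: "W y = 0" if y: "y \<noteq> 0" "F y = 0" "g2 y \<noteq> 0" "g (u y) \<noteq> 0" for y
  proof -
    have uy: "on_D (u y)" "phi (point y) = point (u y)" using up y by auto
    note fuy = chartD(4-6)[OF f uy(1) y(4)]
    have "point (f (u y)) = point y" using psi_phi[OF y(1,2)] fuy uy(2) by simp
    then obtain r where r: "f (u y) = r *s y" using point_eq_iff[OF y(1) fuy(1)] by metis
    have "T1 y * lin_form l y = U (u y) * a (u y) * lin_form m y"
      by (simp add: T1_def a_def r lin_form_simps mult_ac)
    also have "\<dots> = lin_form lx (u y) * T2 y"
      using aU[OF uy(1)] by (simp add: T2_def power2_eq_square mult_ac)
    finally show ?thesis by (simp add: W_def)
  qed
  \<comment> \<open>Multiplication by \<open>h\<close> takes care of the points where one of the two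
    charts is not valid.\<close>
  define h where "h = (\<lambda>y. g2 y * g (u y))"
  have h: "form (e2 + e * d2) h" unfolding h_def by (rule form_mult[OF g2 form_compose[OF chartD(1)[OF f] uu]])
  have hW: "form (e2 + e * d2 + n) (\<lambda>y. h y * W y)" by (rule form_mult[OF h W])
  have "vanish (\<lambda>y. h y * W y)" unfolding vanish_def h_def using W0 by auto
  then obtain Q where Q: "form (e2 + e * d2 + n - c) Q" "\<forall>y. h y * W y = G y * Q y"
    using vanish_imp_multiple[OF hW] by blast
  have Wp: "W (f p) = 0" by (simp add: W_def T2p l_def lin_form_cross)
  have Gp: "G (f p) = 0" using G_vanish fp unfolding vanish_def by blast
  obtain x where x: "lin_form l x = 1" using lin_form_normalise[OF l0] .
  have "h (f p) * T1 (f p) = lin_form (grad (\<lambda>y. h y * W y) (f p)) x"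
    by (simp add: grad_mult[OF inf_F2bar h W] Wp gradW x)
  also have "\<dots> = lin_form (grad (\<lambda>y. G y * Q y) (f p)) x" using Q(2) by simp
  also have "\<dots> = 0" by (simp add: grad_mult[OF inf_F2bar G Q(1)] Gp gradG)
  finally have "h (f p) * T1 (f p) = 0" .
  moreover have "g (k *s p) = k ^ e * g p" "U (k *s p) = k ^ 3 * U p"
    "lin_form m (f (k *s p)) = k ^ d * lin_form m (f p)"
    using form_homog[OF chartD(1)[OF f]] form_homog[OF U] form_homog[OF form_compose[OF form_lin ff, of m]]
    by simp_all
  ultimately show False using g2p p(2) k0 Up m by (simp add: h_def T1_def k)
qed

text \<open>Both vectors are orthogonal to \<open>f p\<close> and to its derivative: the gradient by
  Euler's formula and by differentiating \<open>G (f v) = 0\<close>. Both are nonzero, hence so is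
  \<open>k\<close>.\<close>

lemma conormal:
  assumes f: "chart e d g f" and p: "on_D p" "g p \<noteq> 0"
  shows "\<exists>k. k \<noteq> 0 \<and> cross (f p) (jac f p (sq p)) = k *s grad G (f p)"
proof -
  note fp = chartD(4-6)[OF f p] and ff = chartD(2)[OF f]
  have Gf: "G (f v) = 0" if "on_D v" for v
  proof (rule cancel_on_D[OF chartD(1)[OF f] form_compose[OF G ff] form_zero p _ that])
    fix v assume "on_D v" "g v \<noteq> 0"
    then show "G (f v) = 0" using G_vanish chartD(4,5)[OF f] unfolding vanish_def by blast
  qed
  have "lin_form (grad G (f p)) (jac f p (sq p)) = 0"
    using grad_vanish_on_D[OF form_compose[OF G ff] Gf p(1)] by (simp add: grad_compose[OF inf_F2bar G ff])
  moreover have "lin_form (grad G (f p)) (f p) = 0" using Gf[OF p(1)] by (simp add: grad_euler[OF inf_F2bar G])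
  ultimately obtain k where k: "grad G (f p) = k *s cross (f p) (jac f p (sq p))"
    using orthogonal_imp_cross[OF immersion[OF f p]] by blast
  then have "k \<noteq> 0" using gradient_G_nonzero[OF f p] by auto
  then show ?thesis using k by (intro exI[of _ "1 / k"]) simp
qed

text \<open>Rescaling the chart by \<open>\<rho>\<close> multiplies \<open>f \<times> f'\<close> by \<open>\<rho>\<^sup>2\<close>.\<close>

lemma chart_change:
  assumes f: "chart e d g f" and f': "chart e' d' g' f'" and p: "on_D p" "g p \<noteq> 0" "g' p \<noteq> 0"
    and r: "f' p = r *s f p"
  shows "cross (f' p) (jac f' p (sq p)) = r\<^sup>2 *s cross (f p) (jac f p (sq p))"
proof -
  note ff = chartD(2)[OF f] and ff' = chartD(2)[OF f']
  have fm: "form (d + d') (\<lambda>v. cross (f v) (f' v) $ i)" for i by (rule form_cross[OF ff ff'])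
  have "cross (f v) (f' v) $ i = 0" if "on_D v" for v i
  proof (rule cancel_on_D[OF form_mult[OF chartD(1)[OF f] chartD(1)[OF f']] fm form_zero p(1) _ _ that])
    show "g p * g' p \<noteq> 0" using p by simp
    fix v assume "on_D v" "g v * g' v \<noteq> 0"
    then obtain c where "f' v = c *s f v" using chart_compatible[OF f f', of v] by auto
    then show "cross (f v) (f' v) $ i = 0" by (simp add: cross_scale)
  qed
  then have "jac (\<lambda>v. cross (f v) (f' v)) p (sq p) = 0"
    by (simp add: vec_eq_iff jac_component del: cross_component) (blast intro: grad_vanish_on_D[OF fm _ p(1)])
  then have eq: "cross (jac f p (sq p)) (f' p) + cross (f p) (jac f' p (sq p)) = 0"
    by (simp add: jac_cross[OF ff ff'])
  have "cross (f p) (jac f' p (sq p)) = cross (f' p) (jac f p (sq p))"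
    using minus_unique[OF eq] cross_commute[of "f' p" "jac f p (sq p)"] by simp
  then show ?thesis by (simp add: r cross_scale power2_eq_square)
qed

end

context quartic_iso_min
begin

text \<open>The scalar \<open>k\<close> at one point. Under \<open>f' = r f\<close> it is multiplied
  by \<open>r ^ (3 - c)\<close> with the exponent taken in the integers; \<open>scale_change\<close>
  avoids the negative exponent for \<open>c = 4\<close>.\<close>

definition scale_at :: "(F2bar^3 \<Rightarrow> F2bar^3) \<Rightarrow> F2bar^3 \<Rightarrow> F2bar \<Rightarrow> bool" where
  "scale_at f v k \<longleftrightarrow> k \<noteq> 0 \<and> cross (f v) (jac f v (sq v)) = k *s grad G (f v)"

lemma scale_exists: "chart e d g f \<Longrightarrow> on_D p \<Longrightarrow> g p \<noteq> 0 \<Longrightarrow> \<exists>k. scale_at f p k"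
  unfolding scale_at_def using conormal by blast

lemma scale_change:
  assumes f: "chart e d g f" and f': "chart e' d' g' f'" and p: "on_D p" "g p \<noteq> 0" "g' p \<noteq> 0"
    and k: "scale_at f p k" and k': "scale_at f' p k'"
  obtains r where "r \<noteq> 0" "f' p = r *s f p" "k' * r ^ (c - 1) = r\<^sup>2 * k"
proof -
  obtain r where r: "r \<noteq> 0" "f' p = r *s f p" using chart_compatible[OF f f' p] by blast
  have "grad G (r *s f p) = r ^ (c - 1) *s grad G (f p)"
    by (simp add: vec_eq_iff form_homog[OF grad_form[OF inf_F2bar G]])
  then have e1: "cross (f' p) (jac f' p (sq p)) = (k' * r ^ (c - 1)) *s grad G (f p)"
    using k' by (simp add: scale_at_def r(2))
  have e2: "cross (f' p) (jac f' p (sq p)) = (r\<^sup>2 * k) *s grad G (f p)"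
    using chart_change[OF f f' p r(2)] k by (simp add: scale_at_def)
  have "(k' * r ^ (c - 1)) *s grad G (f p) = (r\<^sup>2 * k) *s grad G (f p)"
    by (rule trans[OF e1[symmetric] e2])
  then have "k' * r ^ (c - 1) = r\<^sup>2 * k" using gradient_G_nonzero[OF f p(1,2)] by simp
  then show ?thesis using that r by blast
qed

text \<open>The degree is \<open>d + (d - 1) + 2\<close>: differentiation lowers it by one and
  \<open>sq v\<close> contributes two.\<close>

lemma form_conormal:
  assumes f: "chart e d g f"
  shows "form (2 * d + 1) (\<lambda>v. cross (f v) (jac f v (sq v)) $ i)"
proof -
  have "form (d + 1) (\<lambda>v. jac f v (sq v) $ i)" for i
    unfolding jac_component lin_form_def vpow_component
    by (intro form_sum form_cong[OF form_mult[OF grad_form[OF inf_F2bar chartD(2)[OF f]] form_power[OF form_coord, of 2]]])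
       (use chartD(3)[OF f] in auto)
  from form_cross[OF chartD(2)[OF f] this] show ?thesis by (rule form_cong) auto
qed

lemma form_gradient_G:
  assumes f: "chart e d g f" shows "form ((c - 1) * d) (\<lambda>v. grad G (f v) $ i)"
  by (rule form_compose[OF grad_form[OF inf_F2bar G] chartD(2)[OF f]])

text \<open>If the image had degree \<open>c \<le> 3\<close>, then \<open>L \<cdot> l(f)\<^bsup>3 - c\<^esup> / k\<close> would be a regular
  function of degree \<open>0\<close> with a zero.\<close>

lemma degree_G: "c = 4"
proof (rule ccontr)
  assume "c \<noteq> 4"
  then have c3: "c \<le> 3" using c4 by simp
  obtain p1 where p1: "on_D p1" using on_D_exists by blast
  obtain q where "cross p1 q \<noteq> 0" using on_D_smooth[OF p1] by blast
  then obtain L where L: "L \<noteq> 0" "lin_form L p1 = 0" using lin_form_cross(1) by blast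
  obtain e0 d0 g0 f0 where f0: "chart e0 d0 g0 f0" "g0 p1 \<noteq> 0" using chart_exists[OF p1] by blast
  obtain l where "lin_form (f0 p1) l = 1" using lin_form_normalise[OF chartD(4)[OF f0(1) p1 f0(2)]] .
  then have l: "lin_form l (f0 p1) = 1" by (simp add: lin_form_commute)
  \<comment> \<open>\<open>h\<close> takes its value from an arbitrary chart at each point;
    independence of the chart amounts to \<open>k' = r ^ (3 - c) k\<close>.\<close>
  define P where "P = (\<lambda>v x. \<exists>e d g f k. chart e d g f \<and> g v \<noteq> 0 \<and> scale_at f v k \<and>
    x = lin_form L v * lin_form l (f v) ^ (3 - c) / k)"
  define h where "h = (\<lambda>v. SOME x. P v x)"
  have h: "h v = lin_form L v * lin_form l (f v) ^ (3 - c) / k"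
    if f: "chart e d g f" and v: "on_D v" "g v \<noteq> 0" and k: "scale_at f v k" for e d g f k v
  proof -
    have "P v (lin_form L v * lin_form l (f v) ^ (3 - c) / k)" unfolding P_def using f v k by blast
    then have "P v (h v)" unfolding h_def by (rule someI)
    then obtain e' d' g' f' k' where f': "chart e' d' g' f'" "g' v \<noteq> 0" "scale_at f' v k'"
      and hv: "h v = lin_form L v * lin_form l (f' v) ^ (3 - c) / k'" unfolding P_def by (elim exE conjE)
    obtain r where r: "r \<noteq> 0" "f' v = r *s f v" "k' * r ^ (c - 1) = r\<^sup>2 * k"
      by (rule scale_change[OF f f'(1) v f'(2) k f'(3)])
    have nz: "k \<noteq> 0" "k' \<noteq> 0" using k f'(3) by (auto simp: scale_at_def)
    have "r\<^sup>2 = r ^ (c - 1) * r ^ (3 - c)"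
      using c3 c_pos by (simp add: power_add[symmetric])
    then have "k' = r ^ (3 - c) * k" using r(1,3) by (simp add: mult_ac)
    then show ?thesis using nz r(1) by (simp add: hv r(2) lin_form_simps power_mult_distrib)
  qed
  have "regular 0 h"
  proof (rule regularI)
    fix p assume p: "on_D p"
    obtain e d g f where f: "chart e d g f" "g p \<noteq> 0" using chart_exists[OF p] by blast
    obtain j where j: "cross (f p) (jac f p (sq p)) $ j \<noteq> 0"
      using immersion[OF f(1) p f(2)] by (auto simp: vec_eq_iff)
    let ?b = "\<lambda>v. g v * cross (f v) (jac f v (sq v)) $ j"
    let ?a = "\<lambda>v. g v * (lin_form L v * lin_form l (f v) ^ (3 - c) * grad G (f v) $ j)"
    have b: "form (e + (2 * d + 1)) ?b" by (rule form_mult[OF chartD(1)[OF f(1)] form_conormal[OF f(1)]])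
    have lf: "form d (\<lambda>v. lin_form l (f v))" using form_compose[OF form_lin chartD(2)[OF f(1)]] by simp
    have "d * (3 - c) + (c - 1) * d = 2 * d" using c3 c_pos by (cases c) (auto simp: algebra_simps)
    then have a: "form (e + (2 * d + 1) + 0) ?a"
      by (intro form_cong[OF form_mult[OF chartD(1)[OF f(1)]
            form_mult[OF form_mult[OF form_lin form_power[OF lf]] form_gradient_G[OF f(1)]]]]) auto
    have "?b v * h v = ?a v" if v: "on_D v" "?b v \<noteq> 0" for v
    proof -
      have gv: "g v \<noteq> 0" using v by auto
      obtain k where k: "scale_at f v k" using scale_exists[OF f(1) v(1) gv] by blast
      then have "k \<noteq> 0" "cross (f v) (jac f v (sq v)) $ j = k * grad G (f v) $ j"
        by (simp_all add: scale_at_def)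
      then show ?thesis using h[OF f(1) v(1) gv k] by simp
    qed
    then show "\<exists>n a b. form (n + 0) a \<and> form n b \<and> b p \<noteq> 0 \<and> (\<forall>v. on_D v \<longrightarrow> b v \<noteq> 0 \<longrightarrow> b v * h v = a v)"
      using a b f(2) j by (intro exI[of _ "e + (2 * d + 1)"] exI[of _ ?a] exI[of _ ?b]) simp
  qed
  then obtain H where H: "form 0 H" "\<forall>v. on_D v \<longrightarrow> h v = H v" using regular_imp_form by blast
  have "h p1 = 0"
  proof -
    obtain k where "scale_at f0 p1 k" using scale_exists[OF f0(1) p1 f0(2)] by blast
    from h[OF f0(1) p1 f0(2) this] show ?thesis using L(2) by simp
  qed
  then have h0: "h v = 0" if "on_D v" for v using H form_0[OF H(1), of v p1] p1 that by simp
  have lf0: "form d0 (\<lambda>v. lin_form l (f0 v))" using form_compose[OF form_lin chartD(2)[OF f0(1)]] by simp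
  have "lin_form L v = 0" if "on_D v" for v
  proof (rule cancel_on_D[OF form_mult[OF chartD(1)[OF f0(1)] lf0] form_lin form_zero p1 _ _ that])
    show "g0 p1 * lin_form l (f0 p1) \<noteq> 0" using f0(2) l by simp
    fix v assume v: "on_D v" "g0 v * lin_form l (f0 v) \<noteq> 0"
    then have gv: "g0 v \<noteq> 0" by auto
    obtain k where k: "scale_at f0 v k" using scale_exists[OF f0(1) v(1) gv] by blast
    then show "lin_form L v = 0" using h[OF f0(1) v(1) gv k] h0[OF v(1)] v(2) by (auto simp: scale_at_def)
  qed
  then have "lin_form L v = 0" for v using vanish_on_D_low_degree[OF form_lin] by simp
  then show False using lin_form_normalise[OF L(1)] by (metis zero_neq_one)
qed

text \<open>For \<open>c = 4\<close> the rule of \<open>scale_change\<close> becomes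
  \<open>k' r = k\<close>, so the vector \<open>k f\<close> is the same in all charts. Nonzero
  components of the gradient of \<open>G\<close> are its local denominators.\<close>

lemma psi_linear: "\<exists>M. \<forall>v. on_D v \<longrightarrow> M *v v \<noteq> 0 \<and> psi (point v) = point (M *v v)"
proof -
  define P where "P = (\<lambda>v x. \<exists>e d g f k. chart e d g f \<and> g v \<noteq> 0 \<and> scale_at f v k \<and> x = k *s f v)"
  define h where "h = (\<lambda>v. SOME x. P v x)"
  have h: "h v = k *s f v"
    if f: "chart e d g f" and v: "on_D v" "g v \<noteq> 0" and k: "scale_at f v k" for e d g f k v
  proof -
    have "P v (k *s f v)" unfolding P_def using f v k by blast
    then have "P v (h v)" unfolding h_def by (rule someI)
    then obtain e' d' g' f' k' where f': "chart e' d' g' f'" "g' v \<noteq> 0" "scale_at f' v k'"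
      and hv: "h v = k' *s f' v" unfolding P_def by (elim exE conjE)
    obtain r where r: "r \<noteq> 0" "f' v = r *s f v" "k' * r ^ (c - 1) = r\<^sup>2 * k"
      by (rule scale_change[OF f f'(1) v f'(2) k f'(3)])
    have "k' * r = k" using r(1,3) by (simp add: degree_G power3_eq_cube power2_eq_square)
    then show ?thesis by (simp add: hv r(2))
  qed
  have "regular 1 (\<lambda>v. h v $ i)" for i
  proof (rule regularI)
    fix p assume p: "on_D p"
    obtain e d g f where f: "chart e d g f" "g p \<noteq> 0" using chart_exists[OF p] by blast
    obtain j where j: "grad G (f p) $ j \<noteq> 0"
      using gradient_G_nonzero[OF f(1) p f(2)] by (auto simp: vec_eq_iff)
    let ?b = "\<lambda>v. g v * grad G (f v) $ j"
    let ?a = "\<lambda>v. g v * (cross (f v) (jac f v (sq v)) $ j * f v $ i)"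
    have b: "form (e + 3 * d) ?b"
      by (rule form_cong[OF form_mult[OF chartD(1)[OF f(1)] form_gradient_G[OF f(1)]]]) (auto simp: degree_G)
    have a: "form (e + 3 * d + 1) ?a"
      by (rule form_cong[OF form_mult[OF chartD(1)[OF f(1)] form_mult[OF form_conormal[OF f(1)] chartD(2)[OF f(1)]]]])
         auto
    have "?b v * h v $ i = ?a v" if v: "on_D v" "?b v \<noteq> 0" for v
    proof -
      have gv: "g v \<noteq> 0" using v by auto
      obtain k where k: "scale_at f v k" using scale_exists[OF f(1) v(1) gv] by blast
      then have "cross (f v) (jac f v (sq v)) $ j = k * grad G (f v) $ j"
        by (simp add: scale_at_def)
      then show ?thesis using h[OF f(1) v(1) gv k] by simp
    qed
    then show "\<exists>n a b. form (n + 1) a \<and> form n b \<and> b p \<noteq> 0 \<and> (\<forall>v. on_D v \<longrightarrow> b v \<noteq> 0 \<longrightarrow> b v * h v $ i = a v)"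
      using a b f(2) j by (intro exI[of _ "e + 3 * d"] exI[of _ ?a] exI[of _ ?b]) simp
  qed
  note reg = this
  have "\<exists>l. \<forall>v. on_D v \<longrightarrow> h v $ i = lin_form l v" for i
  proof -
    obtain H where "form 1 H" "\<forall>v. on_D v \<longrightarrow> h v $ i = H v" using regular_imp_form[OF reg] by blast
    then show ?thesis using form_1[of H] by auto
  qed
  then have "\<forall>i. \<exists>l. \<forall>v. on_D v \<longrightarrow> h v $ i = lin_form l v" by blast
  from choice[OF this] obtain l where l: "\<And>i v. on_D v \<Longrightarrow> h v $ i = lin_form (l i) v" by blast
  define M where "M = (\<chi> i. l i)"
  have M: "M *v v = h v" if "on_D v" for v
    by (simp add: vec_eq_iff l[OF that] M_def matrix_vector_mult_def lin_form_def)
  show ?thesis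
  proof (intro exI[of _ M] allI impI)
    fix v assume v: "on_D v"
    obtain e d g f where f: "chart e d g f" "g v \<noteq> 0" using chart_exists[OF v] by blast
    obtain k where k: "scale_at f v k" using scale_exists[OF f(1) v f(2)] by blast
    have Mv: "M *v v = k *s f v" using M[OF v] h[OF f(1) v f(2) k] by simp
    have "k *s f v \<noteq> 0" using k chartD(4)[OF f(1) v f(2)] by (simp add: scale_at_def)
    then show "M *v v \<noteq> 0 \<and> psi (point v) = point (M *v v)"
      using chartD(4,6)[OF f(1) v f(2)] point_eq_iff[of "f v" "M *v v"] by (auto simp: Mv)
  qed
qed

lemma no_linear_vanish:
  assumes "vanish (lin_form a)" shows "a = 0"
proof (rule ccontr)
  assume "a \<noteq> 0"
  then have "\<exists>v. lin_form a v \<noteq> 0" using lin_form_normalise by (metis zero_neq_one)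
  then show False using G_min[OF form_lin assms] degree_G by simp
qed

end

lemma lin_form_matrix: "lin_form a (M *v v) = lin_form (transpose M *v a) v"
  by (simp add: lin_form_3 matrix_vector_mult_def sum_3 transpose_def algebra_simps)

context quartic_iso
begin

text \<open>An equation of least degree exists because \<open>F\<close> itself is one of degree 4.
  If the matrix \<open>M\<close> were singular, the image would lie on a line, contradicting that
  the least degree is 4.\<close>

theorem psi_linear:
  "\<exists>M. invertible M \<and> (\<forall>v. on_D v \<longrightarrow> psi (point v) = point (M *v v)) \<and>
     (\<forall>y. y \<noteq> 0 \<longrightarrow> (F y = 0 \<longleftrightarrow> (\<exists>v. on_D v \<and> y = M *v v)))"
proof -
  define P where "P = (\<lambda>n. \<exists>W. form n W \<and> vanish W \<and> (\<exists>v. W v \<noteq> 0))"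
  have P4: "P 4" unfolding P_def using F F_nonzero by (intro exI[of _ F]) (auto simp: vanish_def)
  define c where "c = (LEAST n. P n)"
  have "P c" unfolding c_def by (rule LeastI[of P 4, OF P4])
  then obtain G where G: "form c G" "vanish G" "\<exists>v. G v \<noteq> 0" unfolding P_def by blast
  interpret quartic_iso_min F psi phi c G
  proof
    show "c \<le> 4" unfolding c_def by (rule Least_le[of P 4, OF P4])
    show "c \<le> n" if "form n W" "vanish W" "\<exists>v. W v \<noteq> 0" for n W
      unfolding c_def by (rule Least_le) (use that in \<open>auto simp: P_def\<close>)
  qed (use G in auto)
  obtain M where M: "\<And>v. on_D v \<Longrightarrow> M *v v \<noteq> 0" "\<And>v. on_D v \<Longrightarrow> psi (point v) = point (M *v v)"
    using psi_linear by blast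
  have onto: "\<exists>v. on_D v \<and> y = M *v v" if y: "y \<noteq> 0" "F y = 0" for y
  proof -
    obtain p e d g f k where p: "on_D p" "phi (point y) = point p" by (rule chart_onto[OF y])
    have "point (M *v p) = point y" using M(2)[OF p(1)] psi_phi[OF y] p(2) by simp
    then obtain k where k: "y = k *s (M *v p)" using point_eq_iff[OF M(1)[OF p(1)] y(1)] by blast
    then have "k \<noteq> 0" using y by auto
    then have "on_D (k *s p)" using p(1) form_homog[OF form_i4] by (auto simp: on_D_def)
    moreover have "y = M *v (k *s p)" using k by (simp add: vector_scalar_commute)
    ultimately show ?thesis by blast
  qed
  have into: "F (M *v v) = 0" if v: "on_D v" for v
  proof -
    obtain e d g f where f: "chart e d g f" "g v \<noteq> 0" using chart_exists[OF v] by blast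
    note fv = chartD(4-6)[OF f(1) v f(2)]
    have "point (f v) = point (M *v v)" using fv(3) M(2)[OF v] by simp
    then obtain k where "M *v v = k *s f v" using point_eq_iff[OF fv(1) M(1)[OF v]] by blast
    then show ?thesis using fv(2) form_homog[OF F] by simp
  qed
  have "invertible M"
  proof (rule ccontr)
    assume "\<not> invertible M"
    then have "\<not> invertible (transpose M)" by (simp add: invertible_det_nz)
    then obtain a where a: "a \<noteq> 0" "transpose M *v a = 0"
      using matrix_left_invertible_ker[of "transpose M"] invertible_left_inverse[of "transpose M"] by blast
    have "vanish (lin_form a)" unfolding vanish_def
    proof (intro allI impI)
      fix y :: "F2bar^3" assume "y \<noteq> 0" "F y = 0"
      then obtain v where v: "y = M *v v" using onto by blast
      show "lin_form a y = 0" by (simp only: v lin_form_matrix a(2) lin_form_0)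
    qed
    then show False using no_linear_vanish a(1) by blast
  qed
  then show ?thesis using M(2) onto into by blast
qed

end

section \<open>Polynomials and polynomial functions\<close>

abbreviation "lookup \<equiv> Poly_Mapping.lookup"
abbreviation "keys \<equiv> Poly_Mapping.keys"

definition monomial_eval :: "(3 \<Rightarrow>\<^sub>0 nat) \<Rightarrow> 'a::comm_semiring_1^3 \<Rightarrow> 'a" where
  "monomial_eval m v = (\<Prod>i\<in>UNIV. v $ i ^ lookup m i)"

text \<open>Evaluation after a change of coefficients. It covers plain evaluation, extension of
  scalars, constant coefficients in \<open>'a poly\<close>, and squared coefficients at the same
  time.\<close>

definition map_eval :: "('a::zero \<Rightarrow> 'b::comm_semiring_1) \<Rightarrow> 'a mpoly3 \<Rightarrow> 'b^3 \<Rightarrow> 'b" where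
  "map_eval h F v = (\<Sum>m\<in>keys F. h (lookup F m) * monomial_eval m v)"

lemma prod_3: "prod f (UNIV :: 3 set) = f 1 * f 2 * f 3"
proof -
  have "prod f {1, 2, 3 :: 3} = f 1 * (f 2 * f 3)" by simp
  then show ?thesis unfolding UNIV_3 by (simp add: mult.assoc)
qed

lemma monomial_eval_add: "monomial_eval (m + n) v = monomial_eval m v * monomial_eval n v"
  by (simp add: monomial_eval_def lookup_add power_add prod.distrib)

lemma lookup_map: "(h :: _ \<Rightarrow> _) 0 = 0 \<Longrightarrow> lookup (Poly_Mapping.map h F) m = h (lookup F m)"
  by (simp add: Poly_Mapping.map.rep_eq when_def)

lemma eval_map:
  assumes "h 0 = 0" shows "eval (Poly_Mapping.map h F) v = map_eval h F v"
  unfolding eval_def map_eval_def monomial_eval_def[symmetric] lookup_map[of h, OF assms]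
  by (rule sum.mono_neutral_left) (auto simp: in_keys_iff lookup_map[of h, OF assms] assms)

lemma eval_eq_map_eval: "eval F v = map_eval (\<lambda>c. c) F v"
  by (simp add: eval_def map_eval_def monomial_eval_def)

lemma map_eval_superset:
  assumes "h 0 = 0" "finite A" "keys F \<subseteq> A"
  shows "map_eval h F v = (\<Sum>m\<in>A. h (lookup F m) * monomial_eval m v)"
  unfolding map_eval_def using assms by (intro sum.mono_neutral_left) (auto simp: in_keys_iff)

locale coefficient_hom =
  fixes h :: "'a::comm_ring_1 \<Rightarrow> 'b::comm_ring_1"
  assumes h0: "h 0 = 0" and h1: "h 1 = 1"
    and h_add: "h (a + b) = h a + h b" and h_mult: "h (a * b) = h a * h b"
begin

lemma map_eval_add: "map_eval h (F + G) v = map_eval h F v + map_eval h G v"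
proof -
  let ?A = "keys F \<union> keys G"
  have "map_eval h (F + G) v = (\<Sum>m\<in>?A. h (lookup (F + G) m) * monomial_eval m v)"
    using keys_add[of F G] by (intro map_eval_superset h0) auto
  also have "\<dots> = (\<Sum>m\<in>?A. h (lookup F m) * monomial_eval m v) + (\<Sum>m\<in>?A. h (lookup G m) * monomial_eval m v)"
    by (simp add: lookup_add h_add algebra_simps sum.distrib)
  finally show ?thesis by (simp add: map_eval_superset[of h ?A] h0)
qed

lemma map_eval_single: "map_eval h (Poly_Mapping.single m c) v = h c * monomial_eval m v"
  by (simp add: map_eval_superset[of h "{m}"] h0)

lemma map_eval_zero: "map_eval h 0 v = 0"
  by (simp add: map_eval_def)

lemma map_eval_sum: "map_eval h (\<Sum>i\<in>A. F i) v = (\<Sum>i\<in>A. map_eval h (F i) v)"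
  by (induction A rule: infinite_finite_induct) (simp_all add: map_eval_add map_eval_zero)

lemma map_eval_mult: "map_eval h (F * G) v = map_eval h F v * map_eval h G v"
proof -
  have exp: "F = (\<Sum>m\<in>keys F. Poly_Mapping.single m (lookup F m))" for F :: "'a mpoly3"
    by (rule poly_mapping_eqI) (auto simp: lookup_sum lookup_single when_def in_keys_iff)
  have "F * G = (\<Sum>m\<in>keys F. \<Sum>n\<in>keys G. Poly_Mapping.single (m + n) (lookup F m * lookup G n))"
    by (subst exp[of F], subst exp[of G]) (simp add: sum_product mult_single)
  then have "map_eval h (F * G) v = (\<Sum>m\<in>keys F. \<Sum>n\<in>keys G.
      (h (lookup F m) * monomial_eval m v) * (h (lookup G n) * monomial_eval n v))"
    by (simp add: map_eval_sum map_eval_single h_mult monomial_eval_add mult_ac)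
  then show ?thesis by (simp add: map_eval_def sum_product)
qed

lemma map_eval_one: "map_eval h 1 v = 1"
  using map_eval_single[of 0 1 v] by (simp add: monomial_eval_def h1)

lemma map_eval_power: "map_eval h (F ^ n) v = map_eval h F v ^ n"
  by (induction n) (simp_all add: map_eval_one map_eval_mult)

lemma map_eval_uminus: "map_eval h (- F) v = - map_eval h F v"
  using map_eval_add[of F "- F" v] by (simp add: eq_neg_iff_add_eq_0 add.commute map_eval_zero)

lemma map_eval_diff: "map_eval h (F - G) v = map_eval h F v - map_eval h G v"
  using map_eval_add[of F "- G" v] map_eval_uminus[of G v] by simp

lemma map_eval_Const: "map_eval h (Const c) v = h c"
  by (simp add: Const_def map_eval_single monomial_eval_def)

lemma map_eval_Var: "map_eval h (Var i) v = v $ i"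
proof -
  have "(\<Prod>j\<in>UNIV. v $ j ^ lookup (Poly_Mapping.single i (1::nat)) j) = (\<Prod>j\<in>UNIV. if j = i then v $ j else 1)"
    by (intro prod.cong) (auto simp: lookup_single when_def)
  then show ?thesis by (simp add: Var_def map_eval_single monomial_eval_def h1)
qed

end

interpretation id_hom: coefficient_hom "\<lambda>c::'a::comm_ring_1. c" by unfold_locales simp_all
interpretation to_ac_hom: coefficient_hom to_ac by unfold_locales simp_all

lemma eval_add: "eval (F + G) v = eval F v + eval G v"
  and eval_mult: "eval (F * G) v = eval F v * eval G v"
  and eval_Const: "eval (Const c) v = c"
  and eval_Var: "eval (Var i) v = v $ i" for F G :: "'a::comm_ring_1 mpoly3"
  by (simp_all add: eval_eq_map_eval id_hom.map_eval_add id_hom.map_eval_mult id_hom.map_eval_Const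
      id_hom.map_eval_Var)

abbreviation ev :: "bit mpoly3 \<Rightarrow> F2bar^3 \<Rightarrow> F2bar" where
  "ev F \<equiv> eval (extend_scalars F)"

lemma ev_eq: "ev F v = map_eval to_ac F v"
  by (simp add: extend_scalars_def eval_map)

lemma ev_I4: "ev I4 v = i4 v"
  by (simp add: ev_eq I4_def Let_def to_ac_hom.map_eval_add to_ac_hom.map_eval_mult
      to_ac_hom.map_eval_power to_ac_hom.map_eval_Var i4_def)

lemma homogeneous_add: "homogeneous d F \<Longrightarrow> homogeneous d G \<Longrightarrow> homogeneous d (F + G)"
  unfolding homogeneous_def using keys_add[of F G] by blast

lemma homogeneous_mult:
  assumes "homogeneous d F" "homogeneous e G" shows "homogeneous (d + e) (F * G)"
  unfolding homogeneous_def
proof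
  fix m assume "m \<in> keys (F * G)"
  then obtain a b where "m = a + b" "a \<in> keys F" "b \<in> keys G" using keys_mult[of F G] by blast
  then show "(\<Sum>i\<in>UNIV. lookup m i) = d + e"
    using assms by (simp add: homogeneous_def lookup_add sum.distrib)
qed

lemma form_monomial: "form (\<Sum>i\<in>UNIV. lookup m i) (\<lambda>v. monomial_eval m v)"
  unfolding monomial_eval_def UNIV_3
  by (rule form_cong[OF form_mult[OF form_power[OF form_coord, of "lookup m 1" 1]
        form_mult[OF form_power[OF form_coord, of "lookup m 2" 2] form_power[OF form_coord, of "lookup m 3" 3]]]]) auto

lemma form_eval: "homogeneous d F \<Longrightarrow> form d (eval F)"
  unfolding eval_def[abs_def] monomial_eval_def[symmetric] homogeneous_def
  by (intro form_sum form_cong[OF form_cmult[OF form_monomial]]) auto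

lemma form_imp_eval: "form d f \<Longrightarrow> \<exists>F. homogeneous d F \<and> eval F = f"
proof (induction rule: form.induct)
  case (form_const c)
  have "homogeneous 0 (Const c)" by (simp add: homogeneous_def Const_def)
  then show ?case by (intro exI[of _ "Const c"]) (auto simp: eval_Const)
next
  case (form_coord i)
  have "homogeneous 1 (Var i :: 'a mpoly3)" by (simp add: homogeneous_def Var_def lookup_single when_def)
  then show ?case by (intro exI[of _ "Var i"]) (auto simp: eval_Var)
next
  case (form_add n f g)
  then obtain F G where "homogeneous n F" "eval F = f" "homogeneous n G" "eval G = g" by blast
  then show ?case by (intro exI[of _ "F + G"]) (auto simp: eval_add homogeneous_add)
next
  case (form_mult m f n g)
  then obtain F G where "homogeneous m F" "eval F = f" "homogeneous n G" "eval G = g" by blast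
  then show ?case by (intro exI[of _ "F * G"]) (auto simp: eval_mult homogeneous_mult)
qed

text \<open>Kronecker substitution: for large \<open>N\<close> the exponents \<open>a + N b + N\<^sup>2 c\<close> separate the monomials.\<close>

lemma eval_eq_0_imp:
  fixes F :: "'a::field mpoly3"
  assumes inf: "infinite (UNIV :: 'a set)" and 0: "\<And>v. eval F v = 0" shows "F = 0"
proof (rule ccontr)
  assume "F \<noteq> 0"
  then obtain m0 where m0: "m0 \<in> keys F" by (metis keys_eq_empty ex_in_conv)
  define N where "N = Suc (\<Sum>m\<in>keys F. \<Sum>i\<in>UNIV. lookup m i)"
  have lt: "lookup m i < N" if "m \<in> keys F" for m i
  proof -
    have "lookup m i \<le> (\<Sum>i\<in>UNIV. lookup m i)" by (rule member_le_sum) auto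
    also have "\<dots> \<le> (\<Sum>m\<in>keys F. \<Sum>i\<in>UNIV. lookup m i)" using that by (intro member_le_sum) auto
    finally show ?thesis by (simp add: N_def)
  qed
  define code where "code m = lookup m 1 + N * (lookup m 2 + N * lookup m 3)" for m :: "3 \<Rightarrow>\<^sub>0 nat"
  have inj: "inj_on code (keys F)"
  proof (rule inj_onI)
    fix m n assume mn: "m \<in> keys F" "n \<in> keys F" "code m = code n"
    have dm: "a = a' \<and> b = b'" if "a + N * b = a' + N * b'" "a < N" "a' < N" for a b a' b'
    proof -
      have "(a + N * b) mod N = a" "(a' + N * b') mod N = a'" using that(2,3) by simp_all
      then have "a = a'" by (metis that(1))
      then show ?thesis using that(1,2) by simp
    qed
    have "lookup m 1 = lookup n 1" "lookup m 2 + N * lookup m 3 = lookup n 2 + N * lookup n 3"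
      using dm[OF _ lt[OF mn(1)] lt[OF mn(2)]] mn(3) unfolding code_def by blast+
    then have "\<forall>i. lookup m i = lookup n i"
      using dm[OF _ lt[OF mn(1)] lt[OF mn(2)]] unfolding forall_3 by blast
    then show "m = n" by (intro poly_mapping_eqI) simp
  qed
  define p where "p = (\<Sum>m\<in>keys F. monom (lookup F m) (code m))"
  have "p = 0"
  proof (rule poly_eq_infinite[OF inf])
    fix t :: 'a
    have "monomial_eval m (vector [t, t ^ N, t ^ (N * N)]) = t ^ code m" for m
    proof -
      have "monomial_eval m (vector [t, t ^ N, t ^ (N * N)]) =
          t ^ lookup m 1 * (t ^ N) ^ lookup m 2 * (t ^ (N * N)) ^ lookup m 3"
        unfolding monomial_eval_def prod_3 vector_3 ..
      also have "\<dots> = t ^ (lookup m 1 + N * lookup m 2 + N * N * lookup m 3)"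
        by (simp only: power_mult[symmetric] power_add[symmetric])
      finally show ?thesis by (simp add: code_def distrib_left mult.assoc add.assoc)
    qed
    then have "poly p t = eval F (vector [t, t ^ N, t ^ (N * N)])"
      unfolding p_def poly_sum eval_def monomial_eval_def[symmetric] by (simp add: poly_monom)
    then show "poly p t = poly 0 t" using 0 by simp
  qed
  have "coeff p (code m0) = (\<Sum>m\<in>keys F. if m = m0 then lookup F m else 0)"
    unfolding p_def coeff_sum using m0 inj by (intro sum.cong) (auto dest: inj_onD)
  also have "\<dots> = lookup F m0" using m0 by simp
  finally show False using m0 \<open>p = 0\<close> by (simp add: in_keys_iff)
qed

lemma eval_eqI:
  fixes F G :: "'a::field mpoly3"
  assumes "infinite (UNIV :: 'a set)" "\<And>v. eval F v = eval G v" shows "F = G"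
proof -
  have "eval (F - G) v = 0" for v using assms(2) by (simp add: eval_eq_map_eval id_hom.map_eval_diff)
  then show ?thesis using eval_eq_0_imp[OF assms(1)] by (metis eq_iff_diff_eq_0)
qed

lemma lookup_extend: "lookup (extend_scalars F) m = to_ac (lookup F m)"
  by (simp add: extend_scalars_def lookup_map)

lemma extend_inj: "extend_scalars F = extend_scalars G \<Longrightarrow> F = G"
  by (metis lookup_extend poly_mapping_eqI to_ac_eq_iff)

lemma ev_eqI: "(\<And>v. ev F v = ev G v) \<Longrightarrow> F = G"
  by (intro extend_inj eval_eqI[OF inf_F2bar])

lemma homogeneous_extend: "homogeneous d F \<Longrightarrow> homogeneous d (extend_scalars F)"
  by (auto simp: homogeneous_def in_keys_iff lookup_extend)

lemma form_ev: "homogeneous d F \<Longrightarrow> form d (ev F)"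
  by (intro form_eval homogeneous_extend)

lemma F2bar_fixed: "(x :: F2bar)\<^sup>2 = x \<longleftrightarrow> x \<in> range to_ac"
proof
  assume "x\<^sup>2 = x"
  then have "x = to_ac 0 \<or> x = to_ac 1" using F2bar_idem by simp
  then show "x \<in> range to_ac" by blast
next
  assume "x \<in> range to_ac"
  then obtain b where "x = to_ac b" by blast
  then show "x\<^sup>2 = x" by (cases b) auto
qed

lemma map_to_ac_exists:
  assumes "\<And>m. lookup F m \<in> range to_ac" shows "\<exists>G. F = extend_scalars G"
proof
  have "lookup F m = lookup (extend_scalars (Poly_Mapping.map of_ac F)) m" for m
    using to_ac_of_ac[OF assms[of m]] by (simp add: lookup_extend lookup_map of_ac_0)
  then show "F = extend_scalars (Poly_Mapping.map of_ac F)" by (rule poly_mapping_eqI)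
qed

lemma square_surj: "\<exists>y. y\<^sup>2 = (x :: F2bar)"
  using nth_root_exists[of 2 x] by auto

lemma sq_surj: "\<exists>w. sq w = (v :: F2bar^3)"
proof -
  obtain f where "\<forall>x :: F2bar. (f x)\<^sup>2 = x" using square_surj by metis
  then have "sq (\<chi> i. f (v $ i)) = v" by (simp add: vec_eq_iff)
  then show ?thesis by blast
qed

interpretation square_hom: coefficient_hom "\<lambda>x::F2bar. x\<^sup>2"
  by unfold_locales (auto simp: F2bar_square_add power_mult_distrib)

lemma F2bar_sum_square: "(\<Sum>i\<in>A. f i :: F2bar)\<^sup>2 = (\<Sum>i\<in>A. (f i)\<^sup>2)"
  by (induction A rule: infinite_finite_induct) (auto simp: F2bar_square_add)

lemma eval_square_coefficients:
  "eval (Poly_Mapping.map (\<lambda>x::F2bar. x\<^sup>2) F) (sq v) = (eval F v)\<^sup>2"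
proof -
  have "monomial_eval m (sq v) = (monomial_eval m v)\<^sup>2" for m
    by (simp add: monomial_eval_def prod_power_distrib power_mult[symmetric] mult.commute)
  then show ?thesis
    by (simp add: eval_map map_eval_def eval_eq_map_eval[of F] F2bar_sum_square power_mult_distrib)
qed

lemma ev_sq: "ev F (sq v) = (ev F v)\<^sup>2"
proof -
  have "Poly_Mapping.map (\<lambda>x::F2bar. x\<^sup>2) (extend_scalars F) = extend_scalars F"
    by (rule poly_mapping_eqI) (simp add: lookup_map lookup_extend F2bar_fixed)
  then show ?thesis using eval_square_coefficients[of "extend_scalars F" v] by simp
qed

text \<open>Every vector over the closure is a square, so squaring the coefficients leaves
  \<open>F\<close> unchanged as a function; hence each coefficient equals its square.\<close>

lemma descend:
  assumes "\<And>v. eval F (sq v) = (eval F v)\<^sup>2" shows "\<exists>G. F = extend_scalars G"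
proof (rule map_to_ac_exists)
  have "Poly_Mapping.map (\<lambda>x::F2bar. x\<^sup>2) F = F"
    by (rule eval_eqI[OF inf_F2bar]) (metis assms eval_square_coefficients sq_surj)
  then show "lookup F m \<in> range to_ac" for m
    by (metis F2bar_fixed lookup_map zero_power2)
qed

section \<open>Frobenius twists\<close>

definition frob :: "F2bar^3^3 \<Rightarrow> F2bar^3^3" where
  "frob A = map_matrix (\<lambda>x. x\<^sup>2) A"

lemma frob_component [simp]: "frob A $ i $ j = (A $ i $ j)\<^sup>2"
  by (simp add: frob_def map_matrix_def)

lemma mat_ac_component: "mat_ac A $ i $ j = to_ac (A $ i $ j)"
  by (simp add: map_matrix_def)

lemma sq_mult: "sq (A *v v) = frob A *v sq v"
  by (simp add: vec_eq_iff matrix_vector_mult_def F2bar_sum_square power_mult_distrib)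

lemma frob_mult: "frob (A ** B) = frob A ** frob B"
  by (simp add: vec_eq_iff matrix_matrix_mult_def F2bar_sum_square power_mult_distrib)

lemma frob_mat_ac [simp]: "frob (mat_ac P) = mat_ac P"
  by (auto simp: vec_eq_iff mat_ac_component F2bar_fixed)

lemma frob_transpose: "frob (transpose A) = transpose (frob A)"
  by (simp add: vec_eq_iff transpose_def)

lemma frob_one: "frob (mat 1) = mat 1"
  by (simp add: vec_eq_iff mat_def)

lemma mat_ac_mult: "mat_ac (A ** B) = mat_ac A ** mat_ac B"
  by (simp only: vec_eq_iff matrix_matrix_mult_def mat_ac_component vec_lambda_beta to_ac_sum to_ac_mult) simp

lemma mat_ac_transpose: "mat_ac (transpose A) = transpose (mat_ac A)"
  by (simp add: vec_eq_iff transpose_def mat_ac_component)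

lemma mat_ac_one: "mat_ac (mat 1) = mat 1"
  by (simp add: vec_eq_iff mat_def mat_ac_component)

lemma mat_ac_exists:
  assumes "frob A = A" shows "\<exists>P. A = mat_ac P"
proof -
  have "A $ i $ j \<in> range to_ac" for i j
    using assms F2bar_fixed[of "A $ i $ j"] by (metis frob_component)
  then have "A = mat_ac (\<chi> i j. of_ac (A $ i $ j))"
    by (simp add: vec_eq_iff mat_ac_component to_ac_of_ac)
  then show ?thesis by blast
qed

lemma invertible_mat_ac: "invertible (mat_ac P) \<longleftrightarrow> invertible P"
proof -
  have "det (mat_ac P) = to_ac (det P)" by (simp only: det_3 mat_ac_component to_ac_add to_ac_diff to_ac_mult)
  then show ?thesis by (simp add: invertible_det_nz)
qed

lemma det_frob: "det (frob A) = (det A)\<^sup>2"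
  by (simp add: det_3 F2bar_diff F2bar_square_add power_mult_distrib)

lemma vpow_vpow: "vpow m (vpow n v) = vpow (n * m) (v :: 'a::comm_monoid_mult^3)"
  by (simp add: vec_eq_iff power_mult)

lemma invertible_obtain_inverse:
  fixes A :: "'a::field^3^3"
  assumes "invertible A" obtains B where "A ** B = mat 1" "B ** A = mat 1" "invertible B"
  using assms unfolding invertible_def by blast

lemma invertible_mult_eq_0:
  fixes A :: "'a::field^3^3"
  assumes "invertible A" shows "A *v v = 0 \<longleftrightarrow> v = 0"
proof
  assume 0: "A *v v = 0"
  obtain B where "B ** A = mat 1" using assms unfolding invertible_def by blast
  then have "v = B *v (A *v v)" by (simp add: matrix_vector_mul_assoc)
  then show "v = 0" using 0 by simp
qed simp

lemma matrix_eqI: "(\<And>v. A *v v = B *v v) \<Longrightarrow> A = (B :: 'a::field^3^3)"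
  by (simp add: matrix_eq)

subsection \<open>The determinantal formula\<close>

lemma det_cols_eq: "det_cols a b c = lin_form (cross a b) c" for a b c :: "'a::field^3"
  by (simp add: det_cols_def det_3 lin_form_3 vector_3 transpose_def algebra_simps)

lemma det_cols_mult: "det_cols (A *v a) (A *v b) (A *v c) = det A * det_cols a b c"
  for A :: "'a::field^3^3"
proof -
  have "transpose (vector [A *v a, A *v b, A *v c] :: 'a^3^3) = A ** transpose (vector [a, b, c])"
    by (simp add: vec_eq_iff forall_3 vector_3 transpose_def matrix_matrix_mult_def matrix_vector_mult_def)
  then show ?thesis by (simp add: det_cols_def det_mul)
qed

text \<open>A Moore determinant, the denominator of the formula for \<open>P = 1\<close>; it is the
  product of the seven linear forms over \<open>F_2\<close>.\<close>

definition dickson :: "F2bar^3 \<Rightarrow> F2bar" where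
  "dickson v = det_cols v (sq v) (vpow 4 v)"

text \<open>The nonzero \<open>\<F>\<^sub>2\<close>-combinations of \<open>x, y, z\<close> are the roots of
  \<open>T\<^sup>7 + I\<^sub>4 T\<^sup>3 + \<alpha> T + \<Delta>\<close> (Dickson).\<close>

lemma vpow8: "vpow 8 v = i4 v *s vpow 4 v + i4_polar v (sq v) *s sq v + dickson v *s v"
proof -
  have pow: "x^8 = x*x*x*x*x*x*x*x" for x :: F2bar
    by (simp add: power_numeral_reduce)
  show ?thesis
    by (simp add: vec_eq_iff forall_3 i4_def i4_polar_def dickson_def det_cols_eq lin_form_3 F2bar_diff)
       (simp add: pow algebra_simps power2_eq_square power4_eq_xxxx)
qed

text \<open>In \<open>vpow8\<close> the multiples of \<open>v\<close> and \<open>v^2\<close> drop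
  out of a determinant that already has these two columns.\<close>

lemma i4_times_dickson: "i4 v * dickson v = det_cols v (sq v) (vpow 8 v)"
  by (simp add: vpow8[of v] det_cols_eq[of v "sq v"] lin_form_simps lin_form_cross)
     (simp add: dickson_def det_cols_eq)

lemma form_vpow: "form n (\<lambda>v. vpow n v $ i)"
  by (rule form_cong[OF form_power[OF form_coord]]) auto

lemma form_lin_cross:
  assumes f: "\<And>i. form l (\<lambda>v. f v $ i)" and g: "\<And>i. form m (\<lambda>v. g v $ i)" and h: "\<And>i. form n (\<lambda>v. h v $ i)"
  shows "form (l + m + n) (\<lambda>v. lin_form (cross (f v) (g v)) (h v))"
  unfolding lin_form_def by (intro form_sum form_mult form_cross f g h)

text \<open>At \<open>(t, t^2, t^4)\<close> the six products in the determinant have the exponents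
  21, 20, 17, 12 and twice 14; the last two cancel.\<close>

lemma dickson_nonzero: "\<exists>v. dickson v \<noteq> 0"
proof -
  have "dickson (vector [t, t^2, t^4]) = poly (monom 1 21 + monom 1 20 + monom 1 17 + monom 1 12) t" for t
  proof -
    have "dickson (vector [t, t^2, t^4]) = t^21 + t^17 + t^20 + t^12"
      by (simp add: dickson_def det_cols_eq lin_form_3 vector_3 algebra_simps F2bar_diff
          flip: power_mult power_add power_Suc)
    then show ?thesis by (simp add: poly_monom)
  qed
  moreover have "coeff (monom 1 21 + monom 1 20 + monom 1 17 + monom 1 12 :: F2bar poly) 21 = 1" by simp
  ultimately show ?thesis
    using poly_eq_infinite[OF inf_F2bar, of 0 "monom 1 21 + monom 1 20 + monom 1 17 + monom 1 12" 0]
    by (metis coeff_0 poly_0 zero_neq_one)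
qed

lemma map_eval_det_cols:
  "map_eval to_ac (det_cols a b c) v =
    det_cols (\<chi> i. map_eval to_ac (a $ i) v) (\<chi> i. map_eval to_ac (b $ i) v) (\<chi> i. map_eval to_ac (c $ i) v)"
  by (simp add: det_cols_def det_3 vector_3 transpose_def to_ac_hom.map_eval_add to_ac_hom.map_eval_diff
      to_ac_hom.map_eval_mult)

lemma map_eval_var_powers: "(\<chi> i. map_eval to_ac (var_powers n $ i) v) = vpow n v"
  by (simp add: vec_eq_iff var_powers_def to_ac_hom.map_eval_power to_ac_hom.map_eval_Var)

lemma map_eval_matrix_var_powers:
  "(\<chi> i. map_eval to_ac ((map_matrix Const P *v var_powers n) $ i) v) = mat_ac P *v vpow n v"
  by (simp add: vec_eq_iff var_powers_def matrix_vector_mult_def to_ac_hom.map_eval_sum map_matrix_def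
      to_ac_hom.map_eval_mult to_ac_hom.map_eval_Const to_ac_hom.map_eval_power to_ac_hom.map_eval_Var)

lemma vpow_1 [simp]: "vpow 1 v = v"
  by (simp add: vec_eq_iff)

lemma ev_numer_form:
  "ev (numer_form P) v = det_cols v (mat_ac P *v sq v) (mat_ac (P ** P ** P) *v vpow 8 v)"
  unfolding numer_form_def ev_eq map_eval_det_cols map_eval_matrix_var_powers map_eval_var_powers vpow_1 ..

lemma ev_denom_form:
  "ev (denom_form P) v = det_cols v (mat_ac P *v sq v) (mat_ac (P ** P) *v vpow 4 v)"
  unfolding denom_form_def ev_eq map_eval_det_cols map_eval_matrix_var_powers map_eval_var_powers vpow_1 ..

lemma form_matrix_vpow: "form n (\<lambda>v. (M *v vpow n v) $ i)"
  unfolding matrix_vector_mult_def by (simp, intro form_sum form_cmult form_cong[OF form_power[OF form_coord]]) auto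

lemma form_denom: "form 7 (ev (denom_form P))"
  unfolding ev_denom_form[abs_def] det_cols_eq
  using form_lin_cross[OF form_coord form_matrix_vpow[of 2] form_matrix_vpow[of 4]] by simp

text \<open>The columns of both determinants are \<open>v\<close> and its images under iterates of
  this map, because squaring fixes the entries of \<open>P\<close>.\<close>

definition twisted_frob :: "bit^3^3 \<Rightarrow> F2bar^3 \<Rightarrow> F2bar^3" where
  "twisted_frob P v = mat_ac P *v sq v"

lemma twisted_frob_2: "twisted_frob P (twisted_frob P v) = mat_ac (P ** P) *v vpow 4 v"
  by (simp add: twisted_frob_def sq_mult vpow_vpow mat_ac_mult matrix_vector_mul_assoc)

lemma twisted_frob_3:
  "twisted_frob P (twisted_frob P (twisted_frob P v)) = mat_ac (P ** P ** P) *v vpow 8 v"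
  by (simp add: twisted_frob_def sq_mult vpow_vpow mat_ac_mult matrix_vector_mul_assoc frob_mult matrix_mul_assoc)

lemma zero_locus_iff:
  assumes "form n (eval F)" "v \<noteq> 0" shows "point v \<in> zero_locus F \<longleftrightarrow> eval F v = 0"
proof
  assume "point v \<in> zero_locus F"
  then obtain w where w: "w \<noteq> 0" "eval F w = 0" "point v = point w" unfolding zero_locus_def by blast
  then obtain c where "v = c *s w" using point_eq_iff[OF w(1) assms(2)] by metis
  then show "eval F v = 0" using w(2) form_homog[OF assms(1)] by simp
qed (use assms in \<open>auto simp: zero_locus_def\<close>)

lemma point_cases: obtains v where "v \<noteq> 0" "p = point v"
  using coords_nonzero point_coords by metis

text \<open>The change of coordinates \<open>A\<close> carries the ordinary Frobenius map into the
  twisted one, see \<open>twisted_frob_A\<close>. Several \<open>A\<close> belong to one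
  \<open>P\<close>; this freedom is what yields the automorphisms.\<close>

locale twist =
  fixes P :: "bit^3^3" and A B :: "F2bar^3^3"
  assumes P: "P \<in> PSL32" and AB: "A ** B = mat 1" and BA: "B ** A = mat 1"
    and PA: "mat_ac P ** frob A = A"
begin

lemma A_B [simp]: "A *v (B *v v) = v" and B_A [simp]: "B *v (A *v v) = v"
  by (simp_all add: matrix_vector_mul_assoc AB BA)

lemma invertible_A: "invertible A" "invertible B" "det A \<noteq> 0"
  using AB BA invertible_det_nz[of A] unfolding invertible_def by blast+

lemma A_eq_0 [simp]: "A *v v = 0 \<longleftrightarrow> v = 0" and B_eq_0 [simp]: "B *v v = 0 \<longleftrightarrow> v = 0"
  by (simp_all add: invertible_mult_eq_0 invertible_A)

lemma twisted_frob_A: "twisted_frob P (A *v u) = A *v sq u"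
  by (simp add: twisted_frob_def sq_mult matrix_vector_mul_assoc PA)

lemma ev_denom_A: "ev (denom_form P) (A *v u) = det A * dickson u"
  unfolding ev_denom_form twisted_frob_2[symmetric] twisted_frob_def[symmetric] twisted_frob_A
    det_cols_mult dickson_def by (simp add: vpow_vpow)

lemma ev_numer_A: "ev (numer_form P) (A *v u) = det A * (i4 u * dickson u)"
  unfolding ev_numer_form twisted_frob_3[symmetric] twisted_frob_def[symmetric] twisted_frob_A
    det_cols_mult i4_times_dickson by (simp add: vpow_vpow)

lemma cancel_denom:
  assumes "form n f" "form n g" "\<And>v. f v * ev (denom_form P) v = g v * ev (denom_form P) v"
  shows "f v = g v"
proof -
  obtain u where "dickson u \<noteq> 0" using dickson_nonzero by blast
  then have "ev (denom_form P) (A *v u) \<noteq> 0" using invertible_A(3) by (simp add: ev_denom_A)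
  moreover have "(f v - g v) * ev (denom_form P) v = 0" for v using assms(3)[of v] by (simp add: algebra_simps)
  then have "(\<forall>v. f v - g v = 0) \<or> (\<forall>v. ev (denom_form P) v = 0)"
    by (rule form_mult_zero[OF inf_F2bar form_diff[OF assms(1,2)] form_denom])
  ultimately show ?thesis by auto
qed

text \<open>The function \<open>i4 (B v)\<close> is the quotient of the determinants, but its
  coefficients lie a priori only in the closure. Numerator and denominator commute with squaring,
  hence so does the quotient, and \<open>descend\<close> applies.\<close>

lemma ev_quotient_form: "ev (quotient_form P) (A *v u) = i4 u"
proof -
  have f: "form 4 (\<lambda>v. i4 (B *v v))" by (rule form_compose_matrix[OF form_i4])
  then obtain F where F: "eval F = (\<lambda>v. i4 (B *v v))" using form_imp_eval by blast
  have fd: "i4 (B *v v) * ev (denom_form P) v = ev (numer_form P) v" for v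
    using ev_denom_A[of "B *v v"] ev_numer_A[of "B *v v"] by simp
  have f2: "form 8 (\<lambda>v. i4 (B *v sq v))" "form 8 (\<lambda>v. (i4 (B *v v))\<^sup>2)"
    using form_compose[OF f form_vpow[of 2]] form_power[OF f, of 2] by simp_all
  have "i4 (B *v sq v) = (i4 (B *v v))\<^sup>2" for v
  proof (rule cancel_denom[OF f2])
    fix v
    have "i4 (B *v sq v) * (ev (denom_form P) v)\<^sup>2 = (i4 (B *v v))\<^sup>2 * (ev (denom_form P) v)\<^sup>2"
      using fd[of "sq v"] fd[of v] by (simp add: ev_sq flip: power_mult_distrib)
    then show "i4 (B *v sq v) * ev (denom_form P) v = (i4 (B *v v))\<^sup>2 * ev (denom_form P) v"
      by (cases "ev (denom_form P) v = 0") auto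
  qed
  then obtain G where G: "F = extend_scalars G" using descend[of F] F by auto
  have evG: "ev G v = i4 (B *v v)" for v using F by (simp add: G[symmetric])
  have GD: "G * denom_form P = numer_form P"
  proof (rule ev_eqI)
    fix v
    have "ev (G * denom_form P) v = ev G v * ev (denom_form P) v"
      by (simp only: ev_eq to_ac_hom.map_eval_mult)
    then show "ev (G * denom_form P) v = ev (numer_form P) v" by (simp add: evG fd)
  qed
  have "denom_form P \<noteq> 0"
  proof
    assume "denom_form P = 0"
    then have "ev (denom_form P) v = 0" for v by (simp add: ev_eq to_ac_hom.map_eval_zero)
    then show False using dickson_nonzero ev_denom_A invertible_A(3) by (metis mult_eq_0_iff)
  qed
  then have "quotient_form P = G"
    unfolding quotient_form_def using GD by (intro the_equality) (metis mult_cancel_right)+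
  then show ?thesis by (simp add: evG)
qed

lemma ev_quotient_form_B: "ev (quotient_form P) v = i4 (B *v v)"
  using ev_quotient_form[of "B *v v"] by simp

lemma form_quotient: "form 4 (ev (quotient_form P))"
  unfolding ev_quotient_form_B[abs_def] by (rule form_compose_matrix[OF form_i4])

lemma curve_quotient_iff: "v \<noteq> 0 \<Longrightarrow> point v \<in> curve (quotient_form P) \<longleftrightarrow> on_D (B *v v)"
  unfolding curve_def by (simp add: zero_locus_iff[OF form_quotient] ev_quotient_form_B on_D_def)

text \<open>By \<open>vanish_on_D\<close> the zero set determines the quartic up to a constant
  \<open>c\<close>. Comparing the values at the square of a vector shows
  \<open>c^2 = c\<close>.\<close>

lemma ev_unique:
  assumes F: "F \<noteq> 0" "homogeneous 4 F" and C: "curve F = curve (quotient_form P)"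
  shows "ev F v = i4 (B *v v)"
proof -
  have f: "form 4 (\<lambda>u. ev F (A *v u))" by (rule form_compose_matrix[OF form_ev[OF F(2)]])
  have "ev F (A *v u) = 0" if u: "on_D u" for u
  proof -
    have nz: "A *v u \<noteq> 0" using u by (simp add: on_D_def)
    then have "point (A *v u) \<in> curve F" using u by (simp add: C curve_quotient_iff)
    then show ?thesis unfolding curve_def using zero_locus_iff[OF form_ev[OF F(2)] nz] by simp
  qed
  then obtain h where h: "form 0 h" "\<forall>u. ev F (A *v u) = i4 u * h u" using vanish_on_D[OF f] by auto
  define c where "c = h 0"
  have c: "ev F v = c * i4 (B *v v)" for v
    using h(2)[rule_format, of "B *v v"] form_0[OF h(1), of "B *v v" 0] by (simp add: c_def mult.commute)
  have "c \<noteq> 0"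
  proof
    assume "c = 0"
    then have "F = 0" using c by (intro ev_eqI) (simp add: ev_eq to_ac_hom.map_eval_zero)
    then show False using F(1) by simp
  qed
  define w where "w = A *v (axis 2 1 :: F2bar^3)"
  have "ev F (sq w) = c\<^sup>2" unfolding ev_sq by (simp add: c w_def)
  moreover have "i4 (B *v sq w) = 1"
    using ev_sq[of "quotient_form P" w] by (simp add: ev_quotient_form_B w_def)
  ultimately have "c\<^sup>2 = c" using c[of "sq w"] by simp
  then have "c = 1" using \<open>c \<noteq> 0\<close> F2bar_idem by blast
  then show ?thesis using c by simp
qed

end

subsection \<open>Lang's theorem\<close>

instance bit :: finite
proof
  have "(UNIV :: bit set) = {0, 1}" using bit_not_one_iff by auto
  then show "finite (UNIV :: bit set)" by (metis finite.emptyI finite.insertI)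
qed

lemma matrix_power_eq_one:
  fixes P :: "bit^3^3"
  assumes "invertible P"
  obtains m where "0 < m" "((**) P ^^ m) (mat 1) = mat 1"
proof -
  let ?f = "\<lambda>n. ((**) P ^^ n) (mat 1)"
  have "\<not> inj ?f"
  proof
    assume "inj ?f"
    then have "finite (UNIV :: nat set)" using finite_imageD[of ?f UNIV] finite[of "range ?f"] by blast
    then show False by simp
  qed
  then obtain i j where ij: "i < j" "?f i = ?f j" unfolding inj_def by (metis linorder_neqE_nat)
  obtain Q where Q: "Q ** P = mat 1" using assms unfolding invertible_def by blast
  have inj: "U = V" if "P ** U = P ** V" for U V :: "bit^3^3"
    using that Q by (metis matrix_mul_assoc matrix_mul_lid)
  have "U = V" if "((**) P ^^ n) U = ((**) P ^^ n) V" for n and U V :: "bit^3^3"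
    using that by (induction n) (auto dest: inj)
  moreover have "((**) P ^^ i) (?f (j - i)) = ((**) P ^^ i) (mat 1)"
    using ij fun_cong[OF funpow_add[of i "j - i" "(**) P"], of "mat 1"] by simp
  ultimately have "?f (j - i) = mat 1" by blast
  then show ?thesis using that[of "j - i"] ij(1) by simp
qed

text \<open>\<open>T^(2^m) + T\<close> has derivative 1, hence simple roots, and so divides the
  additive polynomial, whose degree is smaller. The coefficient read off belongs to the exponent
  \<open>2^0 = 1\<close>.\<close>

lemma additive_polynomial_zero:
  fixes a :: "nat \<Rightarrow> F2bar"
  assumes "0 < m" and 0: "\<And>c. c ^ (2 ^ m) = c \<Longrightarrow> (\<Sum>i<m. a i * c ^ (2 ^ i)) = 0"
  shows "a 0 = 0"
proof -
  define q :: "F2bar poly" where "q = monom 1 (2 ^ m) + [:0, 1:]"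
  define p where "p = (\<Sum>i<m. monom (a i) (2 ^ i))"
  have m1: "1 < (2::nat) ^ m" by (rule one_less_power) (use assms(1) in auto)
  have "degree q = 2 ^ m"
    unfolding q_def using m1 by (subst degree_add_eq_left) (auto simp: degree_monom_eq)
  have "q dvd p"
  proof (rule poly_dvd_by_local_multiples)
    show "q \<noteq> 0" using \<open>degree q = 2 ^ m\<close> m1 by auto
    fix t assume t: "poly q t = 0"
    then have "poly p t = 0" using 0[of t] by (simp add: p_def q_def poly_sum poly_monom F2bar_add_eq_0)
    then obtain s where s: "p = [:- t, 1:] * s" by (metis dvdE poly_eq_0_iff_dvd)
    obtain r where r: "q = [:- t, 1:] * r" using t by (metis dvdE poly_eq_0_iff_dvd)
    have "pderiv q = [:1:]"
      using m1 assms(1) by (simp add: q_def pderiv_add pderiv_monom pderiv_pCons)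
    moreover have "poly (pderiv q) t = poly r t"
      unfolding r pderiv_mult poly_add poly_mult by (simp add: pderiv_pCons)
    ultimately have "poly r t \<noteq> 0" by simp
    moreover have "r * p = q * s" unfolding r s by (simp only: mult_ac)
    ultimately show "\<exists>b c. poly b t \<noteq> 0 \<and> b * p = q * c" by blast
  qed
  moreover have "degree p < degree q"
    unfolding \<open>degree q = 2 ^ m\<close> p_def
    using assms(1) by (intro degree_sum_less) (auto intro: le_less_trans[OF degree_monom_le])
  ultimately have "p = 0" by (metis dvd_imp_degree_le linorder_not_less)
  have "coeff p 1 = (\<Sum>i<m. if i = 0 then a i else 0)"
    unfolding p_def coeff_sum by (intro sum.cong) auto
  then show ?thesis using \<open>p = 0\<close> assms(1) by simp
qed

text \<open>Hilbert 90: the traces \<open>\<Sum>\<^sub>i c\<^bsup>2^i\<^esup> P\<^sup>i w\<close> are fixed by the twisted Frobenius map.\<close>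

lemma lin_form_zero_on_fixed:
  assumes P: "invertible P" and l: "\<And>v. twisted_frob P v = v \<Longrightarrow> lin_form l v = 0" shows "l = 0"
proof -
  obtain m where m: "0 < m" "((**) P ^^ m) (mat 1) = mat 1" using matrix_power_eq_one[OF P] .
  define Q where "Q i = mat_ac (((**) P ^^ i) (mat 1))" for i
  have Q: "Q 0 = mat 1" "Q m = mat 1" "\<And>i. mat_ac P ** Q i = Q (Suc i)" "\<And>i. frob (Q i) = Q i"
    using m by (simp_all add: Q_def mat_ac_one mat_ac_mult)
  have "l $ k = 0" for k
  proof -
    let ?e = "axis k 1 :: F2bar^3"
    have e: "sq ?e = ?e" by (simp add: vec_eq_iff axis_def)
    have "lin_form l (Q 0 *v ?e) = 0"
    proof (rule additive_polynomial_zero[OF m(1)])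
      fix c :: F2bar assume c: "c ^ (2 ^ m) = c"
      define T where "T = (\<lambda>i. c ^ (2 ^ i) *s (Q i *v ?e))"
      have step: "twisted_frob P (T i) = T (Suc i)" for i
        by (simp add: T_def twisted_frob_def vpow_scale sq_mult Q(4) e vector_scalar_commute
            matrix_vector_mul_assoc Q(3) power_mult[symmetric] mult.commute)
      have "twisted_frob P (\<Sum>i<n. T i) = (\<Sum>i<n. twisted_frob P (T i))" for n
      proof (induction n)
        case 0 show ?case by (simp add: twisted_frob_def vec_eq_iff matrix_vector_mult_def)
      next
        case (Suc n)
        have "twisted_frob P (u + v) = twisted_frob P u + twisted_frob P v" for u v
          by (simp add: twisted_frob_def vec_eq_iff matrix_vector_mult_def F2bar_square_add algebra_simps sum.distrib)
        then show ?case using Suc by simp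
      qed
      then have "twisted_frob P (\<Sum>i<m. T i) = (\<Sum>i<m. T (Suc i))" by (simp add: step)
      also have "\<dots> = (\<Sum>i<m. T i) + T m - T 0" using sum.lessThan_Suc_shift[of T m] by simp
      also have "T m = T 0" by (simp add: T_def Q c)
      finally have "lin_form l (\<Sum>i<m. T i) = 0" using l by simp
      moreover have "lin_form l (\<Sum>i<n. T i) = (\<Sum>i<n. lin_form l (T i))" for n
        by (induction n) (simp_all add: lin_form_simps)
      ultimately show "(\<Sum>i<m. lin_form l (Q i *v ?e) * c ^ (2 ^ i)) = 0"
        by (simp add: T_def lin_form_simps mult.commute)
    qed
    then show ?thesis by (simp add: Q lin_form_axis)
  qed
  then show ?thesis by (simp add: vec_eq_iff)
qed

lemma cross_axis_nonzero:
  fixes a :: "'a::field^3"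
  assumes "a \<noteq> 0" shows "\<exists>i. cross a (axis i 1) \<noteq> 0"
proof (rule ccontr)
  assume "\<not> ?thesis"
  then have "\<forall>i. cross a (axis i 1) = 0" by blast
  then have "a = 0" by (auto simp: vec_eq_iff forall_3 axis_def)
  then show False using assms by simp
qed

text \<open>The equation for \<open>A\<close> says that its columns are fixed by
  \<open>v \<mapsto> P v^2\<close>. No nonzero linear form kills all fixed vectors, so three
  independent ones can be chosen successively.\<close>

theorem lang:
  assumes P: "P \<in> PSL32" shows "\<exists>A B. twist P A B"
proof -
  have iP: "invertible P" using P by (simp add: PSL32_def)
  have "\<exists>a. twisted_frob P a = a \<and> lin_form l a \<noteq> 0" if "l \<noteq> 0" for l
    using lin_form_zero_on_fixed[OF iP, of l] that by blast
  note ex = this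
  have "(axis 1 1 :: F2bar^3) \<noteq> 0" by (simp add: axis_eq_0_iff)
  from ex[OF this] obtain a where a: "twisted_frob P a = a" and "lin_form (axis 1 1) a \<noteq> 0" by blast
  then have a0: "a \<noteq> 0" by auto
  obtain l where l: "l \<noteq> 0" "lin_form l a = 0"
  proof -
    obtain i where "cross a (axis i 1) \<noteq> 0" using cross_axis_nonzero[OF a0] by blast
    then show ?thesis using that[of "cross a (axis i 1)"] lin_form_cross by blast
  qed
  obtain b where b: "twisted_frob P b = b" "lin_form l b \<noteq> 0" using ex[OF l(1)] by blast
  have "cross a b \<noteq> 0"
  proof
    assume "cross a b = 0"
    then obtain k where "b = k *s a" using cross_eq_0_iff[OF a0] by blast
    then show False using b(2) l(2) by (simp add: lin_form_simps)
  qed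
  then obtain c where c: "twisted_frob P c = c" "lin_form (cross a b) c \<noteq> 0" using ex by blast
  define A where "A = transpose (vector [a, b, c] :: F2bar^3^3)"
  have "det A = det_cols a b c" by (simp add: A_def det_cols_def)
  then have "invertible A" using c(2) by (simp add: invertible_det_nz det_cols_eq)
  then obtain B where B: "A ** B = mat 1" "B ** A = mat 1" unfolding invertible_def by blast
  have "mat_ac P ** frob A = A"
  proof -
    have col: "(mat_ac P ** frob A) $ i $ j = twisted_frob P (vector [a, b, c] $ j) $ i" for i j
      by (simp add: A_def twisted_frob_def matrix_matrix_mult_def matrix_vector_mult_def transpose_def)
    have "twisted_frob P (vector [a, b, c] $ j) = vector [a, b, c] $ j" for j :: 3
      using exhaust_3[of j] a b(1) c(1) by (auto simp: vector_3)
    then show ?thesis by (simp add: vec_eq_iff col) (simp add: A_def transpose_def)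
  qed
  then have "twist P A B" using P B by unfold_locales
  then show ?thesis by blast
qed

section \<open>Intersection divisors of lines\<close>

lemma poly_restrict_line: "poly (restrict_line F u w) t = eval F (u + t *s w)"
proof -
  have "poly (monomial_eval m (\<chi> i. [:u $ i, w $ i:])) t = monomial_eval m (u + t *s w)" for m
    by (simp add: monomial_eval_def prod_3)
  moreover have "restrict_line F u w = map_eval (\<lambda>c. [:c:]) F (\<chi> i. [:u $ i, w $ i:])"
    unfolding restrict_line_def by (rule eval_map) simp
  ultimately show ?thesis by (simp add: map_eval_def poly_sum eval_eq_map_eval)
qed

lemma incident_iff:
  assumes "l \<noteq> 0" "v \<noteq> 0" shows "incident (point l) (point v) \<longleftrightarrow> lin_form l v = 0"
proof -
  obtain c where c: "coords (point l) = c *s l"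
    using point_eq_iff[OF assms(1) coords_nonzero] point_coords by metis
  obtain d where d: "coords (point v) = d *s v"
    using point_eq_iff[OF assms(2) coords_nonzero] point_coords by metis
  have "c \<noteq> 0" "d \<noteq> 0" using c d coords_nonzero[of "point l"] coords_nonzero[of "point v"] by auto
  then show ?thesis by (simp add: incident_def c d lin_form_simps)
qed

lemma line_span:
  fixes u w :: "'a::{alg_closed_field, field_gcd}^3"
  assumes uw: "cross u w \<noteq> 0" and l: "l \<noteq> 0" "lin_form l u = 0" "lin_form l w = 0" and x: "lin_form l x = 0"
  obtains a b where "x = a *s u + b *s w"
proof -
  obtain k where k: "l = k *s cross u w" using orthogonal_imp_cross[OF uw l(2,3)] by blast
  then have "k \<noteq> 0" using l(1) by auto
  then have 0: "lin_form (cross u w) x = 0" using x by (simp add: k lin_form_simps)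
  obtain r where "frame w u r (cross r u) (cross w r) (cross u w)" by (rule frame_of_cross[OF uw])
  then interpret frame w u r "cross r u" "cross w r" "cross u w" .
  define a b where "a = lin_form (cross w r) x" and "b = lin_form (cross r u) x"
  have "x = b *s w + a *s u + 0 *s r" using expand[of x] unfolding 0 a_def b_def .
  then show ?thesis using that[of a b] by (simp add: add.commute)
qed

lemma second_point_exists:
  fixes L :: "'a::{alg_closed_field, field_gcd} proj2"
  shows "\<exists>q. incident L q \<and> q \<noteq> p"
proof (cases "incident L p")
  case True
  let ?l = "coords L" and ?x = "coords p"
  obtain i where i: "?x $ i \<noteq> 0" using coords_nonzero[of p] by (auto simp: vec_eq_iff)
  define y where "y = cross ?l (axis i 1)"
  have "cross y ?x = - (?x $ i) *s ?l"
    using True by (simp add: y_def cross_cross lin_form_axis incident_def)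
  then have yx: "cross ?x y \<noteq> 0" using i cross_commute[of ?x y] by simp
  then have y: "y \<noteq> 0" by (auto simp: vec_eq_iff forall_3)
  have "incident L (point y)"
    using incident_iff[OF coords_nonzero y, of L] by (simp add: y_def lin_form_cross lin_form_commute[of ?l])
  moreover have "point y \<noteq> p"
    using point_eq_iff[OF coords_nonzero y, of p] cross_eq_0_iff[OF coords_nonzero, of p y] yx by auto
  ultimately show ?thesis by blast
next
  case False
  obtain i where y: "cross (coords L) (axis i 1) \<noteq> 0" using cross_axis_nonzero[OF coords_nonzero] by blast
  have "incident L (point (cross (coords L) (axis i 1)))"
    using incident_iff[OF coords_nonzero y, of L]
    by (simp add: lin_form_cross lin_form_commute[of "coords L"])
  then show ?thesis using False by blast
qed

text \<open>A name for the choice made inside \<open>line_mult\<close>.\<close>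

definition other_point :: "'a::field proj2 \<Rightarrow> 'a proj2 \<Rightarrow> 'a proj2" where
  "other_point L p = (SOME q. incident L q \<and> q \<noteq> p)"

lemma other_point:
  fixes L :: "'a::{alg_closed_field, field_gcd} proj2"
  shows "incident L (other_point L p)" "cross (coords p) (coords (other_point L p)) \<noteq> 0"
proof -
  have "incident L (other_point L p) \<and> other_point L p \<noteq> p"
    unfolding other_point_def by (rule someI_ex[OF second_point_exists])
  moreover have "cross (coords p) (coords q) = 0 \<Longrightarrow> q = p" for q
    using cross_eq_0_iff[OF coords_nonzero] point_eq_iff[OF coords_nonzero coords_nonzero] point_coords by metis
  ultimately show "incident L (other_point L p)" "cross (coords p) (coords (other_point L p)) \<noteq> 0" by auto
qed

lemma line_mult_incident:
  "incident L p \<Longrightarrow> line_mult F L p = order 0 (restrict_line F (coords p) (coords (other_point L p)))"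
  by (simp add: line_mult_def other_point_def)

lemma order_prod_linear:
  fixes c d :: "'b \<Rightarrow> 'a::field"
  assumes "\<And>x. x \<in> set xs \<Longrightarrow> c x \<noteq> 0 \<or> d x \<noteq> 0"
  shows "prod_list (map (\<lambda>x. [:c x, d x:]) xs) \<noteq> 0 \<and>
    order 0 (prod_list (map (\<lambda>x. [:c x, d x:]) xs)) = length (filter (\<lambda>x. c x = 0) xs)"
  using assms
proof (induction xs)
  case Nil
  show ?case by (simp add: order_0I)
next
  case (Cons x xs)
  let ?p = "prod_list (map (\<lambda>x. [:c x, d x:]) xs)"
  define q where "q = [:c x, d x:]"
  have nz: "q \<noteq> 0" "?p \<noteq> 0" using Cons by (auto simp: q_def)
  have "order 0 q = (if c x = 0 then 1 else 0)"
  proof (cases "c x = 0")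
    case True
    then have "q = smult (d x) [:0, 1:]" and "d x \<noteq> 0" using Cons.prems by (auto simp: q_def)
    then have "order 0 q = order 0 [:0, 1::'a:]" by (metis order_smult)
    then show ?thesis using True order_power_n_n[of "0::'a" 1] by simp
  qed (simp add: order_0I q_def)
  moreover have "order 0 (q * ?p) = order 0 q + order 0 ?p" using nz by (intro order_mult) auto
  moreover have "order 0 ?p = length (filter (\<lambda>x. c x = 0) xs)" using Cons by auto
  ultimately show ?case using nz unfolding list.map prod_list.Cons q_def[symmetric] by simp
qed

lemma count_mset_map: "count (mset (map f xs)) p = length (filter (\<lambda>x. f x = p) xs)"
  by (induction xs) auto

lemma poly_prod_list_linear:
  "poly (prod_list (map (\<lambda>x. [:c x, d x:]) xs)) t = prod_list (map (\<lambda>x. c x + t * d x) xs)"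
  by (induction xs) (simp_all del: mult_pCons_left)

lemma cross_nonzero_independent:
  fixes u w :: "'a::field^3"
  assumes uw: "cross u w \<noteq> 0" and 0: "a *s u + b *s w = 0" shows "a = 0 \<and> b = 0"
proof -
  have "cross (a *s u + b *s w) w = a *s cross u w" "cross u (a *s u + b *s w) = b *s cross u w"
    by (simp_all add: vec_eq_iff forall_3 algebra_simps)
  moreover have "cross (0 :: 'a^3) w = 0" "cross u (0 :: 'a^3) = 0" by (simp_all add: vec_eq_iff forall_3)
  ultimately show ?thesis using uw unfolding 0 by auto
qed

text \<open>One factorization on the line gives all multiplicities, whatever points
  \<open>line_mult\<close> selects: after a change of parameters each factor stays linear, and its
  constant term vanishes exactly when its zero is the point \<open>p\<close>.\<close>

lemma intersection_divisorI:
  fixes F :: "'a::{alg_closed_field, field_gcd} mpoly3"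
  assumes F: "form n (eval F)" and uw: "cross u w \<noteq> 0" and l: "l \<noteq> 0" "lin_form l u = 0" "lin_form l w = 0"
    and k: "k \<noteq> 0" and ps: "\<And>x. x \<in> set ps \<Longrightarrow> \<alpha> x \<noteq> 0 \<or> \<beta> x \<noteq> 0"
    and eq: "\<And>a b. eval F (a *s u + b *s w) = k * prod_list (map (\<lambda>x. a * \<beta> x - b * \<alpha> x) ps)"
  shows "is_intersection_divisor F (point l) (mset (map (\<lambda>x. point (\<alpha> x *s u + \<beta> x *s w)) ps))"
  unfolding is_intersection_divisor_def
proof (intro conjI allI)
  note inf = infinite_alg_closed[where 'a = 'a]
  have "\<exists>t. poly (prod_list (map (\<lambda>x. [:\<beta> x, - \<alpha> x:]) ps)) t \<noteq> 0"
    using order_prod_linear[of ps \<beta> "\<lambda>x. - \<alpha> x"] ps poly_eq_infinite[OF inf, of 0 _ 0] by force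
  then obtain t where t: "prod_list (map (\<lambda>x. 1 * \<beta> x - t * \<alpha> x) ps) \<noteq> 0"
    by (auto simp: poly_prod_list_linear)
  then have "eval F (1 *s u + t *s w) \<noteq> 0" unfolding eq using k by simp
  moreover have nz: "1 *s u + t *s w \<noteq> 0" using cross_nonzero_independent[OF uw, of 1 t] by auto
  moreover have "incident (point l) (point (1 *s u + t *s w))"
    using incident_iff[OF l(1) nz] l by (simp add: lin_form_simps)
  ultimately show "\<not> {p. incident (point l) p} \<subseteq> zero_locus F"
    using zero_locus_iff[OF F nz] by blast
next
  fix p
  let ?\<phi> = "\<lambda>x. \<alpha> x *s u + \<beta> x *s w"
  have \<phi>nz: "?\<phi> x \<noteq> 0" if "x \<in> set ps" for x
    using cross_nonzero_independent[OF uw] ps[OF that] by blast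
  show "count (mset (map (\<lambda>x. point (?\<phi> x)) ps)) p = line_mult F (point l) p"
  proof (cases "incident (point l) p")
    case False
    have "incident (point l) (point (?\<phi> x))" if "x \<in> set ps" for x
      using incident_iff[OF l(1) \<phi>nz[OF that]] l by (simp add: lin_form_simps)
    then have "p \<notin> set (map (\<lambda>x. point (?\<phi> x)) ps)" using False by auto
    then show ?thesis using False
      unfolding count_mset_map by (auto simp: line_mult_def filter_empty_conv)
  next
    case True
    define q where "q = other_point (point l) p"
    have on: "lin_form l (coords p) = 0" "lin_form l (coords q) = 0"
      using True other_point(1)[of "point l" p] incident_iff[OF l(1) coords_nonzero] by (auto simp: q_def)
    obtain a1 b1 where x: "coords p = a1 *s u + b1 *s w" by (rule line_span[OF uw l on(1)])
    obtain a2 b2 where y: "coords q = a2 *s u + b2 *s w" by (rule line_span[OF uw l on(2)])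
    have "cross (coords p) (coords q) = (a1 * b2 - a2 * b1) *s cross u w"
      unfolding x y by (simp add: vec_eq_iff forall_3 algebra_simps)
    \<comment> \<open>The determinant of the change of parameters; it is nonzero because the two
      points of the line differ.\<close>
    then have D: "a1 * b2 - a2 * b1 \<noteq> 0" using other_point(2)[of p "point l"] by (auto simp: q_def)
    let ?c = "\<lambda>x. a1 * \<beta> x - b1 * \<alpha> x" and ?d = "\<lambda>x. a2 * \<beta> x - b2 * \<alpha> x"
    have cd: "?c z \<noteq> 0 \<or> ?d z \<noteq> 0" if "z \<in> set ps" for z
    proof (rule ccontr)
      assume "\<not> ?thesis"
      then have c0: "?c z = 0" "?d z = 0" by auto
      have "\<alpha> z * (a1 * b2 - a2 * b1) = a2 * ?c z - a1 * ?d z" "\<beta> z * (a1 * b2 - a2 * b1) = b2 * ?c z - b1 * ?d z"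
        by (simp_all add: algebra_simps)
      then show False using ps[OF that] D unfolding c0 by simp
    qed
    have "restrict_line F (coords p) (coords q) = smult k (prod_list (map (\<lambda>x. [:?c x, ?d x:]) ps))"
    proof (rule poly_eq_infinite[OF infinite_alg_closed])
      fix t
      have "coords p + t *s coords q = (a1 + t * a2) *s u + (b1 + t * b2) *s w"
        unfolding x y by (simp add: vec_eq_iff algebra_simps)
      moreover have "(\<lambda>x. (a1 + t * a2) * \<beta> x - (b1 + t * b2) * \<alpha> x) = (\<lambda>x. ?c x + t * ?d x)"
        by (simp add: fun_eq_iff algebra_simps)
      ultimately show "poly (restrict_line F (coords p) (coords q)) t =
          poly (smult k (prod_list (map (\<lambda>x. [:?c x, ?d x:]) ps))) t"
        by (simp only: poly_restrict_line eq poly_prod_list_linear poly_smult)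
    qed
    then have "line_mult F (point l) p = length (filter (\<lambda>x. ?c x = 0) ps)"
      using order_prod_linear[of ps ?c ?d, OF cd] k line_mult_incident[OF True, of F]
      by (simp add: q_def order_smult)
    moreover have "?c z = 0 \<longleftrightarrow> point (?\<phi> z) = p" if z: "z \<in> set ps" for z
    proof -
      have "cross (coords p) (?\<phi> z) = ?c z *s cross u w"
        unfolding x by (simp add: vec_eq_iff forall_3 algebra_simps)
      then have "?c z = 0 \<longleftrightarrow> cross (coords p) (?\<phi> z) = 0" using uw by simp
      also have "\<dots> \<longleftrightarrow> point (coords p) = point (?\<phi> z)"
        using cross_eq_0_iff[OF coords_nonzero] point_eq_iff[OF coords_nonzero \<phi>nz[OF z]] by blast
      finally show ?thesis by auto
    qed
    then have "filter (\<lambda>x. ?c x = 0) ps = filter (\<lambda>x. point (?\<phi> x) = p) ps" by (rule filter_cong[OF refl])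
    ultimately show ?thesis unfolding count_mset_map by simp
  qed
qed

lemma intersection_divisor_unique:
  "is_intersection_divisor F L D \<Longrightarrow> is_intersection_divisor F L E \<Longrightarrow> D = E"
  by (simp add: is_intersection_divisor_def multiset_eq_iff)

subsection \<open>Gradients\<close>

lemma grad_coord_power:
  "lin_form (grad (\<lambda>v::F2bar^3. v $ i ^ n) v) w = of_nat n * v $ i ^ (n - 1) * w $ i"
proof (induction n)
  case 0 show ?case by (simp add: grad_const[OF inf_F2bar])
next
  case (Suc n)
  have "lin_form (grad (\<lambda>v::F2bar^3. v $ i ^ Suc n) v) w = lin_form (grad (\<lambda>v. v $ i * v $ i ^ n) v) w" by simp
  also have "\<dots> = v $ i * lin_form (grad (\<lambda>v. v $ i ^ n) v) w + v $ i ^ n * w $ i"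
    using grad_mult[OF inf_F2bar form_coord form_power[OF form_coord]] by (simp add: grad_coord[OF inf_F2bar])
  finally show ?case unfolding Suc by (cases n) (simp_all add: algebra_simps)
qed

text \<open>Links the formal partial derivatives to the Taylor gradient by comparing monomials.
  Where the exponent \<open>m - 1\<close> is truncated, the coefficient is zero.\<close>

lemma gradient_eq_grad:
  assumes "homogeneous n (F :: F2bar mpoly3)" shows "gradient F v = grad (eval F) v"
proof -
  have part: "eval (partial i F) v = (\<Sum>m\<in>keys F. of_nat (lookup m i) * lookup F m *
      monomial_eval (m - Poly_Mapping.single i 1) v)" for i
    unfolding eval_eq_map_eval partial_def id_hom.map_eval_sum id_hom.map_eval_single ..
  have mono: "lin_form (grad (monomial_eval m) v) (axis i 1) = of_nat (lookup m i) *
      monomial_eval (m - Poly_Mapping.single i 1) v" for m i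
  proof -
    have p: "form a (\<lambda>v::F2bar^3. v $ j ^ a)" for j a by (rule form_cong[OF form_power[OF form_coord]]) auto
    have pp: "form (a + b) (\<lambda>v::F2bar^3. v $ j ^ a * v $ k ^ b)" for j k a b by (rule form_mult[OF p p])
    have M: "monomial_eval m = (\<lambda>v::F2bar^3. v $ 1 ^ lookup m 1 * v $ 2 ^ lookup m 2 * v $ 3 ^ lookup m 3)"
      by (simp add: fun_eq_iff monomial_eval_def prod_3)
    show ?thesis unfolding M
      using exhaust_3[of i]
      by (auto simp: grad_mult[OF inf_F2bar pp p] grad_mult[OF inf_F2bar p p] grad_coord_power
          monomial_eval_def prod_3 lookup_minus lookup_single axis_def)
  qed
  have sum: "lin_form (grad (\<lambda>v. \<Sum>m\<in>S. lookup F m * monomial_eval m v) v) w =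
      (\<Sum>m\<in>S. lookup F m * lin_form (grad (monomial_eval m) v) w)" if "finite S" "S \<subseteq> keys F" for S w
    using that
  proof (induction S)
    case empty show ?case by (simp add: grad_const[OF inf_F2bar])
  next
    case (insert m S)
    have deg: "form n (\<lambda>v. lookup F m * monomial_eval m v)" if "m \<in> keys F" for m
      using assms that unfolding homogeneous_def by (intro form_cong[OF form_cmult[OF form_monomial]]) auto
    have "form n (\<lambda>v. lookup F m * monomial_eval m v)" "form n (\<lambda>v. \<Sum>m\<in>S. lookup F m * monomial_eval m v)"
      using insert.prems by (auto intro!: deg form_sum)
    from grad_add[OF inf_F2bar this] show ?case
      using insert by (simp add: grad_cmult[OF inf_F2bar form_monomial])
  qed
  show ?thesis
  proof (rule lin_form_eqI)
    fix w
    have E: "eval F = (\<lambda>v. \<Sum>m\<in>keys F. lookup F m * monomial_eval m v)"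
      by (simp add: fun_eq_iff eval_def monomial_eval_def)
    have "gradient F v $ i = grad (eval F) v $ i" for i
    proof -
      have "gradient F v $ i = (\<Sum>m\<in>keys F. lookup F m * lin_form (grad (monomial_eval m) v) (axis i 1))"
        unfolding gradient_def vec_lambda_beta part mono by (simp add: mult_ac)
      also have "\<dots> = lin_form (grad (eval F) v) (axis i 1)" unfolding E by (rule sum[symmetric]) auto
      finally show ?thesis by (simp add: lin_form_axis)
    qed
    then have "gradient F v = grad (eval F) v" by (simp add: vec_eq_iff)
    then show "lin_form (gradient F v) w = lin_form (grad (eval F) v) w" by simp
  qed
qed

section \<open>Tangents and bitangents of the twisted quartics\<close>

lemma power_divisor_eq: "power_divisor P v = {#point v, point v, point (twisted_frob P v), point (twisted_frob P (twisted_frob P (twisted_frob P v)))#}"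
proof -
  have "mat_ac (transpose P) ** mat_ac (transpose P) ** mat_ac (transpose P) = transpose (mat_ac (P ** P ** P))"
    by (simp add: mat_ac_transpose mat_ac_mult matrix_transpose_mul matrix_mul_assoc)
  then show ?thesis
    by (simp add: power_divisor_def Let_def twisted_frob_3)
       (simp add: mat_ac_transpose twisted_frob_def)
qed

lemma cross_zero: "cross 0 v = 0" "cross v 0 = 0"
  by (simp_all add: vec_eq_iff forall_3)

text \<open>The theorem concerns an arbitrary equation \<open>F\<close> of the curve instead of
  \<open>quotient_form P\<close>; \<open>ev_unique\<close> provides the assumption on its
  values.\<close>

locale twisted_quartic = twist +
  fixes F :: "bit mpoly3"
  assumes F4: "homogeneous 4 F" and ev_F: "ev F v = i4 (B *v v)"
begin

abbreviation "\<sigma> \<equiv> twisted_frob P"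

lemma form_F: "form 4 (ev F)" by (rule form_ev[OF F4])

lemma curve_iff: "v \<noteq> 0 \<Longrightarrow> point v \<in> curve F \<longleftrightarrow> on_D (B *v v)"
  unfolding curve_def by (simp add: zero_locus_iff[OF form_F] ev_F on_D_def)

lemma \<sigma>_B: "\<sigma> v = A *v sq (B *v v)"
  using twisted_frob_A[of "B *v v"] by simp

lemma \<sigma>_scale: "\<sigma> (c *s v) = c\<^sup>2 *s \<sigma> v"
  by (simp add: twisted_frob_def vpow_scale vector_scalar_commute)

lemma \<sigma>_3: "\<sigma> (\<sigma> (\<sigma> v)) = A *v vpow 8 (B *v v)"
  by (simp add: \<sigma>_B vpow_vpow)

lemma cross_A_eq_0: "cross (A *v u) (A *v v) = 0 \<longleftrightarrow> cross u v = 0"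
proof (cases "u = 0")
  case True
  then show ?thesis by (simp add: cross_zero)
next
  case False
  have "(\<exists>c. A *v v = c *s (A *v u)) \<longleftrightarrow> (\<exists>c. v = c *s u)"
    by (metis B_A vector_scalar_commute)
  then show ?thesis using False by (simp add: cross_eq_0_iff)
qed

lemma cross_\<sigma>: "on_D (B *v v) \<Longrightarrow> cross v (\<sigma> v) \<noteq> 0"
  using cross_A_eq_0[of "B *v v" "sq (B *v v)"] on_D_smooth by (simp add: \<sigma>_B)

lemma gradient_F: "gradient (extend_scalars F) v = det B *s cross v (\<sigma> v)"
proof (rule lin_form_eqI)
  fix w
  have E: "ev F = (\<lambda>v. i4 (B *v v))" by (simp add: fun_eq_iff ev_F)
  have "jac (\<lambda>v. B *v v) v w = B *v w"
    by (simp add: vec_eq_iff jac_component lin_form_def matrix_vector_mult_def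
        grad_lin[OF inf_F2bar, unfolded lin_form_def])
  then have "lin_form (gradient (extend_scalars F) v) w = lin_form (cross (B *v v) (sq (B *v v))) (B *v w)"
    unfolding gradient_eq_grad[OF homogeneous_extend[OF F4]] E
    by (simp add: grad_compose[OF inf_F2bar form_i4 form_mv] grad_i4)
  also have "\<dots> = det_cols (B *v v) (B *v \<sigma> v) (B *v w)" by (simp add: det_cols_eq \<sigma>_B)
  also have "\<dots> = det B * det_cols v (\<sigma> v) w" by (rule det_cols_mult)
  finally show "lin_form (gradient (extend_scalars F) v) w = lin_form (det B *s cross v (\<sigma> v)) w"
    by (simp add: det_cols_eq lin_form_simps)
qed

lemma det_B: "det B \<noteq> 0"
  using invertible_A(2) by (simp add: invertible_det_nz)

text \<open>On the tangent, in coordinates where it is \<open>x u + y u^2\<close>, only two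
  coefficients of \<open>i4_expand\<close> survive and leave \<open>x y^2 (a x + d y)\<close>. The
  fourth zero \<open>d u + a u^2\<close> is \<open>u^8\<close> by Dickson's relation with
  \<open>i4 u = 0\<close>.\<close>

theorem tangent_divisor_power:
  assumes v: "v \<noteq> 0" "point v \<in> curve F"
  shows "tangent_divisor (extend_scalars F) v (power_divisor P v)"
proof -
  define u where "u = B *v v"
  have u: "on_D u" using v curve_iff by (simp add: u_def)
  have vu: "v = A *v u" "\<sigma> v = A *v sq u" by (simp_all add: u_def \<sigma>_B)
  have cr: "cross v (\<sigma> v) \<noteq> 0" using cross_\<sigma> u by (simp add: u_def)
  then have g: "gradient (extend_scalars F) v \<noteq> 0" using det_B by (simp add: gradient_F)
  define a d where "a = i4_polar u (sq u)" and "d = dickson u"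
  have v8: "vpow 8 u = a *s sq u + d *s u" using vpow8[of u] u by (simp add: a_def d_def on_D_def)
  have "vpow 8 u \<noteq> 0" using u by (auto simp: on_D_def vec_eq_iff)
  then have ad: "d \<noteq> 0 \<or> a \<noteq> 0" using v8 by auto
  \<comment> \<open>A pair \<open>(\<alpha>, \<beta>)\<close> stands for the factor
    \<open>x \<beta> - y \<alpha>\<close> and the point
    \<open>\<alpha> v + \<beta> \<sigma> v\<close>; the pair \<open>(1, 0)\<close> is the point of
    contact and occurs twice.\<close>
  define ps where "ps = [(1, 0), (1, 0), (0, 1), (d, a)]"
  have eq: "ev F (x *s v + y *s \<sigma> v) = 1 * prod_list (map (\<lambda>p. x * snd p - y * fst p) ps)" for x y
  proof -
    have "B *v (x *s v + y *s \<sigma> v) = x *s u + y *s sq u"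
      by (simp add: vu twisted_frob_A matrix_vector_right_distrib vector_scalar_commute)
    then have "ev F (x *s v + y *s \<sigma> v) = i4 (x *s u + y *s sq u)" by (simp add: ev_F)
    also have "\<dots> = x\<^sup>2 * y\<^sup>2 * a + x * y ^ 3 * d"
      using u by (simp add: i4_expand lin_form_cross on_D_def i4_sq a_def d_def dickson_def det_cols_eq vpow_vpow)
         (simp add: lin_form_3 algebra_simps)
    also have "\<dots> = 1 * prod_list (map (\<lambda>p. x * snd p - y * fst p) ps)"
      by (simp add: ps_def F2bar_diff algebra_simps power2_eq_square power3_eq_cube)
    finally show ?thesis .
  qed
  have "is_intersection_divisor (extend_scalars F) (point (gradient (extend_scalars F) v))
    (mset (map (\<lambda>p. point (fst p *s v + snd p *s \<sigma> v)) ps))"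
    by (rule intersection_divisorI[OF form_F cr g _ _ _ _ eq])
       (use ad in \<open>auto simp: ps_def gradient_F lin_form_simps lin_form_cross\<close>)
  moreover have "d *s v + a *s \<sigma> v = \<sigma> (\<sigma> (\<sigma> v))"
    unfolding \<sigma>_3 u_def[symmetric] v8
    by (simp add: vu twisted_frob_A matrix_vector_right_distrib vector_scalar_commute add.commute)
  ultimately show ?thesis using g by (simp add: tangent_divisor_def power_divisor_eq ps_def)
qed

end

section \<open>Recovery of the matrix from the tangents\<close>

lemma commuting_scalar:
  fixes M :: "'a::field^3^3"
  assumes "\<And>w. cross (M *v w) w = 0" shows "\<exists>c. M = mat c"
proof -
  note defs = vec_eq_iff forall_3 matrix_vector_mult_def sum_3
  have 1: "M $ 2 $ 1 = 0 \<and> M $ 3 $ 1 = 0"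
    using assms[of "axis 1 1"] by (simp add: defs axis_def)
  have 2: "M $ 1 $ 2 = 0 \<and> M $ 3 $ 2 = 0"
    using assms[of "axis 2 1"] by (simp add: defs axis_def)
  have 3: "M $ 1 $ 3 = 0 \<and> M $ 2 $ 3 = 0"
    using assms[of "axis 3 1"] by (simp add: defs axis_def)
  have e: "(M *v (\<chi> i. 1)) $ 1 = M $ 1 $ 1" "(M *v (\<chi> i. 1)) $ 2 = M $ 2 $ 2" "(M *v (\<chi> i. 1)) $ 3 = M $ 3 $ 3"
    by (simp_all add: matrix_vector_mult_def sum_3 1 2 3)
  have "M $ 1 $ 1 - M $ 2 $ 2 = 0" "M $ 3 $ 3 - M $ 1 $ 1 = 0"
    using arg_cong[OF assms[of "\<chi> i. 1"], of "\<lambda>x. x $ 3"] arg_cong[OF assms[of "\<chi> i. 1"], of "\<lambda>x. x $ 2"]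
    by (simp_all add: e)
  then have "M $ 2 $ 2 = M $ 1 $ 1" "M $ 3 $ 3 = M $ 1 $ 1" by auto
  then show ?thesis by (intro exI[of _ "M $ 1 $ 1"]) (simp add: 1 2 3 vec_eq_iff forall_3 mat_def)
qed

text \<open>All entries are 0 or 1, so at an entry 1 of \<open>P\<close> the scalar \<open>c\<close>
  is an entry of \<open>Q\<close>; being nonzero, it is 1.\<close>

lemma scalar_multiple_imp_eq:
  assumes P: "P \<in> PSL32" and Q: "Q \<in> PSL32"
    and eq: "\<And>v. mat_ac Q *v v = c *s (mat_ac P *v v)"
  shows "Q = P"
proof -
  have nz: "\<exists>i j. R $ i $ j \<noteq> 0" if "R \<in> PSL32" for R
  proof (rule ccontr)
    assume "\<not> ?thesis"
    then have "R = 0" by (simp add: vec_eq_iff)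
    then have "det R = 0" by (simp add: det_3)
    then show False using that by (simp add: PSL32_def invertible_det_nz)
  qed
  have entry: "to_ac (Q $ i $ j) = c * to_ac (P $ i $ j)" for i j
  proof -
    have col: "(mat_ac R *v axis j 1) $ i = to_ac (R $ i $ j)" for R
      by (simp add: matrix_vector_mult_def axis_def mat_ac_component if_distrib cong: if_cong)
    show ?thesis using arg_cong[OF eq[of "axis j 1"], of "\<lambda>x. x $ i"] by (simp add: col)
  qed
  obtain i j where "Q $ i $ j \<noteq> 0" using nz[OF Q] by blast
  then have "c \<noteq> 0" using entry[of i j] by auto
  obtain i j where "P $ i $ j \<noteq> 0" using nz[OF P] by blast
  then have "P $ i $ j = 1" by simp
  then have "c = to_ac (Q $ i $ j)" using entry[of i j] by simp
  then have "c = 1" using \<open>c \<noteq> 0\<close> by (cases "Q $ i $ j") auto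
  then show ?thesis using entry by (simp add: vec_eq_iff)
qed

lemma F2bar_4 [simp]: "(4 :: F2bar) = 0"
  using numeral_Bit0[of "num.Bit0 num.One", where 'a = F2bar] by (simp only: two_F2bar add_0)

lemma jac_vpow4: "jac (vpow 4) v w = (0 :: F2bar^3)"
  by (simp add: vec_eq_iff jac_component grad_coord_power)

context twisted_quartic
begin

text \<open>A product of lines, one through each point of \<open>S\<close>, makes finitely many
  exceptions harmless in identities on the curve.\<close>

lemma avoid_finite:
  assumes "finite S"
  shows "\<exists>m g. form m g \<and> (\<exists>u. on_D u \<and> g u \<noteq> 0) \<and> (\<forall>u. on_D u \<longrightarrow> point (A *v u) \<in> S \<longrightarrow> g u = 0)"
  using assms
proof induction
  case empty
  show ?case using form_const[of 1] on_D_exists by (intro exI[of _ 0] exI[of _ "\<lambda>v. 1"]) auto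
next
  case (insert s S)
  then obtain m g where g: "form m g" "\<exists>u. on_D u \<and> g u \<noteq> 0"
    "\<forall>u. on_D u \<longrightarrow> point (A *v u) \<in> S \<longrightarrow> g u = 0" by blast
  define x where "x = B *v coords s"
  have "x \<noteq> 0" by (simp add: x_def)
  then obtain i where l0: "cross x (axis i 1) \<noteq> 0" using cross_axis_nonzero by blast
  define l where "l = cross x (axis i 1)"
  have "\<not> (\<forall>u. on_D u \<longrightarrow> lin_form l u = 0)"
    using vanish_on_D_low_degree[OF form_lin] lin_form_normalise[of l] l0 unfolding l_def
    by (metis one_less_numeral_iff semiring_norm(76) zero_neq_one)
  then have "\<exists>u. on_D u \<and> lin_form l u * g u \<noteq> 0"
    using mult_vanish_on_D[OF form_lin g(1), of l] g(2) by blast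
  moreover have "lin_form l u * g u = 0" if u: "on_D u" "point (A *v u) \<in> insert s S" for u
  proof (cases "point (A *v u) = s")
    case True
    have "A *v u \<noteq> 0" using u by (simp add: on_D_def)
    then obtain c where "A *v u = c *s coords s"
      using True point_eq_iff[OF coords_nonzero, of "A *v u" s] by auto
    then have "u = c *s x" by (metis B_A vector_scalar_commute x_def)
    then show ?thesis by (simp add: l_def lin_form_simps lin_form_cross)
  qed (use u g(3) in auto)
  ultimately show ?case using form_mult[OF form_lin g(1), of l] by blast
qed

text \<open>Comparing divisors, the point \<open>Q v^2\<close> is \<open>\<sigma> v\<close> or
  \<open>\<sigma>^3 v\<close> away from \<open>S\<close>, and by irreducibility one alternative
  holds throughout. The first makes \<open>Q\<close> a multiple of \<open>P\<close>; the second is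
  refuted by differentiation, since fourth powers have derivative zero.\<close>

theorem tangents_determine_matrix:
  assumes Q: "Q \<in> PSL32" and S: "finite S"
    and tan: "\<And>v. v \<noteq> 0 \<Longrightarrow> point v \<in> curve F - S \<Longrightarrow>
      tangent_divisor (extend_scalars F) v (power_divisor Q v)"
  shows "Q = P"
proof -
  \<comment> \<open>\<open>Q v^2\<close> transported to the coordinates of the invariant quartic;
    \<open>N\<close> is scalar exactly when \<open>Q\<close> is a multiple of
    \<open>P\<close>.\<close>
  define N where "N = B ** mat_ac Q ** frob A"
  have QA: "twisted_frob Q (A *v u) = A *v (N *v sq u)" for u
    by (simp add: N_def twisted_frob_def sq_mult matrix_vector_mul_assoc matrix_mul_assoc AB)
  have two: "cross (N *v sq u) (sq u) = 0 \<or> cross (N *v sq u) (vpow 8 u) = 0"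
    if u: "on_D u" "point (A *v u) \<notin> S" for u
  proof -
    define v where "v = A *v u"
    have v: "v \<noteq> 0" "point v \<in> curve F" using u curve_iff[of v] by (auto simp: v_def on_D_def)
    have "tangent_divisor (extend_scalars F) v (power_divisor Q v)" using tan[of v] v u by (simp add: v_def)
    then have "power_divisor Q v = power_divisor P v"
      using tangent_divisor_power[OF v] unfolding tangent_divisor_def by (metis intersection_divisor_unique)
    then have "{#point (twisted_frob Q v), point (twisted_frob Q (twisted_frob Q (twisted_frob Q v)))#} =
        {#point (\<sigma> v), point (\<sigma> (\<sigma> (\<sigma> v)))#}" by (simp add: power_divisor_eq)
    then have "point (twisted_frob Q v) \<in># {#point (\<sigma> v), point (\<sigma> (\<sigma> (\<sigma> v)))#}"
      by (metis union_single_eq_member)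
    then have "point (twisted_frob Q v) = point (\<sigma> v) \<or> point (twisted_frob Q v) = point (\<sigma> (\<sigma> (\<sigma> v)))"
      by auto
    moreover have "sq u \<noteq> 0" "vpow 8 u \<noteq> 0" using u by (auto simp: on_D_def vec_eq_iff)
    then have nz: "A *v sq u \<noteq> 0" "A *v vpow 8 u \<noteq> 0" by auto
    have QA': "twisted_frob Q v = A *v (N *v sq u)" by (simp add: QA v_def)
    have "cross (A *v (N *v sq u)) (A *v z) = 0"
      if "point (A *v (N *v sq u)) = point (A *v z)" "A *v z \<noteq> 0" for z
    proof (cases "A *v (N *v sq u) = 0")
      case False
      then show ?thesis using that point_eq_iff cross_eq_0_iff by blast
    qed (simp add: cross_zero)
    ultimately show ?thesis
      using nz unfolding QA' by (auto simp: \<sigma>_B v_def vpow_vpow cross_A_eq_0 simp del: A_eq_0)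
  qed
  obtain m g where g: "form m g" "\<exists>u. on_D u \<and> g u \<noteq> 0" "\<And>u. on_D u \<Longrightarrow> point (A *v u) \<in> S \<Longrightarrow> g u = 0"
    using avoid_finite[OF S] by blast
  have fN: "form 1 (\<lambda>w. (N *v w) $ i)" for i by (rule form_mv)
  have f1: "form 2 (\<lambda>w. cross (N *v w) w $ i)" for i
    by (rule form_cong[OF form_cross[OF fN form_coord]]) auto
  have f2: "form 5 (\<lambda>w. cross (N *v w) (vpow 4 w) $ i)" for i
    by (rule form_cong[OF form_cross[OF fN form_vpow]]) auto
  have f1s: "form (2 * 2) (\<lambda>u. cross (N *v sq u) (sq u) $ i)" for i
    by (rule form_compose[OF f1 form_vpow])
  have f2s: "form (5 * 2) (\<lambda>u. cross (N *v sq u) (vpow 4 (sq u)) $ i)" for i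
    by (rule form_compose[OF f2 form_vpow])
  have "(\<forall>u. on_D u \<longrightarrow> cross (N *v sq u) (sq u) $ i = 0) \<or>
      (\<forall>u. on_D u \<longrightarrow> cross (N *v sq u) (vpow 4 (sq u)) $ j = 0)" for i j
  proof -
    have "g u * cross (N *v sq u) (sq u) $ i * cross (N *v sq u) (vpow 4 (sq u)) $ j = 0" if u: "on_D u" for u
    proof (cases "point (A *v u) \<in> S")
      case False
      then show ?thesis using two[OF u] by (auto simp: vpow_vpow simp del: cross_component)
    qed (use g(3) u in simp)
    then show ?thesis
      using mult_vanish_on_D[OF form_mult[OF g(1) f1s[of i]] f2s[of j]] mult_vanish_on_D[OF g(1) f1s[of i]] g(2)
      by blast
  qed
  then have "(\<forall>u. on_D u \<longrightarrow> cross (N *v sq u) (sq u) = 0) \<or>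
      (\<forall>u. on_D u \<longrightarrow> cross (N *v sq u) (vpow 4 (sq u)) = 0)"
    unfolding vec_eq_iff zero_index by blast
  \<comment> \<open>Every point of the curve is the square of another one, so \<open>sq u\<close>
    may be replaced by an arbitrary \<open>w\<close>.\<close>
  moreover have on_sq: "\<exists>u. on_D u \<and> w = sq u" if w: "on_D w" for w
  proof -
    obtain u where "sq u = w" using sq_surj by blast
    moreover have "sq (0 :: F2bar^3) = 0" by (simp add: vec_eq_iff)
    then have "u \<noteq> 0" using w \<open>sq u = w\<close> unfolding on_D_def by auto
    ultimately show ?thesis using w i4_sq[of u] unfolding on_D_def by (intro exI[of _ u]) auto
  qed
  ultimately consider "\<And>w. on_D w \<Longrightarrow> cross (N *v w) w = 0"
    | "\<And>w. on_D w \<Longrightarrow> cross (N *v w) (vpow 4 w) = 0" by metis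
  then show ?thesis
  proof cases
    case 1
    have "cross (N *v w) w $ i = 0" for w i
      by (rule vanish_on_D_low_degree[OF f1]) (simp_all add: 1 del: cross_component)
    then have "cross (N *v w) w = 0" for w by (simp add: vec_eq_iff)
    then obtain c where c: "N = mat c" using commuting_scalar by blast
    show ?thesis
    proof (rule scalar_multiple_imp_eq[OF P Q])
      fix v :: "F2bar^3"
      obtain w where w: "sq w = v" using sq_surj[of v] by blast
      have "mat_ac Q *v sq w = A *v (N *v sq (B *v w))"
        using QA[of "B *v w"] by (simp add: twisted_frob_def)
      also have "N *v sq (B *v w) = c *s sq (B *v w)"
        by (simp add: c vec_eq_iff matrix_vector_mult_def mat_def if_distrib if_distribR cong: if_cong)
      also have "A *v (c *s sq (B *v w)) = c *s \<sigma> w" by (simp add: \<sigma>_B vector_scalar_commute)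
      finally show "mat_ac Q *v v = c *s (mat_ac P *v v)" by (simp add: w twisted_frob_def)
    qed
  next
    case 2
    obtain w where w: "on_D w" using on_D_exists by blast
    have inj: "N *v x = 0 \<longleftrightarrow> x = 0" for x
    proof -
      have "invertible (mat_ac Q)" "invertible (frob A)"
        using Q invertible_A(1) invertible_mat_ac[of Q] by (simp_all add: PSL32_def) (simp add: invertible_det_nz det_frob)
      then have "invertible N" unfolding N_def by (intro invertible_mult invertible_A)
      then show ?thesis by (rule invertible_mult_eq_0)
    qed
    have "jac (\<lambda>v. cross (N *v v) (vpow 4 v)) w (sq w) = 0"
      by (simp add: vec_eq_iff jac_component del: cross_component)
         (intro allI grad_vanish_on_D[OF f2 _ w], simp add: 2 del: cross_component)
    moreover have "jac (\<lambda>v. N *v v) w (sq w) = N *v sq w"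
    proof -
      have row: "(N *v v) $ i = lin_form (N $ i) v" for v i
        by (simp add: lin_form_def matrix_vector_mult_def)
      show ?thesis by (simp add: vec_eq_iff jac_component row grad_lin[OF inf_F2bar] del: vpow_component)
    qed
    ultimately have "cross (N *v sq w) (vpow 4 w) = 0"
      by (simp add: jac_cross[OF fN form_vpow] jac_vpow4 cross_zero)
    moreover have "vpow 4 w \<noteq> 0" using w by (auto simp: on_D_def vec_eq_iff)
    ultimately obtain a b where a: "N *v w = a *s vpow 4 w" and b: "N *v sq w = b *s vpow 4 w"
      using 2[OF w] cross_commute[of "vpow 4 w"] cross_eq_0_iff[of "vpow 4 w"] by (metis neg_equal_0_iff_equal)
    have "w \<noteq> 0" using w by (simp add: on_D_def)
    then have "a \<noteq> 0" using a inj[of w] by auto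
    \<comment> \<open>The injective \<open>N\<close> sends \<open>w\<close> and \<open>sq w\<close>
      to multiples of one vector, so these are proportional, against smoothness.\<close>
    have "N *v (a *s sq w - b *s w) = 0"
      by (simp add: matrix_vector_mult_diff_distrib vector_scalar_commute a b vector_smult_assoc mult.commute)
    then have "a *s sq w = b *s w" using inj by simp
    then have "cross w (a *s sq w) = 0" by (simp add: cross_scale)
    then show ?thesis using \<open>a \<noteq> 0\<close> on_D_smooth[OF w] by (simp add: cross_scale)
  qed
qed

end

subsection \<open>Bitangents\<close>

definition vec_ac :: "bit^3 \<Rightarrow> F2bar^3" where
  "vec_ac w = (\<chi> i. to_ac (w $ i))"

lemma vec_ac_component [simp]: "vec_ac w $ i = to_ac (w $ i)"
  by (simp add: vec_ac_def)

lemma vec_ac_eq_0 [simp]: "vec_ac w = 0 \<longleftrightarrow> w = 0"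
  by (simp add: vec_eq_iff)

lemma vec_ac_add: "vec_ac (u + w) = vec_ac u + vec_ac w"
  unfolding vec_eq_iff vec_ac_component vector_add_component to_ac_add by simp

lemma to_ac_bit_square: "(to_ac (b :: bit))\<^sup>2 = to_ac b"
  by (simp add: F2bar_fixed)

lemma sq_vec_ac [simp]: "sq (vec_ac w) = vec_ac w"
  by (simp add: vec_eq_iff to_ac_bit_square)

lemma vec_ac_exists: assumes "sq m = m" shows "\<exists>w. m = vec_ac w"
proof -
  have "m $ i \<in> range to_ac" for i using assms F2bar_fixed[of "m $ i"] by (metis vpow_component)
  then have "m = vec_ac (\<chi> i. of_ac (m $ i))" by (simp add: vec_eq_iff to_ac_of_ac)
  then show ?thesis by blast
qed

lemma lin_form_vec_ac: "lin_form (vec_ac u) (vec_ac w) = to_ac (lin_form u w)"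
  by (simp only: lin_form_3 vec_ac_component to_ac_add to_ac_mult)

lemma cross_vec_ac: "cross (vec_ac u) (vec_ac w) = vec_ac (cross u w)"
  unfolding vec_eq_iff forall_3 cross_component vec_ac_component to_ac_diff to_ac_mult by simp

lemma bit_cases: "(b :: bit) = 0 \<or> b = 1"
  by (cases b) auto

lemma i4_vec_ac: assumes "w \<noteq> 0" shows "i4 (vec_ac w) = 1"
  using assms bit_cases[of "w $ 1"] bit_cases[of "w $ 2"] bit_cases[of "w $ 3"]
  by (auto simp: vec_eq_iff forall_3 i4_def)

lemma bit_vec_proportional:
  assumes "vec_ac u = c *s vec_ac w" "u \<noteq> 0" shows "u = w"
proof -
  obtain i where i: "u $ i \<noteq> 0" using assms(2) by (auto simp: vec_eq_iff)
  have eq: "to_ac (u $ j) = c * to_ac (w $ j)" for j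
    using arg_cong[OF assms(1), of "\<lambda>x. x $ j"] by simp
  have "u $ i = 1" using i bit_cases by blast
  then have "c * to_ac (w $ i) = 1" using eq[of i] by simp
  moreover from this have "w $ i = 1" using bit_cases[of "w $ i"] by auto
  ultimately have "c = 1" by simp
  then show ?thesis using eq by (simp add: vec_eq_iff)
qed

lemma bit_orthogonal_basis:
  fixes w :: "bit^3"
  assumes "w \<noteq> 0" obtains u1 u2 where "lin_form w u1 = 0" "lin_form w u2 = 0" "cross u1 u2 \<noteq> 0"
proof -
  consider "w $ 1 = 1" | "w $ 1 = 0" "w $ 2 = 1" | "w $ 1 = 0" "w $ 2 = 0"
    using bit_cases[of "w $ 1"] bit_cases[of "w $ 2"] by blast
  then show ?thesis
  proof cases
    case 1
    have "cross (vector [w $ 2, 1, 0]) (vector [w $ 3, 0, 1]) $ 1 = (1 :: bit)" by (simp add: vector_3)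
    then have "cross (vector [w $ 2, 1, 0]) (vector [w $ 3, 0, 1]) \<noteq> (0 :: bit^3)"
      by (metis zero_index zero_neq_one)
    then show ?thesis
      by (intro that[of "vector [w $ 2, 1, 0]" "vector [w $ 3, 0, 1]"])
        (use 1 in \<open>auto simp: lin_form_3 vector_3\<close>)
  next
    case 2
    have "cross (vector [1, 0, 0]) (vector [0, w $ 3, 1]) $ 2 = (1 :: bit)" by (simp add: vector_3)
    then have "cross (vector [1, 0, 0]) (vector [0, w $ 3, 1]) \<noteq> (0 :: bit^3)" by (metis zero_index zero_neq_one)
    then show ?thesis
      by (intro that[of "vector [1, 0, 0]" "vector [0, w $ 3, 1]"])
        (use 2 in \<open>auto simp: lin_form_3 vector_3\<close>)
  next
    case 3
    have "cross (vector [1, 0, 0]) (vector [0, 1, 0]) $ 3 = (1 :: bit)" by (simp add: vector_3)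
    then have "cross (vector [1, 0, 0]) (vector [0, 1, 0]) \<noteq> (0 :: bit^3)" by (metis zero_index zero_neq_one)
    then show ?thesis
      by (intro that[of "vector [1, 0, 0]" "vector [0, 1, 0]"])
        (use 3 in \<open>auto simp: lin_form_3 vector_3\<close>)
  qed
qed

lemma card_bit_vec: "card {w :: bit^3. w \<noteq> 0} = 7"
proof -
  define f :: "bit \<times> bit \<times> bit \<Rightarrow> bit^3" where "f = (\<lambda>(a, b, c). vector [a, b, c])"
  have "\<exists>x. w = f x" for w
    by (rule exI[of _ "(w $ 1, w $ 2, w $ 3)"]) (simp add: f_def vec_eq_iff forall_3 vector_3)
  then have "range f = UNIV" by blast
  moreover have "inj f" unfolding f_def inj_def by (auto simp: vec_eq_iff forall_3 vector_3)
  ultimately have "card (UNIV :: (bit^3) set) = card (UNIV :: (bit \<times> bit \<times> bit) set)"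
    using card_image[of f UNIV] by simp
  also have "(UNIV :: bit set) = {0, 1}" using bit_cases by blast
  then have "card (UNIV :: bit set) = 2" by (metis card_2_iff zero_neq_one)
  then have "card (UNIV :: (bit \<times> bit \<times> bit) set) = 8"
    by (simp add: UNIV_Times_UNIV[symmetric] card_cartesian_product del: UNIV_Times_UNIV)
  finally have "card (UNIV :: (bit^3) set) = 8" .
  moreover have "{w :: bit^3. w \<noteq> 0} = UNIV - {0}" by auto
  ultimately show ?thesis by (simp add: card_Diff_singleton)
qed

context twisted_quartic
begin

text \<open>The coefficient vector of the image under \<open>A\<close> of the line over
  \<open>F_2\<close> with coefficients \<open>w\<close>; coefficients transform by the transposed
  inverse.\<close>

definition bit_line :: "bit^3 \<Rightarrow> F2bar^3" where
  "bit_line w = transpose B *v vec_ac w"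

lemma invertible_transpose: "invertible (transpose A)" "invertible (transpose B)"
  using invertible_A by (simp_all add: invertible_det_nz)

lemma transpose_AB: "transpose A *v (transpose B *v v) = v" "transpose B *v (transpose A *v v) = v"
proof -
  have "transpose A ** transpose B = mat 1" "transpose B ** transpose A = mat 1"
    by (simp_all only: matrix_transpose_mul[symmetric] AB BA transpose_mat)
  then show "transpose A *v (transpose B *v v) = v" "transpose B *v (transpose A *v v) = v"
    by (simp_all only: matrix_vector_mul_assoc matrix_vector_mul_lid)
qed

lemma bit_line_eq_0 [simp]: "bit_line w = 0 \<longleftrightarrow> w = 0"
  unfolding bit_line_def using invertible_mult_eq_0[OF invertible_transpose(2)] vec_ac_eq_0 by blast

lemma bit_line_add: "bit_line (u + w) = bit_line u + bit_line w"
  by (simp only: bit_line_def vec_ac_add matrix_vector_right_distrib)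

lemma bit_line_proportional:
  assumes "bit_line u = c *s bit_line w" "u \<noteq> 0" shows "u = w"
proof (rule bit_vec_proportional[OF _ assms(2)])
  have "transpose A *v bit_line u = c *s (transpose A *v bit_line w)"
    by (simp only: assms(1) vector_scalar_commute)
  then show "vec_ac u = c *s vec_ac w" by (simp only: bit_line_def transpose_AB)
qed

lemma frob_B: "frob B = B ** mat_ac P"
proof -
  have "frob A ** frob B = mat 1" by (simp add: frob_mult[symmetric] AB frob_one)
  have "B ** mat_ac P = B ** mat_ac P ** (frob A ** frob B)" by (simp add: \<open>frob A ** frob B = mat 1\<close>)
  also have "\<dots> = B ** (mat_ac P ** frob A) ** frob B" by (simp add: matrix_mul_assoc)
  finally show ?thesis by (simp add: PA BA)
qed

text \<open>The origin of \<open>R = P^t\<close>: from \<open>P A^\<sigma> = A\<close> follows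
  \<open>B^\<sigma> = B P\<close>, and passing to coefficient vectors transposes this.\<close>

lemma sq_bit_line: "sq (bit_line w) = mat_ac (transpose P) *v bit_line w"
proof -
  have "frob (transpose B) = mat_ac (transpose P) ** transpose B"
    by (simp add: frob_transpose frob_B matrix_transpose_mul mat_ac_transpose)
  then show ?thesis unfolding bit_line_def sq_mult sq_vec_ac by (simp only: matrix_vector_mul_assoc)
qed

text \<open>The quartic is 1 at the three points over \<open>F_2\<close> of the line spanned by
  \<open>x\<close> and \<open>y\<close>, and the odd terms vanish because \<open>sq x = x\<close>
  and \<open>sq y = y\<close>. What remains is \<open>a^4 + a^2 b^2 + b^4\<close>, the square of
  \<open>a^2 + a b + b^2\<close>.\<close>

lemma bit_line_bitangent:
  assumes w: "w \<noteq> 0" shows "point (bit_line w) \<in> bitangents (extend_scalars F)"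
proof -
  obtain u1 u2 where u: "lin_form w u1 = 0" "lin_form w u2 = 0" "cross u1 u2 \<noteq> 0"
    by (rule bit_orthogonal_basis[OF w])
  have nz: "u1 \<noteq> 0" "u2 \<noteq> 0" "u1 + u2 \<noteq> 0"
  proof -
    show "u1 \<noteq> 0" "u2 \<noteq> 0" using u(3) by (auto simp: cross_zero)
    show "u1 + u2 \<noteq> 0"
    proof
      assume "u1 + u2 = 0"
      then have "u2 = - u1" by (metis minus_unique)
      then have "cross u1 u2 = 0" by (auto simp: vec_eq_iff forall_3)
      then show False using u(3) by simp
    qed
  qed
  define x y where "x = vec_ac u1" and "y = vec_ac u2"
  have sqs: "sq x = x" "sq y = y" "i4 x = 1" "i4 y = 1" "i4 (x + y) = 1"
    using nz by (simp_all add: x_def y_def i4_vec_ac vec_ac_add[symmetric])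
  have polar: "i4_polar x y = 1"
    using i4_expand[of 1 x 1 y] sqs by (simp add: lin_form_commute cross_self)
  \<comment> \<open>A primitive cube root of unity: in the coordinates of \<open>i4\<close> the
    points of contact are defined over \<open>F_4\<close>.\<close>
  obtain t where t: "t\<^sup>2 + t + 1 = (0 :: F2bar)"
  proof -
    have "degree [:1, 1, 1 :: F2bar:] > 0" by simp
    then obtain t where "poly [:1, 1, 1 :: F2bar:] t = 0" using alg_closed_imp_poly_has_root by blast
    then show ?thesis using that by (simp add: algebra_simps power2_eq_square)
  qed
  have cr: "cross (A *v x) (A *v y) \<noteq> 0"
    using u(3) by (simp add: cross_A_eq_0 x_def y_def cross_vec_ac)
  have on: "lin_form (bit_line w) (A *v x) = 0" "lin_form (bit_line w) (A *v y) = 0"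
    using u(1,2) by (simp_all only: lin_form_matrix bit_line_def transpose_AB x_def y_def lin_form_vec_ac to_ac_0)
  define ps where "ps = [(t, 1), (t, 1), (1 + t, 1), (1 + t, 1 :: F2bar)]"
  have eq: "ev F (a *s (A *v x) + b *s (A *v y)) = 1 * prod_list (map (\<lambda>p. a * snd p - b * fst p) ps)" for a b
  proof -
    have "(a + b * t) * (a + b * (1 + t)) = a\<^sup>2 + a * b + b\<^sup>2 * (t\<^sup>2 + t)"
      by (simp add: algebra_simps power2_eq_square)
    moreover have "t\<^sup>2 + t = 1" using t by (simp add: F2bar_add_eq_0)
    ultimately have f: "(a + b * t) * (a + b * (1 + t)) = a\<^sup>2 + a * b + b\<^sup>2" by simp
    have "B *v (a *s (A *v x) + b *s (A *v y)) = a *s x + b *s y"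
      by (simp add: matrix_vector_right_distrib vector_scalar_commute)
    then have "ev F (a *s (A *v x) + b *s (A *v y)) = a^4 + a\<^sup>2 * b\<^sup>2 + b^4"
      by (simp add: ev_F i4_expand sqs polar)
    also have "\<dots> = (a\<^sup>2 + a * b + b\<^sup>2)\<^sup>2"
      by (simp add: F2bar_square_add power_mult_distrib)
    also have "\<dots> = 1 * prod_list (map (\<lambda>p. a * snd p - b * fst p) ps)"
      unfolding f[symmetric] by (simp add: ps_def F2bar_diff power2_eq_square mult_ac)
    finally show ?thesis .
  qed
  have "is_intersection_divisor (extend_scalars F) (point (bit_line w))
    (mset (map (\<lambda>p. point (fst p *s (A *v x) + snd p *s (A *v y))) ps))"
    by (rule intersection_divisorI[OF form_F cr _ on _ _ eq]) (use w in \<open>auto simp: ps_def\<close>)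
  then show ?thesis unfolding bitangents_def ps_def by (auto simp: add_mset_commute)
qed

text \<open>Multiplicity at least two means that the restriction to the line vanishes together with
  its derivative, so the line is the tangent there, whatever the rest of the divisor is.\<close>

lemma contact_point:
  assumes D: "is_intersection_divisor (extend_scalars F) L D" and two: "2 \<le> count D p"
  shows "on_D (B *v coords p)" "L = point (cross (coords p) (\<sigma> (coords p)))"
proof -
  let ?x = "coords p" and ?y = "coords (other_point L p)" and ?G = "extend_scalars F"
  let ?r = "restrict_line ?G ?x ?y"
  have lm: "2 \<le> line_mult ?G L p" using D two by (simp add: is_intersection_divisor_def)
  then have inc: "incident L p" by (simp add: line_mult_def split: if_splits)
  have "[:- 0, 1:] ^ 2 dvd ?r"
    using lm unfolding line_mult_incident[OF inc] by (rule dvd_trans[OF le_imp_power_dvd order_1])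
  then obtain q where q: "?r = monom 1 2 * q" by (auto simp: monom_altdef elim!: dvdE)
  have tay: "ev F (?x + t *s ?y) = t\<^sup>2 * poly q t" for t
    unfolding poly_restrict_line[symmetric] q by (simp add: poly_monom)
  have "ev F ?x = 0" using tay[of 0] by simp
  then show on: "on_D (B *v ?x)" by (simp add: ev_F on_D_def)
  have g: "gradient ?G ?x = grad (ev F) ?x" by (rule gradient_eq_grad[OF homogeneous_extend[OF F4]])
  have "lin_form (grad (ev F) ?x) ?y = 0"
    by (rule grad_eqI[OF inf_F2bar form_F, where R = q]) (simp add: tay \<open>ev F ?x = 0\<close>)
  then have "lin_form (cross ?x (\<sigma> ?x)) ?y = 0" using det_B unfolding g[symmetric] gradient_F by (simp add: lin_form_simps)
  moreover have "lin_form (cross ?x (\<sigma> ?x)) ?x = 0" by (rule lin_form_cross)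
  ultimately obtain k where k: "cross ?x (\<sigma> ?x) = k *s cross ?x ?y"
    using orthogonal_imp_cross[OF other_point(2)[of p L]] by blast
  have "lin_form (coords L) ?x = 0" "lin_form (coords L) ?y = 0"
    using inc other_point(1)[of L p] by (simp_all add: incident_def)
  then obtain k' where k': "coords L = k' *s cross ?x ?y"
    using orthogonal_imp_cross[OF other_point(2)[of p L]] by blast
  have nz: "k \<noteq> 0" "k' \<noteq> 0" using k k' cross_\<sigma>[OF on] coords_nonzero[of L] by auto
  have "cross ?x (\<sigma> ?x) = (k / k') *s coords L" using nz by (simp add: k k')
  then have "point (coords L) = point (cross ?x (\<sigma> ?x))"
    using point_eq_iff[OF coords_nonzero cross_\<sigma>[OF on], of L] by blast
  then show "L = point (cross ?x (\<sigma> ?x))" by simp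
qed

lemma point_on_line_in_divisor:
  assumes D: "is_intersection_divisor (extend_scalars F) L D" and inc: "incident L p" and on: "on_D (B *v coords p)"
  shows "p \<in># D"
proof -
  let ?x = "coords p" and ?y = "coords (other_point L p)" and ?G = "extend_scalars F"
  have r0: "restrict_line ?G ?x ?y \<noteq> 0"
  proof
    assume 0: "restrict_line ?G ?x ?y = 0"
    have F0: "ev F (?x + t *s ?y) = 0" for t using poly_restrict_line[of ?G ?x ?y t] by (simp add: 0)
    have lin: "lin_form (coords L) ?x = 0" "lin_form (coords L) ?y = 0"
      using inc other_point(1)[of L p] by (simp_all add: incident_def)
    have "q \<in> zero_locus ?G" if "incident L q" for q
    proof -
      have "lin_form (coords L) (coords q) = 0" using that by (simp add: incident_def)
      then obtain a b where ab: "coords q = a *s ?x + b *s ?y"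
        by (rule line_span[OF other_point(2) coords_nonzero lin])
      obtain r where r: "\<And>t. poly r t = ev F (b *s ?y + t *s ?x)" using form_line[OF form_F] by blast
      have "r = 0"
      proof (rule poly_eq_infinite[OF inf_F2bar, of 0])
        fix t :: F2bar assume "t \<noteq> 0"
        then have "b *s ?y + t *s ?x = t *s (?x + (b / t) *s ?y)" by (simp add: vector_add_ldistrib add.commute)
        then have "ev F (b *s ?y + t *s ?x) = t ^ 4 * ev F (?x + (b / t) *s ?y)"
          by (simp only: form_homog[OF form_F])
        then show "poly r t = poly 0 t" by (simp only: r F0 mult_zero_right poly_0)
      qed
      then have "ev F (coords q) = 0" using r[of a] ab by (simp add: add.commute)
      then show ?thesis using zero_locus_iff[OF form_F coords_nonzero, of q] by simp
    qed
    then show False using D unfolding is_intersection_divisor_def by blast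
  qed
  have "poly (restrict_line ?G ?x ?y) 0 = 0" using on by (simp add: poly_restrict_line ev_F on_D_def)
  then have "order 0 (restrict_line ?G ?x ?y) \<noteq> 0" using r0 by (simp add: order_root)
  then have "count D p \<noteq> 0" using D line_mult_incident[OF inc, of ?G] by (simp add: is_intersection_divisor_def)
  then show ?thesis by (simp add: count_eq_zero_iff)
qed

text \<open>The twisted Frobenius map exchanges the two points of contact of a bitangent.\<close>

lemma bitangent_is_bit_line:
  assumes "L \<in> bitangents (extend_scalars F)" shows "\<exists>w. w \<noteq> 0 \<and> L = point (bit_line w)"
proof -
  obtain p q where D: "is_intersection_divisor (extend_scalars F) L {#p, p, q, q#}"
    using assms unfolding bitangents_def by blast
  \<comment> \<open>The point \<open>\<sigma> x\<close> lies on the curve and on the tangent at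
    \<open>x\<close>, and it differs from \<open>p\<close>; so it is the other point of contact. In
    particular hyperflexes do not occur.\<close>
  have step: "point (\<sigma> (coords p)) = q"
    if D: "is_intersection_divisor (extend_scalars F) L {#p, p, q, q#}" for p q
  proof -
    let ?x = "coords p"
    have c: "2 \<le> count {#p, p, q, q#} p" by simp
    note cp = contact_point[OF D c]
    note cr = cross_\<sigma>[OF cp(1)]
    have nz: "\<sigma> ?x \<noteq> 0" using cr by (auto simp: cross_zero)
    have "point (\<sigma> ?x) \<noteq> p"
      using point_eq_iff[OF coords_nonzero nz, of p] cross_eq_0_iff[OF coords_nonzero, of p "\<sigma> ?x"] cr by auto
    moreover have "incident L (point (\<sigma> ?x))"
      using incident_iff[OF cr nz] cp(2) by (simp add: lin_form_cross)
    moreover have "on_D (B *v coords (point (\<sigma> ?x)))"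
    proof -
      have "on_D (B *v \<sigma> ?x)" using on_D_sq[OF cp(1)] by (simp add: \<sigma>_B)
      then have "point (\<sigma> ?x) \<in> curve F" using curve_iff[OF nz] by simp
      then show ?thesis using curve_iff[OF coords_nonzero, of "point (\<sigma> ?x)"] by simp
    qed
    ultimately show ?thesis using point_on_line_in_divisor[OF D] by auto
  qed
  define x where "x = coords p"
  have D': "is_intersection_divisor (extend_scalars F) L {#q, q, p, p#}" using D by (simp add: add_mset_commute)
  have c: "2 \<le> count {#p, p, q, q#} p" by simp
  note cp = contact_point[OF D c, folded x_def]
  note cr = cross_\<sigma>[OF cp(1)]
  have nz: "\<sigma> x \<noteq> 0" "\<sigma> (\<sigma> x) \<noteq> 0"
    using cr on_D_sq[OF on_D_sq[OF cp(1)]] by (auto simp: cross_zero \<sigma>_B on_D_def)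
  have "point (\<sigma> x) = q" "point (\<sigma> (coords q)) = p" using step[OF D] step[OF D'] by (simp_all add: x_def)
  then obtain c where "coords q = c *s \<sigma> x" using point_eq_iff[OF nz(1) coords_nonzero, of q] by auto
  then have q: "\<sigma> (coords q) = c\<^sup>2 *s \<sigma> (\<sigma> x)" by (simp add: \<sigma>_scale)
  have "c \<noteq> 0" using \<open>coords q = c *s \<sigma> x\<close> coords_nonzero[of q] by auto
  then have "c\<^sup>2 *s \<sigma> (\<sigma> x) \<noteq> 0" using nz(2) by simp
  moreover have "point (c\<^sup>2 *s \<sigma> (\<sigma> x)) = point x" using \<open>point (\<sigma> (coords q)) = p\<close> q by (simp add: x_def)
  ultimately obtain d where d: "x = d *s (c\<^sup>2 *s \<sigma> (\<sigma> x))"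
    using point_eq_iff[of "c\<^sup>2 *s \<sigma> (\<sigma> x)" x] by (auto simp: x_def)
  define u where "u = B *v x"
  have u: "on_D u" using cp(1) by (simp add: u_def)
  \<comment> \<open>Two applications of \<open>\<sigma>\<close> lead back to \<open>p\<close>; so
    \<open>u\<close> is defined over \<open>F_4\<close> up to a scalar.\<close>
  have "u = (d * c\<^sup>2) *s vpow 4 u"
    using arg_cong[OF d, of "\<lambda>v. B *v v"] by (simp add: u_def \<sigma>_B vector_scalar_commute vpow_vpow vector_smult_assoc)
  then obtain k where k: "u = k *s vpow 4 u" by blast
  have uc: "cross u (sq u) \<noteq> 0" by (rule on_D_smooth[OF u])
  have k0: "k \<noteq> 0" using k u by (auto simp: on_D_def)
  define m where "m = cross u (sq u)"
  have sqcross: "sq (cross a b) = cross (sq a) (sq b)" for a b :: "F2bar^3"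
    by (simp add: vec_eq_iff forall_3 F2bar_diff F2bar_square_add power_mult_distrib)
  \<comment> \<open>Squaring exchanges the points \<open>u\<close> and \<open>sq u\<close> up to
    scalars, so the line \<open>m\<close> joining them is defined over \<open>F_2\<close> after
    scaling.\<close>
  have "k *s sq m = cross (sq u) (k *s vpow 4 u)" by (simp add: m_def sqcross vpow_vpow cross_scale)
  also have "\<dots> = cross (sq u) u" by (simp add: k[symmetric])
  also have "\<dots> = m" by (simp add: m_def vec_eq_iff forall_3 F2bar_diff add.commute mult.commute)
  finally have "k *s sq m = m" .
  then have "sq (k *s m) = k *s m"
    unfolding vpow_scale power2_eq_square vector_smult_assoc[symmetric] by (simp only:)
  then obtain w where w: "k *s m = vec_ac w" using vec_ac_exists by blast
  have "vec_ac w \<noteq> 0" using uc k0 unfolding w[symmetric] vector_mul_eq_0 m_def by simp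
  then have "w \<noteq> 0" by simp
  have m: "m = inverse k *s vec_ac w"
    using k0 by (simp add: w[symmetric] vector_smult_assoc)
  have "cross x (\<sigma> x) = det A *s (transpose B *v m)"
  proof (rule lin_form_eqI)
    fix v
    have "lin_form (cross x (\<sigma> x)) v = det_cols (A *v u) (A *v sq u) (A *v (B *v v))"
      by (simp add: det_cols_eq u_def \<sigma>_B)
    also have "\<dots> = det A * lin_form m (B *v v)" unfolding det_cols_mult unfolding det_cols_eq m_def ..
    finally show "lin_form (cross x (\<sigma> x)) v = lin_form (det A *s (transpose B *v m)) v"
      by (simp only: lin_form_simps lin_form_matrix)
  qed
  also note m
  finally have "cross x (\<sigma> x) = (det A * inverse k) *s bit_line w"
    by (simp only: bit_line_def vector_scalar_commute vector_smult_assoc)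
  then have "point (bit_line w) = point (cross x (\<sigma> x))"
    using point_eq_iff[of "bit_line w" "cross x (\<sigma> x)"] cr \<open>w \<noteq> 0\<close> bit_line_eq_0[of w] by blast
  then have "L = point (bit_line w)" unfolding cp(2) by (rule sym)
  then show ?thesis using \<open>w \<noteq> 0\<close> by blast
qed

lemma bitangents_eq: "bitangents (extend_scalars F) = (\<lambda>w. point (bit_line w)) ` {w. w \<noteq> 0}"
proof (intro equalityI subsetI)
  fix L assume "L \<in> bitangents (extend_scalars F)"
  from bitangent_is_bit_line[OF this] show "L \<in> (\<lambda>w. point (bit_line w)) ` {w. w \<noteq> 0}" by (elim exE conjE) (rule image_eqI, assumption, simp)
qed (use bit_line_bitangent in \<open>elim imageE CollectE, simp only:\<close>)

lemma inj_bit_line: "inj_on (\<lambda>w. point (bit_line w)) {w. w \<noteq> 0}"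
proof (rule inj_onI)
  fix u w assume "u \<in> {w. w \<noteq> 0}" "w \<in> {w. w \<noteq> 0}" "point (bit_line u) = point (bit_line w)"
  then obtain c where "bit_line w = c *s bit_line u" using point_eq_iff[of "bit_line u" "bit_line w"] by auto
  then show "u = w" using bit_line_proportional[of w c u] \<open>w \<in> _\<close> by simp
qed

end

text \<open>If \<open>a \<noteq> b\<close>, then \<open>a\<close>, \<open>b\<close> and
  \<open>a + b\<close> are nonzero and distinct. At each coordinate where \<open>u\<close> and
  \<open>w\<close> are not both zero, \<open>d\<close> equals one of them, and since
  \<open>u\<close> and \<open>w\<close> are distinct and nonzero, at least two of these values are
  required.\<close>

lemma bit_vec_coefficients:
  fixes u w :: "bit^3"
  assumes "a \<noteq> 0" "b \<noteq> 0" "u \<noteq> 0" "w \<noteq> 0" "u \<noteq> w"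
    and eq: "a *s vec_ac u + b *s vec_ac w = d *s vec_ac z"
  shows "a = b"
proof (rule ccontr)
  assume "a \<noteq> b"
  then have "a + b \<noteq> 0" by (simp add: F2bar_add_eq_0)
  have eqn: "a * to_ac (u $ i) + b * to_ac (w $ i) = d * to_ac (z $ i)" for i
    using arg_cong[OF eq, of "\<lambda>x. x $ i"] by simp
  have v: "(u $ i = 1 \<and> w $ i = 0 \<longrightarrow> d = a) \<and> (u $ i = 0 \<and> w $ i = 1 \<longrightarrow> d = b) \<and>
      (u $ i = 1 \<and> w $ i = 1 \<longrightarrow> d = a + b)" for i
    using bit_cases[of "z $ i"] assms(1,2) \<open>a + b \<noteq> 0\<close> eqn[of i] by auto
  obtain i where i: "u $ i \<noteq> w $ i" using assms(5) by (auto simp: vec_eq_iff)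
  obtain j where j: "u $ j = 1" using assms(3) by (auto simp: vec_eq_iff)
  obtain k where k: "w $ k = 1" using assms(4) by (auto simp: vec_eq_iff)
  show False
    using v[of i] v[of j] v[of k] i j k bit_cases[of "u $ i"] bit_cases[of "w $ i"] bit_cases[of "w $ j"] bit_cases[of "u $ k"]
      assms(1,2) \<open>a \<noteq> b\<close> by auto
qed

context twisted_quartic
begin

lemma range_bit_line: "insert 0 (bit_line ` {w. w \<noteq> 0}) = range bit_line"
  using bit_line_eq_0 by (auto simp: image_iff)

lemma bitangent_coefficients_bit_line: "bitangent_coefficients F (bit_line ` {w. w \<noteq> 0})"
proof -
  have "inj_on point (bit_line ` {w. w \<noteq> 0})"
    using inj_on_imageI[of point bit_line "{w. w \<noteq> 0}"] inj_bit_line by (simp only: comp_def)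
  moreover have "a + b \<in> range bit_line" if "a \<in> range bit_line" "b \<in> range bit_line" for a b
    using that by (elim rangeE) (simp only: bit_line_add[symmetric] rangeI)
  ultimately show ?thesis
    unfolding bitangent_coefficients_def range_bit_line by (auto simp: bij_betw_def bitangents_eq image_image)
qed

text \<open>The sum of the representatives of two bitangents is again a multiple of some
  \<open>bit_line z\<close>, which forces their scalars to agree. Hence only one common scalar is
  free.\<close>

lemma bitangent_coefficients_unique:
  assumes V: "bitangent_coefficients F V"
  shows "\<exists>c. c \<noteq> 0 \<and> V = (\<lambda>w. c *s bit_line w) ` {w. w \<noteq> 0}"
proof -
  have V0: "0 \<notin> V" and inj: "inj_on point V" and im: "point ` V = (\<lambda>w. point (bit_line w)) ` {w. w \<noteq> 0}"
    and add: "\<And>a b. a \<in> V \<Longrightarrow> b \<in> V \<Longrightarrow> a + b \<in> insert 0 V"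
    using V unfolding bitangent_coefficients_def bij_betw_def bitangents_eq by blast+
  have "\<exists>c. c \<noteq> 0 \<and> c *s bit_line w \<in> V" if w: "w \<noteq> 0" for w
  proof -
    obtain a where a: "a \<in> V" "point (bit_line w) = point a" using im w by blast
    then have "a \<noteq> 0" using V0 by blast
    then obtain c where "a = c *s bit_line w" using a(2) w point_eq_iff[of "bit_line w" a] by auto
    then show ?thesis using a \<open>a \<noteq> 0\<close> by auto
  qed
  then obtain c where c: "\<And>w. w \<noteq> 0 \<Longrightarrow> c w \<noteq> 0 \<and> c w *s bit_line w \<in> V" by metis
  have all: "\<exists>w. w \<noteq> 0 \<and> a = c w *s bit_line w" if a: "a \<in> V" for a
  proof -
    obtain w where w: "w \<noteq> 0" "point a = point (bit_line w)" using im a by blast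
    have "point (bit_line w) = point (c w *s bit_line w)"
      using point_eq_iff[of "bit_line w" "c w *s bit_line w"] c[OF w(1)] w(1) by auto
    then have "a = c w *s bit_line w" using inj_onD[OF inj] a c[OF w(1)] w(2) by metis
    then show ?thesis using w(1) by blast
  qed
  have eq: "c u = c w" if uw: "u \<noteq> 0" "w \<noteq> 0" for u w
  proof (cases "u = w")
    case False
    have "\<exists>d z. c u *s bit_line u + c w *s bit_line w = d *s bit_line z"
    proof (cases "c u *s bit_line u + c w *s bit_line w = 0")
      case True
      then have "c u *s bit_line u + c w *s bit_line w = 0 *s bit_line 0" by simp
      then show ?thesis by blast
    next
      case False
      then have "c u *s bit_line u + c w *s bit_line w \<in> V"
        using add[of "c u *s bit_line u" "c w *s bit_line w"] c[OF uw(1)] c[OF uw(2)] by simp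
      from all[OF this] show ?thesis by blast
    qed
    then obtain d z where "c u *s bit_line u + c w *s bit_line w = d *s bit_line z" by blast
    then have "transpose A *v (c u *s bit_line u + c w *s bit_line w) = transpose A *v (d *s bit_line z)" by simp
    then have "c u *s vec_ac u + c w *s vec_ac w = d *s vec_ac z"
      by (simp only: bit_line_def matrix_vector_right_distrib vector_scalar_commute transpose_AB)
    then show ?thesis using bit_vec_coefficients[OF _ _ uw False] c[OF uw(1)] c[OF uw(2)] by blast
  qed simp
  have e: "axis 1 1 \<noteq> (0 :: bit^3)" by (simp add: axis_eq_0_iff)
  have "V = (\<lambda>w. c (axis 1 1) *s bit_line w) ` {w. w \<noteq> 0}"
  proof (intro equalityI subsetI)
    fix a assume "a \<in> V"
    from all[OF this] obtain w where w: "w \<noteq> 0" "a = c w *s bit_line w" by blast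
    then have "a = c (axis 1 1) *s bit_line w" by (simp only: eq[OF w(1) e])
    then show "a \<in> (\<lambda>w. c (axis 1 1) *s bit_line w) ` {w. w \<noteq> 0}" by (rule image_eqI) (simp add: w(1))
  next
    fix a assume "a \<in> (\<lambda>w. c (axis 1 1) *s bit_line w) ` {w. w \<noteq> 0}"
    then obtain w where w: "w \<noteq> 0" "a = c (axis 1 1) *s bit_line w" by blast
    then show "a \<in> V" using c[OF w(1)] by (simp only: eq[OF w(1) e])
  qed
  then show ?thesis using c[OF e] by blast
qed

text \<open>The common scalar \<open>c\<close> of the coefficient vectors turns the Frobenius
  condition into \<open>R = c P^t\<close>; as both matrices are over \<open>F_2\<close>, they
  agree.\<close>

theorem frobenius_matrix_iff: "frobenius_matrix F R \<longleftrightarrow> R = transpose P"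
proof
  have PT: "transpose P \<in> PSL32" using P by (simp add: PSL32_def invertible_det_nz)
  show "frobenius_matrix F R" if "R = transpose P"
    unfolding frobenius_matrix_def that
  proof (intro conjI exI[of _ "bit_line ` {w. w \<noteq> 0}"] ballI)
    show "card (bitangents (extend_scalars F)) = 7"
      unfolding bitangents_eq using card_image[OF inj_bit_line] card_bit_vec by simp
  qed (use PT bitangent_coefficients_bit_line sq_bit_line in auto)
  assume "frobenius_matrix F R"
  then obtain V where R: "R \<in> PSL32" and V: "bitangent_coefficients F V"
    and sqV: "\<And>a. a \<in> V \<Longrightarrow> sq a = mat_ac R *v a" unfolding frobenius_matrix_def by blast
  obtain c where c: "c \<noteq> 0" "V = (\<lambda>w. c *s bit_line w) ` {w. w \<noteq> 0}"
    using bitangent_coefficients_unique[OF V] by blast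
  have bl: "mat_ac R *v bit_line w = c *s (mat_ac (transpose P) *v bit_line w)" if "w \<noteq> 0" for w
  proof -
    have "sq (c *s bit_line w) = mat_ac R *v (c *s bit_line w)" using sqV c(2) that by blast
    then have "c\<^sup>2 *s (mat_ac (transpose P) *v bit_line w) = c *s (mat_ac R *v bit_line w)"
      by (simp only: vpow_scale sq_bit_line vector_scalar_commute)
    then have "c *s (mat_ac R *v bit_line w) = c *s (c *s (mat_ac (transpose P) *v bit_line w))"
      by (simp only: power2_eq_square vector_smult_assoc)
    then show ?thesis using c(1) by (simp only: vec.scale_cancel_left) simp
  qed
  define M N where "M = mat_ac R ** transpose B" and "N = mat_ac (transpose P) ** transpose B"
  have entry: "M $ k $ i = c * N $ k $ i" for k i
  proof -
    have "vec_ac (axis i 1) = axis i 1" by (simp add: vec_eq_iff axis_def)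
    then have "M *v axis i 1 = c *s (N *v axis i 1)"
      using bl[of "axis i 1"] by (simp only: bit_line_def M_def N_def matrix_vector_mul_assoc axis_eq_0_iff) simp
    then have "(M *v axis i 1) $ k = c * (N *v axis i 1) $ k" by simp
    then show ?thesis by (simp add: matrix_vector_mult_def axis_def if_distrib cong: if_cong)
  qed
  have MN: "M *v y = c *s (N *v y)" for y
    by (simp add: vec_eq_iff matrix_vector_mult_def entry sum_distrib_left mult.assoc)
  have "mat_ac R *v v = c *s (mat_ac (transpose P) *v v)" for v
    using MN[of "transpose A *v v"] by (simp only: M_def N_def matrix_vector_mul_assoc[symmetric] transpose_AB)
  then show "R = transpose P" using scalar_multiple_imp_eq[OF PT R] by blast
qed

end

section \<open>Isomorphisms and the Frobenius map\<close>

subsection \<open>Matrices preserving the invariant quartic\<close>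

lemma mat_vec: "mat c *v v = c *s (v :: 'a::field^3)"
  by (simp add: vec_eq_iff forall_3 matrix_vector_mult_def sum_3 mat_def)

text \<open>As in \<open>commuting_scalar\<close>, the matrix is diagonal; but now
  \<open>K v^2\<close> has the wrong degree in \<open>v\<close>, and on \<open>(t, 1, 1)\<close> the
  equation \<open>K11 t^2 = K33 t\<close> for all \<open>t\<close> leaves only zero.\<close>

lemma commuting_frobenius_zero:
  assumes "\<And>v. cross v (K *v sq v) = 0" shows "K = (0 :: F2bar^3^3)"
proof -
  note defs = vec_eq_iff forall_3 matrix_vector_mult_def sum_3
  have 1: "K $ 2 $ 1 = 0 \<and> K $ 3 $ 1 = 0"
    using assms[of "axis 1 1"] by (simp add: defs axis_def)
  have 2: "K $ 1 $ 2 = 0 \<and> K $ 3 $ 2 = 0"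
    using assms[of "axis 2 1"] by (simp add: defs axis_def)
  have 3: "K $ 1 $ 3 = 0 \<and> K $ 2 $ 3 = 0"
    using assms[of "axis 3 1"] by (simp add: defs axis_def)
  have eq: "K $ 3 $ 3 = K $ 2 $ 2" "K $ 1 $ 1 * t\<^sup>2 = K $ 3 $ 3 * t" for t
  proof -
    have c: "cross (vector [t, 1, 1]) (K *v sq (vector [t, 1, 1])) $ i = 0" for i
      by (simp only: assms zero_index)
    show "K $ 3 $ 3 = K $ 2 $ 2" "K $ 1 $ 1 * t\<^sup>2 = K $ 3 $ 3 * t"
      using c[of 1] c[of 2] by (simp_all add: matrix_vector_mult_def sum_3 1 2 3 vector_3 mult.commute)
  qed
  obtain t :: F2bar where t: "t \<notin> {0, 1}"
    using inf_F2bar ex_new_if_finite[of "{0, 1 :: F2bar}"] by auto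
  have "K $ 1 $ 1 = K $ 3 $ 3" using eq(2)[of 1] by simp
  moreover have "K $ 1 $ 1 * t\<^sup>2 = K $ 3 $ 3 * t" by (rule eq(2))
  ultimately have "K $ 1 $ 1 = 0" using t by (auto simp: power2_eq_square)
  then show ?thesis
    using 1 2 3 eq(1) \<open>K $ 1 $ 1 = K $ 3 $ 3\<close> by (simp add: vec_eq_iff forall_3)
qed

text \<open>Each entry satisfies \<open>x^2 = d x\<close>, so it is 0 or \<open>d\<close>; division
  by \<open>d\<close> leaves a matrix over \<open>F_2\<close>.\<close>

lemma frob_proportional:
  assumes T: "invertible T" and d: "\<And>v. frob T *v v = d *s (T *v v)"
  shows "\<exists>k Q. k \<noteq> 0 \<and> Q \<in> PSL32 \<and> (\<forall>v. T *v v = k *s (mat_ac Q *v v))"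
proof -
  have "d \<noteq> 0"
  proof
    assume "d = 0"
    then have "sq (T *v axis 1 1) = 0" by (simp add: sq_mult d)
    then have "T *v axis 1 1 = 0" using sq_nonzero by blast
    then show False using invertible_mult_eq_0[OF T, of "axis 1 1"] by (simp add: axis_eq_0_iff)
  qed
  have entry: "(T $ i $ j)\<^sup>2 = d * T $ i $ j" for i j
  proof -
    have "(frob T *v axis j 1) $ i = d * (T *v axis j 1) $ i" by (simp add: d)
    then show ?thesis by (simp add: matrix_vector_mult_def axis_def if_distrib cong: if_cong)
  qed
  define S where "S = (\<chi> i j. T $ i $ j / d)"
  have "frob S = S"
    using \<open>d \<noteq> 0\<close> by (simp add: vec_eq_iff S_def power_divide entry) (simp add: power2_eq_square)
  then obtain Q where Q: "S = mat_ac Q" using mat_ac_exists by blast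
  have TS: "T $ i $ j = d * S $ i $ j" for i j using \<open>d \<noteq> 0\<close> by (simp add: S_def)
  have "det T = d ^ 3 * det S" by (simp add: det_3 TS power3_eq_cube algebra_simps)
  then have "det S \<noteq> 0" using T by (auto simp: invertible_det_nz)
  then have "Q \<in> PSL32" using invertible_mat_ac[of Q] by (simp add: PSL32_def Q invertible_det_nz)
  moreover have "T *v v = d *s (mat_ac Q *v v)" for v
    by (simp add: vec_eq_iff matrix_vector_mult_def TS sum_distrib_left mult.assoc flip: Q)
  ultimately show ?thesis using \<open>d \<noteq> 0\<close> by blast
qed

text \<open>
  Comparing gradients, \<open>T\<close> maps tangents of the invariant quartic to tangents.  The tangent at \<open>v\<close> is
  spanned by \<open>v\<close> and \<open>sq v\<close>, so \<open>T\<close> agrees with its Frobenius conjugate up to a scalar.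
\<close>

lemma preserves_D_rational:
  assumes T: "invertible T" and D: "\<And>v. on_D v \<Longrightarrow> on_D (T *v v)"
  shows "\<exists>k Q. k \<noteq> 0 \<and> Q \<in> PSL32 \<and> (\<forall>v. T *v v = k *s (mat_ac Q *v v))"
proof -
  obtain U where TU: "T ** U = mat 1" "U ** T = mat 1" using invertible_obtain_inverse[OF T] by blast
  have "form 4 (\<lambda>v. i4 (T *v v))" by (rule form_compose_matrix[OF form_i4])
  then obtain h where h: "form 0 h" "\<And>v. i4 (T *v v) = i4 v * h v"
    using vanish_on_D[of 4 "\<lambda>v. i4 (T *v v)"] D unfolding on_D_def by auto
  have c: "i4 (T *v v) = h 0 * i4 v" for v
    using h(2)[of v] form_0[OF h(1), of v 0] by (simp add: mult.commute)
  \<comment> \<open>Comparing the gradients of both sides of \<open>i4 (T v) = h0 i4 v\<close>, with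
    \<open>h0 = h 0\<close>, gives
    \<open>det T (v \<times> T^-1 T^\<sigma> v^2) = h0 (v \<times> v^2)\<close>; \<open>K\<close>
    collects the two sides.\<close>
  define K where "K = mat (det T) ** (U ** frob T) - mat (h 0)"
  have "cross v (K *v sq v) = 0" for v
  proof (rule lin_form_eqI)
    fix w
    have row: "(T *v v) $ i = lin_form (T $ i) v" for v i
      by (simp add: lin_form_def matrix_vector_mult_def)
    have "jac (\<lambda>v. T *v v) v w = T *v w"
      by (simp add: vec_eq_iff jac_component row grad_lin[OF inf_F2bar])
    then have "lin_form (grad (\<lambda>v. i4 (T *v v)) v) w = lin_form (cross (T *v v) (sq (T *v v))) (T *v w)"
      by (simp add: grad_compose[OF inf_F2bar form_i4 form_mv] grad_i4)
    also have "sq (T *v v) = T *v (U *v (frob T *v sq v))"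
      by (simp add: matrix_vector_mul_assoc TU sq_mult matrix_mul_assoc)
    also have "lin_form (cross (T *v v) (T *v (U *v (frob T *v sq v)))) (T *v w) =
        det_cols (T *v v) (T *v (U *v (frob T *v sq v))) (T *v w)" by (simp only: det_cols_eq)
    also have "\<dots> = det T * det_cols v (U *v (frob T *v sq v)) w" by (rule det_cols_mult)
    finally have "det T * lin_form (cross v (U *v (frob T *v sq v))) w = h 0 * lin_form (cross v (sq v)) w"
      unfolding c by (simp add: grad_cmult[OF inf_F2bar form_i4] grad_i4 det_cols_eq)
    moreover have "K *v sq v = det T *s (U *v (frob T *v sq v)) - h 0 *s sq v"
      unfolding K_def matrix_vector_mult_diff_rdistrib by (simp only: matrix_vector_mul_assoc[symmetric] mat_vec)
    then have "lin_form (cross v (K *v sq v)) w =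
        det T * lin_form (cross v (U *v (frob T *v sq v))) w - h 0 * lin_form (cross v (sq v)) w"
      by (simp add: lin_form_3) (simp add: algebra_simps)
    ultimately show "lin_form (cross v (K *v sq v)) w = lin_form 0 w" by (simp add: lin_form_def)
  qed
  then have "K = 0" by (rule commuting_frobenius_zero)
  have "frob T *v v = (h 0 / det T) *s (T *v v)" for v
  proof -
    have "det T \<noteq> 0" using T by (simp add: invertible_det_nz)
    have "K *v v = det T *s (U *v (frob T *v v)) - h 0 *s v"
      unfolding K_def matrix_vector_mult_diff_rdistrib by (simp only: matrix_vector_mul_assoc[symmetric] mat_vec)
    then have "det T *s (U *v (frob T *v v)) = h 0 *s v" by (simp add: \<open>K = 0\<close>)
    then have "T *v (det T *s (U *v (frob T *v v))) = T *v (h 0 *s v)" by simp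
    then have "det T *s (frob T *v v) = h 0 *s (T *v v)"
      unfolding vector_scalar_commute matrix_vector_mul_assoc matrix_mul_assoc TU by simp
    then have "inverse (det T) *s (det T *s (frob T *v v)) = inverse (det T) *s (h 0 *s (T *v v))" by simp
    then show ?thesis using \<open>det T \<noteq> 0\<close> by (simp add: vector_smult_assoc field_class.field_divide_inverse mult.commute)
  qed
  then show ?thesis by (rule frob_proportional[OF T])
qed

subsection \<open>Morphisms\<close>

lemma proj_map_point:
  assumes "invertible M" "v \<noteq> 0" shows "proj_map M (point v) = point (M *v v)"
proof -
  obtain c where c: "coords (point v) = c *s v"
    using point_eq_iff[OF assms(2) coords_nonzero, of "point v"] by auto
  have nz: "M *v v \<noteq> 0" "M *v coords (point v) \<noteq> 0"
    using invertible_mult_eq_0[OF assms(1)] assms(2) by auto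
  show ?thesis
    unfolding proj_map_def using point_eq_iff[OF nz] c by (metis vector_scalar_commute)
qed

lemma morphism_chart:
  assumes phi: "morphism_over K X0 Y0 \<phi>" and y: "y \<noteq> 0" "point y \<in> X0"
  obtains e g d f where "form_over K e g" "\<And>i. form_over K d (f i)" "eval g y \<noteq> 0"
    "\<And>v. v \<noteq> 0 \<Longrightarrow> point v \<in> X0 \<Longrightarrow> eval g v \<noteq> 0 \<Longrightarrow>
      (\<chi> i. eval (f i) v) \<noteq> 0 \<and> \<phi> (point v) = point (\<chi> i. eval (f i) v)"
proof -
  obtain e g d f where f: "form_over K e g" "\<forall>i. form_over K d (f i)" "point y \<notin> zero_locus g"
    "\<forall>v. v \<noteq> 0 \<and> point v \<in> X0 \<and> eval g v \<noteq> 0 \<longrightarrow>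
      (\<chi> i. eval (f i) v) \<noteq> 0 \<and> \<phi> (point v) = point (\<chi> i. eval (f i) v)"
    using phi y(2) unfolding morphism_over_def by blast
  have "eval g y \<noteq> 0" using f(3) y(1) unfolding zero_locus_def by blast
  then show ?thesis using that[of e g d f] f by blast
qed

lemma morphism_chart_form:
  assumes "morphism_over UNIV X0 Y0 \<phi>" "y \<noteq> 0" "point y \<in> X0"
  shows "\<exists>e d g f. form e g \<and> (\<forall>i. form d (\<lambda>v. (f v :: F2bar^3) $ i)) \<and> g y \<noteq> 0 \<and>
    (\<forall>v. v \<noteq> 0 \<longrightarrow> point v \<in> X0 \<longrightarrow> g v \<noteq> 0 \<longrightarrow> f v \<noteq> 0 \<and> \<phi> (point v) = point (f v))"
proof -
  obtain e g d f where f: "form_over UNIV e g" "\<And>i. form_over UNIV d (f i)" "eval g y \<noteq> 0"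
    "\<And>v. v \<noteq> 0 \<Longrightarrow> point v \<in> X0 \<Longrightarrow> eval g v \<noteq> 0 \<Longrightarrow>
      (\<chi> i. eval (f i) v) \<noteq> 0 \<and> \<phi> (point v) = point (\<chi> i. eval (f i) v)"
    using morphism_chart[OF assms] by blast
  show ?thesis
    by (rule exI[of _ e], rule exI[of _ d], rule exI[of _ "eval g"], rule exI[of _ "\<lambda>v. \<chi> i. eval (f i) v"])
      (use f in \<open>auto simp: form_over_def intro!: form_eval\<close>)
qed

lemma form_matrix_apply: "(\<And>j. form d (\<lambda>v. f v $ j)) \<Longrightarrow> form d (\<lambda>v. (M *v f v) $ i)"
  unfolding matrix_vector_mult_def by (simp, intro form_sum form_cmult)

text \<open>A reduction to \<open>quartic_iso\<close> with reversed direction: \<open>psi\<close>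
  has to start from the invariant quartic, so it is \<open>A\<close> followed by the inverse of
  \<open>\<phi>\<close>, and the matrix found there must be inverted.\<close>

lemma isomorphism_linear:
  assumes AB: "A ** B = mat 1" "B ** A = mat 1"
    and Y0: "\<And>y. y \<noteq> 0 \<Longrightarrow> point y \<in> Y0 \<longleftrightarrow> on_D (B *v y)"
    and G: "form 4 G" "\<exists>v. G v \<noteq> 0" and X0: "\<And>y. y \<noteq> 0 \<Longrightarrow> point y \<in> X0 \<longleftrightarrow> G y = 0"
    and iso: "isomorphism_over UNIV X0 Y0 \<phi>"
  shows "\<exists>N. invertible N \<and> (\<forall>y. y \<noteq> 0 \<longrightarrow> (G y = 0 \<longleftrightarrow> on_D (N *v y))) \<and>
    (\<forall>y. y \<noteq> 0 \<longrightarrow> G y = 0 \<longrightarrow> \<phi> (point y) = point (A *v (N *v y)))"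
proof -
  have inv: "invertible A" "invertible B" using AB unfolding invertible_def by blast+
  have AB': "A *v (B *v v) = v" "B *v (A *v v) = v" for v by (simp_all add: matrix_vector_mul_assoc AB)
  have nz: "A *v v = 0 \<longleftrightarrow> v = 0" "B *v v = 0 \<longleftrightarrow> v = 0" for v
    by (simp_all add: invertible_mult_eq_0 inv)
  have bij: "bij_betw \<phi> X0 Y0" and m: "morphism_over UNIV X0 Y0 \<phi>" "morphism_over UNIV Y0 X0 (inv_into X0 \<phi>)"
    using iso unfolding isomorphism_over_def by blast+
  have YA: "point (A *v v) \<in> Y0" if "on_D v" for v
    using Y0[of "A *v v"] that by (simp add: AB' nz on_D_def)
  have inv_X: "inv_into X0 \<phi> q \<in> X0" "\<phi> (inv_into X0 \<phi> q) = q" if "q \<in> Y0" for q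
    using bij that by (auto simp: bij_betw_def inv_into_into f_inv_into_f)
  interpret quartic_iso G "\<lambda>p. inv_into X0 \<phi> (proj_map A p)" "\<lambda>p. proj_map B (\<phi> p)"
  proof (unfold_locales, goal_cases)
    case (3 p)
    then have p: "A *v p \<noteq> 0" "point (A *v p) \<in> Y0" using YA by (auto simp: nz on_D_def)
    obtain e d g f where f: "form e g" "\<forall>i. form d (\<lambda>v. (f v :: F2bar^3) $ i)" "g (A *v p) \<noteq> 0"
      "\<forall>v. v \<noteq> 0 \<longrightarrow> point v \<in> Y0 \<longrightarrow> g v \<noteq> 0 \<longrightarrow> f v \<noteq> 0 \<and> inv_into X0 \<phi> (point v) = point (f v)"
      using morphism_chart_form[OF m(2) p] by (elim exE conjE)
    show ?case
    proof (rule exI[of _ e], rule exI[of _ d], rule exI[of _ "\<lambda>v. g (A *v v)"], rule exI[of _ "\<lambda>v. f (A *v v)"],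
        intro conjI allI impI)
      fix v assume v: "on_D v" "g (A *v v) \<noteq> 0"
      then have v0: "v \<noteq> 0" "A *v v \<noteq> 0" by (auto simp: on_D_def nz)
      have fv: "f (A *v v) \<noteq> 0" "inv_into X0 \<phi> (point (A *v v)) = point (f (A *v v))"
        using f(4) YA[OF v(1)] v0(2) v(2) by blast+
      show "f (A *v v) \<noteq> 0" by (rule fv)
      show "G (f (A *v v)) = 0" using X0[OF fv(1)] inv_X(1)[OF YA[OF v(1)]] fv(2) by simp
      show "inv_into X0 \<phi> (proj_map A (point v)) = point (f (A *v v))"
        using fv(2) by (simp add: proj_map_point[OF inv(1) v0(1)])
    next
      show "form d (\<lambda>v. f (A *v v) $ i)" for i
        by (rule form_compose_matrix[where a = "\<lambda>v. f v $ i"]) (use f(2) in blast)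
    qed (use f form_compose_matrix[OF f(1)] in auto)
  next
    case (4 y)
    then have y: "y \<noteq> 0" "point y \<in> X0" using X0 by auto
    obtain e d g f where f: "form e g" "\<forall>i. form d (\<lambda>v. (f v :: F2bar^3) $ i)" "g y \<noteq> 0"
      "\<forall>v. v \<noteq> 0 \<longrightarrow> point v \<in> X0 \<longrightarrow> g v \<noteq> 0 \<longrightarrow> f v \<noteq> 0 \<and> \<phi> (point v) = point (f v)"
      using morphism_chart_form[OF m(1) y] by (elim exE conjE)
    show ?case
    proof (rule exI[of _ e], rule exI[of _ d], rule exI[of _ g], rule exI[of _ "\<lambda>v. B *v f v"], intro conjI allI impI)
      fix w assume w: "w \<noteq> 0" "G w = 0" "g w \<noteq> 0"
      then have wX: "point w \<in> X0" using X0 by blast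
      have fw: "f w \<noteq> 0" "\<phi> (point w) = point (f w)" using f(4) w wX by blast+
      have "\<phi> (point w) \<in> Y0" using bij wX by (rule bij_betwE[THEN bspec])
      then show "on_D (B *v f w)" using Y0[OF fw(1)] fw(2) by simp
      show "proj_map B (\<phi> (point w)) = point (B *v f w)"
        by (simp add: fw(2) proj_map_point[OF inv(2) fw(1)])
    qed (use f in \<open>auto intro: form_matrix_apply\<close>)
  next
    case (5 v)
    then have v0: "v \<noteq> 0" "A *v v \<noteq> 0" by (auto simp: on_D_def nz)
    show ?case by (simp add: proj_map_point[OF inv(1) v0(1)] proj_map_point[OF inv(2) v0(2)] inv_X(2)[OF YA[OF 5]] AB')
  next
    case (6 y)
    then have y: "point y \<in> X0" using X0 by blast
    obtain z where z: "z \<noteq> 0" "\<phi> (point y) = point z" by (rule point_cases)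
    have "inv_into X0 \<phi> (\<phi> (point y)) = point y" using bij y by (rule bij_betw_inv_into_left)
    then show ?case using z by (simp add: proj_map_point[OF inv(1)] proj_map_point[OF inv(2)] nz AB')
  qed (rule G)+
  obtain M where M: "invertible M"
    "\<forall>v. on_D v \<longrightarrow> inv_into X0 \<phi> (proj_map A (point v)) = point (M *v v)"
    "\<forall>y. y \<noteq> 0 \<longrightarrow> (G y = 0 \<longleftrightarrow> (\<exists>v. on_D v \<and> y = M *v v))"
    using psi_linear by (elim exE conjE)
  obtain N where N: "M ** N = mat 1" "N ** M = mat 1" "invertible N" using invertible_obtain_inverse[OF M(1)] .
  have MN: "M *v (N *v v) = v" "N *v (M *v v) = v" for v by (simp_all add: matrix_vector_mul_assoc N)
  have on: "G y = 0 \<longleftrightarrow> on_D (N *v y)" if y: "y \<noteq> 0" for y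
  proof
    assume "G y = 0"
    then obtain v where "on_D v" "y = M *v v" using M(3)[rule_format, OF y] by blast
    then show "on_D (N *v y)" by (simp add: MN)
  next
    assume "on_D (N *v y)"
    then show "G y = 0" using M(3)[rule_format, OF y] MN(1)[of y] by metis
  qed
  have "\<phi> (point y) = point (A *v (N *v y))" if y: "y \<noteq> 0" "G y = 0" for y
  proof -
    have v: "on_D (N *v y)" using on y by blast
    then have "N *v y \<noteq> 0" by (simp add: on_D_def)
    then have "inv_into X0 \<phi> (point (A *v (N *v y))) = point y"
      using M(2)[rule_format, OF v] by (simp add: proj_map_point[OF inv(1)] MN)
    then show ?thesis using inv_X(2)[OF YA[OF v]] by simp
  qed
  then show ?thesis using N(3) on by blast
qed

lemma on_D_scale: "c \<noteq> 0 \<Longrightarrow> on_D (c *s v) \<longleftrightarrow> on_D v"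
  by (simp add: on_D_def form_homog[OF form_i4])

text \<open>Proportionality is the vanishing of three quadrics, and no nonzero quadric vanishes on
  the quartic. So every vector is an eigenvector of \<open>H' H^-1\<close>.\<close>

lemma proportional_on_D:
  assumes H: "invertible H" and 0: "\<And>u. on_D u \<Longrightarrow> cross (H *v u) (H' *v u) = 0"
  shows "\<exists>c. \<forall>v. H' *v v = c *s (H *v v)"
proof -
  obtain J where J: "H ** J = mat 1" "J ** H = mat 1" using invertible_obtain_inverse[OF H] by blast
  have f: "form 2 (\<lambda>w. cross (H *v w) (H' *v w) $ i)" for i
    by (rule form_cong[OF form_cross[OF form_mv form_mv]]) auto
  have "cross (H *v w) (H' *v w) $ i = 0" for w i
    by (rule vanish_on_D_low_degree[OF f]) (simp_all add: 0 del: cross_component)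
  then have 0: "cross (H *v w) (H' *v w) = 0" for w by (simp add: vec_eq_iff del: cross_component)
  have HJ: "H *v (J *v w) = w" "J *v (H *v w) = w" for w by (simp_all add: matrix_vector_mul_assoc J)
  have "cross ((H' ** J) *v w) w = 0" for w
  proof -
    have "cross w (H' *v (J *v w)) = 0" using 0[of "J *v w"] by (simp only: HJ)
    then show ?thesis
      using cross_commute[of w "(H' ** J) *v w"] by (simp add: matrix_vector_mul_assoc del: cross_component)
  qed
  then obtain c where c: "H' ** J = mat c" using commuting_scalar by blast
  have "H' *v v = c *s (H *v v)" for v
  proof -
    have "H' *v v = (H' ** J) *v (H *v v)" by (simp only: matrix_vector_mul_assoc[symmetric] HJ)
    then show ?thesis by (simp only: c mat_vec)
  qed
  then show ?thesis by blast
qed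

lemma curve_iff_ev: "homogeneous 4 F \<Longrightarrow> v \<noteq> 0 \<Longrightarrow> point v \<in> curve F \<longleftrightarrow> ev F v = 0"
  unfolding curve_def by (rule zero_locus_iff[OF form_ev])

lemma curve_I4_iff: assumes "v \<noteq> 0" shows "point v \<in> curve I4 \<longleftrightarrow> on_D v"
proof -
  have "ev I4 = i4" by (rule ext) (rule ev_I4)
  then have "form 4 (ev I4)" using form_i4 by simp
  then show ?thesis unfolding curve_def using assms by (simp add: zero_locus_iff ev_I4 on_D_def)
qed

lemma ev_nonzero: assumes "F \<noteq> 0" shows "\<exists>v. ev F v \<noteq> 0"
proof (rule ccontr)
  assume "\<not> ?thesis"
  then have "F = 0" by (intro ev_eqI) (simp add: ev_eq to_ac_hom.map_eval_zero)
  then show False using assms by simp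
qed

section \<open>Linear maps as morphisms, and morphisms over the prime field\<close>

lemma morphism_linear:
  fixes K :: "'a::field set"
  assumes K: "0 \<in> K" "1 \<in> K" "\<And>a b. a \<in> K \<Longrightarrow> b \<in> K \<Longrightarrow> a + b \<in> K" and M: "\<And>i j. M $ i $ j \<in> K"
    and \<phi>: "\<And>v. v \<noteq> 0 \<Longrightarrow> point v \<in> X0 \<Longrightarrow>
      M *v v \<noteq> 0 \<and> point (M *v v) \<in> Y0 \<and> \<phi> (point v) = point (M *v v)"
  shows "morphism_over K X0 Y0 \<phi>"
proof -
  define f where "f i = Const (M $ i $ 1) * Var 1 + (Const (M $ i $ 2) * Var 2 + Const (M $ i $ 3) * Var 3)" for i :: 3
  have lt: "Const a * Var j = Poly_Mapping.single (Poly_Mapping.single j 1) a" for a :: 'a and j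
    by (simp add: Const_def Var_def mult_single)
  have "homogeneous 1 (Poly_Mapping.single (Poly_Mapping.single j 1) a)" for a :: 'a and j :: 3
    by (auto simp: homogeneous_def lookup_single when_def)
  then have f1: "form_over K 1 (f i)" for i
    using K(1) M unfolding f_def lt form_over_def
    by (auto intro!: homogeneous_add K(3) simp: lookup_add lookup_single when_def)
  have ev: "(\<chi> i. eval (f i) v) = M *v v" for v
    by (simp add: vec_eq_iff f_def eval_add eval_mult eval_Const eval_Var matrix_vector_mult_def sum_3 add.assoc)
  have g: "form_over K 0 (Const (1 :: 'a))"
    using K by (simp add: form_over_def homogeneous_def Const_def lookup_one when_def)
  have im: "\<phi> ` X0 \<subseteq> Y0"
  proof
    fix q assume "q \<in> \<phi> ` X0"
    then obtain p where p: "p \<in> X0" "q = \<phi> p" by blast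
    obtain v where "v \<noteq> 0" "p = point v" by (rule point_cases)
    then show "q \<in> Y0" using \<phi>[of v] p by simp
  qed
  show ?thesis
    unfolding morphism_over_def
  proof (intro conjI ballI im)
    fix p assume "p \<in> X0"
    show "\<exists>e g d f. form_over K e g \<and> (\<forall>i::3. form_over K d (f i)) \<and> p \<notin> zero_locus g \<and>
        (\<forall>v. v \<noteq> 0 \<and> point v \<in> X0 \<and> eval g v \<noteq> 0 \<longrightarrow>
           (\<chi> i. eval (f i) v) \<noteq> 0 \<and> \<phi> (point v) = point (\<chi> i. eval (f i) v))"
      by (rule exI[of _ 0], rule exI[of _ "Const 1"], rule exI[of _ 1], rule exI[of _ f], unfold ev)
        (use f1 g \<phi> in \<open>auto simp: zero_locus_def eval_Const\<close>)
  qed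
qed

lemma isomorphism_over_linear:
  fixes K :: "'a::field set"
  assumes K: "0 \<in> K" "1 \<in> K" "\<And>a b. a \<in> K \<Longrightarrow> b \<in> K \<Longrightarrow> a + b \<in> K"
    and MN: "M ** N = mat 1" "N ** M = mat 1" and entries: "\<And>i j. M $ i $ j \<in> K" "\<And>i j. N $ i $ j \<in> K"
    and XY: "\<And>v. v \<noteq> 0 \<Longrightarrow> point v \<in> X0 \<longleftrightarrow> point (M *v v) \<in> Y0"
    and \<phi>: "\<And>v. v \<noteq> 0 \<Longrightarrow> point v \<in> X0 \<Longrightarrow> \<phi> (point v) = point (M *v v)"
  shows "isomorphism_over K X0 Y0 \<phi>"
proof -
  have inv: "invertible M" "invertible N" using MN unfolding invertible_def by blast+
  have MN': "M *v (N *v v) = v" "N *v (M *v v) = v" for v by (simp_all add: matrix_vector_mul_assoc MN)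
  have nz: "M *v v = 0 \<longleftrightarrow> v = 0" "N *v v = 0 \<longleftrightarrow> v = 0" for v
    by (simp_all add: invertible_mult_eq_0 inv)
  have YN: "point (N *v z) \<in> X0" if "z \<noteq> 0" "point z \<in> Y0" for z
    using XY[of "N *v z"] that by (simp add: nz MN')
  have bij: "bij_betw \<phi> X0 Y0"
  proof (rule bij_betw_byWitness[where f' = "proj_map N"])
    show "\<forall>p\<in>X0. proj_map N (\<phi> p) = p"
    proof
      fix p assume p: "p \<in> X0"
      obtain v where v: "v \<noteq> 0" "p = point v" by (rule point_cases)
      have "M *v v \<noteq> 0" using v(1) nz by blast
      then show "proj_map N (\<phi> p) = p" using p v \<phi>[of v] by (simp add: proj_map_point[OF inv(2)] MN')
    qed
    have N: "proj_map N p \<in> X0 \<and> \<phi> (proj_map N p) = p" if p: "p \<in> Y0" for p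
    proof -
      obtain v where v: "v \<noteq> 0" "p = point v" by (rule point_cases)
      have "N *v v \<noteq> 0" using v(1) nz by blast
      then show ?thesis using p v YN[of v] \<phi>[of "N *v v"] by (simp add: proj_map_point[OF inv(2)] MN')
    qed
    then show "\<forall>p\<in>Y0. \<phi> (proj_map N p) = p" "proj_map N ` Y0 \<subseteq> X0" by blast+
    show "\<phi> ` X0 \<subseteq> Y0"
    proof
      fix q assume "q \<in> \<phi> ` X0"
      then obtain p where p: "p \<in> X0" "q = \<phi> p" by blast
      obtain v where "v \<noteq> 0" "p = point v" by (rule point_cases)
      then show "q \<in> Y0" using \<phi>[of v] XY[of v] p by simp
    qed
  qed
  moreover have "morphism_over K X0 Y0 \<phi>"
    by (rule morphism_linear[OF K entries(1)]) (use nz \<phi> XY in auto)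
  moreover have "morphism_over K Y0 X0 (inv_into X0 \<phi>)"
  proof (rule morphism_linear[OF K entries(2)], assumption+, intro conjI)
    fix z assume z: "z \<noteq> 0" "point z \<in> Y0"
    show nz': "N *v z \<noteq> 0" using z(1) nz by blast
    show X: "point (N *v z) \<in> X0" by (rule YN[OF z])
    have "\<phi> (point (N *v z)) = point z" using \<phi>[OF nz' X] by (simp only: MN')
    then show "inv_into X0 \<phi> (point z) = point (N *v z)" using bij_betw_inv_into_left[OF bij X] by simp
  qed
  ultimately show ?thesis unfolding isomorphism_over_def by blast
qed

lemma morphism_over_UNIV: "morphism_over K X0 Y0 \<phi> \<Longrightarrow> morphism_over UNIV X0 Y0 \<phi>"
proof -
  assume \<phi>: "morphism_over K X0 Y0 \<phi>"
  have mono: "form_over K d p \<Longrightarrow> form_over UNIV d p" for d p by (simp add: form_over_def)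
  show ?thesis
    unfolding morphism_over_def
  proof (intro conjI ballI)
    show "\<phi> ` X0 \<subseteq> Y0" using \<phi> unfolding morphism_over_def by blast
    fix p assume p: "p \<in> X0"
    obtain e g d f where f: "form_over K e g" "\<forall>i. form_over K d (f i)" "p \<notin> zero_locus g"
      "\<forall>v. v \<noteq> 0 \<and> point v \<in> X0 \<and> eval g v \<noteq> 0 \<longrightarrow>
        (\<chi> i. eval (f i) v) \<noteq> 0 \<and> \<phi> (point v) = point (\<chi> i. eval (f i) v)"
      using \<phi> p unfolding morphism_over_def by blast
    show "\<exists>e g d f. form_over UNIV e g \<and> (\<forall>i::3. form_over UNIV d (f i)) \<and> p \<notin> zero_locus g \<and>
        (\<forall>v. v \<noteq> 0 \<and> point v \<in> X0 \<and> eval g v \<noteq> 0 \<longrightarrow>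
           (\<chi> i. eval (f i) v) \<noteq> 0 \<and> \<phi> (point v) = point (\<chi> i. eval (f i) v))"
      by (rule exI[of _ e], rule exI[of _ g], rule exI[of _ d], rule exI[of _ f])
        (use f mono in simp)
  qed
qed

lemma isomorphism_over_UNIV: "isomorphism_over K X0 Y0 \<phi> \<Longrightarrow> isomorphism_over UNIV X0 Y0 \<phi>"
  unfolding isomorphism_over_def by (intro conjI morphism_over_UNIV) blast+

lemma eval_sq: assumes "form_over (range (to_ac :: bit \<Rightarrow> F2bar)) d p" shows "eval p (sq v) = (eval p v)\<^sup>2"
proof -
  obtain G where "p = extend_scalars G" using map_to_ac_exists assms unfolding form_over_def by blast
  then show ?thesis by (simp add: ev_sq)
qed

lemma range_to_ac: "0 \<in> range (to_ac :: bit \<Rightarrow> F2bar)" "1 \<in> range (to_ac :: bit \<Rightarrow> F2bar)"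
  "a \<in> range to_ac \<Longrightarrow> b \<in> range to_ac \<Longrightarrow> a + b \<in> range (to_ac :: bit \<Rightarrow> F2bar)"
proof -
  show "0 \<in> range (to_ac :: bit \<Rightarrow> F2bar)" using rangeI[of to_ac "0 :: bit"] by simp
  show "1 \<in> range (to_ac :: bit \<Rightarrow> F2bar)" using rangeI[of to_ac "1 :: bit"] by simp
  assume "a \<in> range to_ac" "b \<in> range to_ac"
  then show "a + b \<in> range (to_ac :: bit \<Rightarrow> F2bar)" by (elim rangeE) (simp only: to_ac_add[symmetric] rangeI)
qed

lemma PSL32_obtain_inverse:
  assumes "Q \<in> PSL32" obtains Q' where "Q' \<in> PSL32" "Q ** Q' = mat 1" "Q' ** Q = mat 1"
  using invertible_obtain_inverse[of Q] assms unfolding PSL32_def by blast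

lemma mat_ac_cancel: "Q ** Q' = mat 1 \<Longrightarrow> mat_ac Q *v (mat_ac Q' *v v) = v"
  by (simp only: matrix_vector_mul_assoc mat_ac_mult[symmetric] mat_ac_one matrix_vector_mul_lid)

lemma mat_ac_eq_0: "Q \<in> PSL32 \<Longrightarrow> mat_ac Q *v v = 0 \<longleftrightarrow> v = 0"
  using invertible_mult_eq_0[of "mat_ac Q" v] invertible_mat_ac[of Q] by (simp add: PSL32_def)

lemma sq_0 [simp]: "sq (0 :: F2bar^3) = 0"
  by (simp add: vec_eq_iff)

lemma PSL32_mult: "P \<in> PSL32 \<Longrightarrow> Q \<in> PSL32 \<Longrightarrow> P ** Q \<in> PSL32"
  by (simp add: PSL32_def invertible_mult)

lemma (in twist) isomorphic_quotient: "isomorphic_curves (curve (quotient_form P)) (curve I4)"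
proof -
  have "isomorphism_over UNIV (curve (quotient_form P)) (curve I4) (proj_map B)"
    by (rule isomorphism_over_linear[OF _ _ _ BA AB])
      (simp_all add: curve_quotient_iff curve_I4_iff proj_map_point invertible_A)
  then show ?thesis unfolding isomorphic_curves_def by blast
qed

text \<open>\<open>N\<close> maps the curve to \<open>I4 = 0\<close>. As \<open>F\<close> has
  coefficients in \<open>F_2\<close>, squaring preserves its zeros, so
  \<open>T = N J^\<sigma>\<close> preserves \<open>I4 = 0\<close> and is \<open>k Q\<close> with
  \<open>Q\<close> over \<open>F_2\<close>. After rescaling \<open>A^\<sigma> = A Q\<close>, and
  Lang's equation then determines \<open>P\<close>.\<close>

lemma isomorphic_imp_quotient:
  assumes F: "F \<noteq> 0" "homogeneous 4 F" and "isomorphic_curves (curve F) (curve I4)"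
  shows "\<exists>P\<in>PSL32. curve F = curve (quotient_form P)"
proof -
  obtain \<phi> where "isomorphism_over UNIV (curve F) (curve I4) \<phi>"
    using assms(3) unfolding isomorphic_curves_def by blast
  then have "\<exists>N. invertible N \<and> (\<forall>y. y \<noteq> 0 \<longrightarrow> (ev F y = 0 \<longleftrightarrow> on_D (N *v y))) \<and>
      (\<forall>y. y \<noteq> 0 \<longrightarrow> ev F y = 0 \<longrightarrow> \<phi> (point y) = point (mat 1 *v (N *v y)))"
    by (intro isomorphism_linear[where B = "mat 1"])
      (use F in \<open>simp_all add: curve_I4_iff curve_iff_ev form_ev ev_nonzero\<close>)
  then obtain N where N: "invertible N" "\<forall>y. y \<noteq> 0 \<longrightarrow> (ev F y = 0 \<longleftrightarrow> on_D (N *v y))"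
    by (elim exE conjE)
  obtain J where J: "N ** J = mat 1" "J ** N = mat 1" "invertible J" using invertible_obtain_inverse[OF N(1)] .
  have NJ: "N *v (J *v v) = v" "J *v (N *v v) = v" for v by (simp_all add: matrix_vector_mul_assoc J)
  define T where "T = N ** frob J"
  have "invertible T"
    unfolding T_def using N(1) J(3) by (intro invertible_mult) (simp_all add: invertible_det_nz det_frob)
  moreover have "on_D (T *v u)" if u: "on_D u" for u
  proof -
    obtain w where w: "sq w = u" using sq_surj[of u] by blast
    have "w \<noteq> 0" using u unfolding w[symmetric] on_D_def by auto
    moreover have "i4 w = 0" using u i4_sq[of w] unfolding w on_D_def by simp
    ultimately have "on_D w" by (simp add: on_D_def)
    define y where "y = J *v w"
    have y: "y \<noteq> 0" using \<open>w \<noteq> 0\<close> invertible_mult_eq_0[OF J(3)] unfolding y_def by blast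
    then have "ev F y = 0" using N(2)[rule_format, OF y] \<open>on_D w\<close> by (simp add: y_def NJ)
    then have "ev F (sq y) = 0" by (simp add: ev_sq)
    then have "on_D (N *v sq y)" using N(2) sq_nonzero[OF y] by blast
    then show ?thesis by (simp only: T_def y_def sq_mult w matrix_vector_mul_assoc)
  qed
  ultimately obtain k Q where Q: "k \<noteq> 0" "Q \<in> PSL32" "\<forall>v. T *v v = k *s (mat_ac Q *v v)"
    using preserves_D_rational by blast
  obtain Q' where Q': "Q' \<in> PSL32" "Q ** Q' = mat 1" "Q' ** Q = mat 1" using PSL32_obtain_inverse[OF Q(2)] .
  text \<open>Rescaling \<open>J\<close> turns the scalar \<open>k\<close> in its Frobenius conjugate into \<open>1\<close>.\<close>
  define A B where "A = mat (inverse k) ** J" and "B = mat k ** N"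
  have Av: "A *v v = inverse k *s (J *v v)" and Bv: "B *v v = k *s (N *v v)" for v
    by (simp_all only: A_def B_def matrix_vector_mul_assoc[symmetric] mat_vec)
  have AB: "A ** B = mat 1" and BA: "B ** A = mat 1"
    by (rule matrix_eqI, use Q(1) in \<open>simp add: matrix_vector_mul_assoc[symmetric] Av Bv vector_scalar_commute NJ vector_smult_assoc\<close>)+
  have frobJ: "frob J *v v = k *s (J *v (mat_ac Q *v v))" for v
  proof -
    have "J *v (T *v v) = frob J *v v" by (simp only: T_def matrix_vector_mul_assoc[symmetric] NJ)
    then show ?thesis by (simp only: Q(3)[rule_format] vector_scalar_commute)
  qed
  have frobA: "frob A = A ** mat_ac Q"
  proof (rule matrix_eqI)
    fix v
    have "frob (mat (inverse k)) = mat ((inverse k)\<^sup>2)" by (simp add: vec_eq_iff mat_def)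
    then have "frob A *v v = ((inverse k)\<^sup>2 * k) *s (J *v (mat_ac Q *v v))"
      by (simp only: A_def frob_mult matrix_vector_mul_assoc[symmetric] mat_vec frobJ vector_smult_assoc)
    also have "(inverse k)\<^sup>2 * k = inverse k" using Q(1) by (simp add: power2_eq_square)
    finally show "frob A *v v = (A ** mat_ac Q) *v v" by (simp only: matrix_vector_mul_assoc[symmetric] Av)
  qed
  have Qm: "mat_ac Q ** mat_ac Q' = mat 1" "mat_ac Q' ** mat_ac Q = mat 1"
    by (simp_all only: mat_ac_mult[symmetric] Q' mat_ac_one)
  have frobB: "frob B = mat_ac Q' ** B"
  proof -
    have "frob A ** frob B = mat 1" by (simp only: frob_mult[symmetric] AB frob_one)
    then have "mat_ac Q' ** (B ** (A ** mat_ac Q ** frob B)) = mat_ac Q' ** (B ** mat 1)" by (simp only: frobA)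
    then show ?thesis
      by (simp only: matrix_mul_assoc matrix_mul_rid) (simp only: matrix_mul_assoc[symmetric] BA Qm matrix_mul_lid matrix_mul_assoc[symmetric, of "mat_ac Q'" B A])
  qed
  \<comment> \<open>The only candidate for \<open>P\<close>: the equations
    \<open>P A^\<sigma> = A\<close> and \<open>A^\<sigma> = A Q\<close> force
    \<open>P = A Q^-1 A^-1\<close>. It remains to see that squaring fixes its entries.\<close>
  define M where "M = A ** mat_ac Q' ** B"
  have "frob M = A ** (mat_ac Q ** mat_ac Q') ** (mat_ac Q' ** B)"
    by (simp only: M_def frob_mult frobA frobB frob_mat_ac matrix_mul_assoc)
  then have "frob M = M" by (simp only: Qm matrix_mul_rid M_def matrix_mul_assoc)
  then obtain P where P: "M = mat_ac P" using mat_ac_exists by blast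
  have "invertible A" "invertible B" using AB BA unfolding invertible_def by blast+
  moreover have "invertible (mat_ac Q')" using Q'(1) by (simp add: PSL32_def invertible_mat_ac)
  ultimately have "invertible M" unfolding M_def by (intro invertible_mult)
  then have "P \<in> PSL32" by (simp add: PSL32_def P invertible_mat_ac)
  moreover have "mat_ac P ** frob A = A"
  proof -
    have "mat_ac P ** frob A = A ** mat_ac Q' ** (B ** A) ** mat_ac Q"
      by (simp only: P[symmetric] M_def frobA matrix_mul_assoc)
    also have "\<dots> = A ** (mat_ac Q' ** mat_ac Q)" by (simp only: BA matrix_mul_rid matrix_mul_assoc)
    finally show ?thesis by (simp only: Qm matrix_mul_rid)
  qed
  ultimately interpret twist P A B using AB BA by unfold_locales
  have "p \<in> curve F \<longleftrightarrow> p \<in> curve (quotient_form P)" for p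
  proof -
    obtain y where y: "y \<noteq> 0" "p = point y" by (rule point_cases)
    show ?thesis
      using y N(2)[rule_format, OF y(1)] on_D_scale[OF Q(1)] by (simp add: curve_iff_ev[OF F(2)] curve_quotient_iff Bv)
  qed
  then show ?thesis using \<open>P \<in> PSL32\<close> by blast
qed

subsection \<open>Rational automorphisms\<close>

context twisted_quartic
begin

lemma F_nonzero: "F \<noteq> 0"
proof
  assume "F = 0"
  then have "i4 v = 0" for v using ev_F[of "A *v v"] by (simp add: ev_eq to_ac_hom.map_eval_zero)
  moreover have "i4 (vec_ac (axis 1 1)) = 1" by (rule i4_vec_ac) (simp add: axis_eq_0_iff)
  ultimately show False by simp
qed

lemma twist_conjugate:
  assumes Q: "Q \<in> PSL32" "Q' \<in> PSL32" "Q ** Q' = mat 1" "Q' ** Q = mat 1"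
  shows "twist (Q ** P ** Q') (mat_ac Q ** A) (B ** mat_ac Q')"
proof
  have PAv: "mat_ac P *v (frob A *v v) = A *v v" for v by (simp only: matrix_vector_mul_assoc PA)
  show "Q ** P ** Q' \<in> PSL32" by (intro PSL32_mult Q P)
  show "mat_ac Q ** A ** (B ** mat_ac Q') = mat 1" "B ** mat_ac Q' ** (mat_ac Q ** A) = mat 1"
    by (rule matrix_eqI, simp only: matrix_vector_mul_assoc[symmetric] A_B B_A mat_ac_cancel[OF Q(3)] mat_ac_cancel[OF Q(4)] matrix_vector_mul_lid)+
  show "mat_ac (Q ** P ** Q') ** frob (mat_ac Q ** A) = mat_ac Q ** A"
    by (rule matrix_eqI)
      (simp only: mat_ac_mult frob_mult frob_mat_ac matrix_vector_mul_assoc[symmetric] mat_ac_cancel[OF Q(4)] PAv)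
qed

text \<open>For commuting \<open>Q\<close> both \<open>A\<close> and \<open>Q A\<close> solve Lang's
  equation for \<open>P\<close>, and the quotient form does not depend on the solution. Its two
  expressions differ by the substitution of \<open>Q^-1\<close>.\<close>

lemma centralizer_preserves_curve:
  assumes Q: "Q \<in> PSL32" "Q ** P = P ** Q" and v: "v \<noteq> 0"
  shows "point v \<in> curve F \<longleftrightarrow> point (mat_ac Q *v v) \<in> curve F"
proof -
  obtain Q' where Q': "Q' \<in> PSL32" "Q ** Q' = mat 1" "Q' ** Q = mat 1" using PSL32_obtain_inverse[OF Q(1)] .
  have "Q ** P ** Q' = P" unfolding Q(2) by (simp only: matrix_mul_assoc[symmetric] Q' matrix_mul_rid)
  then interpret t: twist P "mat_ac Q ** A" "B ** mat_ac Q'" using twist_conjugate[OF Q(1) Q'] by simp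
  have nz: "mat_ac Q *v v \<noteq> 0" using v mat_ac_eq_0[OF Q(1)] by blast
  have "on_D (B *v (mat_ac Q *v v)) \<longleftrightarrow> on_D ((B ** mat_ac Q') *v (mat_ac Q *v v))"
    using curve_quotient_iff[OF nz] t.curve_quotient_iff[OF nz] by simp
  also have "(B ** mat_ac Q') *v (mat_ac Q *v v) = B *v v"
    by (simp only: matrix_vector_mul_assoc[symmetric] mat_ac_cancel[OF Q'(3)])
  finally show ?thesis using curve_iff[OF nz] curve_iff[OF v] by simp
qed

text \<open>A curve preserved by \<open>Q\<close> comes from \<open>P\<close> and also from
  \<open>Q P Q^-1\<close>. Its Frobenius matrix on the bitangents determines the matrix, so the two
  agree.\<close>

lemma preserves_curve_imp_centralizer:
  assumes Q: "Q \<in> PSL32" and C: "\<And>v. v \<noteq> 0 \<Longrightarrow> point v \<in> curve F \<longleftrightarrow> point (mat_ac Q *v v) \<in> curve F"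
  shows "Q ** P = P ** Q"
proof -
  obtain Q' where Q': "Q' \<in> PSL32" "Q ** Q' = mat 1" "Q' ** Q = mat 1" using PSL32_obtain_inverse[OF Q] .
  interpret t: twist "Q ** P ** Q'" "mat_ac Q ** A" "B ** mat_ac Q'" by (rule twist_conjugate[OF Q Q'])
  have "p \<in> curve F \<longleftrightarrow> p \<in> curve (quotient_form (Q ** P ** Q'))" for p
  proof -
    obtain y where y: "y \<noteq> 0" "p = point y" by (rule point_cases)
    have nz: "mat_ac Q' *v y \<noteq> 0" using y(1) mat_ac_eq_0[OF Q'(1)] by blast
    show ?thesis
      using C[OF nz] curve_iff[OF nz] t.curve_quotient_iff[OF y(1)]
      by (simp only: y(2) mat_ac_cancel[OF Q'(2)] matrix_vector_mul_assoc[symmetric])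
  qed
  then have "curve F = curve (quotient_form (Q ** P ** Q'))" by blast
  then interpret t: twisted_quartic "Q ** P ** Q'" "mat_ac Q ** A" "B ** mat_ac Q'" F
    by unfold_locales (rule F4, rule t.ev_unique[OF F_nonzero F4])
  have "frobenius_matrix F (transpose P)" by (simp only: frobenius_matrix_iff)
  then have "transpose P = transpose (Q ** P ** Q')" by (simp only: t.frobenius_matrix_iff)
  then have "P = Q ** P ** Q'" by (metis transpose_transpose)
  then have "P ** Q = Q ** P ** (Q' ** Q)" by (metis matrix_mul_assoc)
  then show ?thesis by (simp only: Q' matrix_mul_rid)
qed

text \<open>A map given by forms over \<open>F_2\<close> commutes with squaring of coordinates. For
  its matrix \<open>H\<close> this means that \<open>H y^2\<close> and \<open>H^\<sigma> y^2\<close>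
  are the same point; every point of the curve is such a square, so \<open>H\<close> is a multiple
  of a matrix over \<open>F_2\<close>.\<close>

lemma rational_automorphism_linear:
  assumes \<phi>: "isomorphism_over (range to_ac) (curve F) (curve F) \<phi>"
  shows "\<exists>Q\<in>PSL32. Q ** P = P ** Q \<and> (\<forall>v. v \<noteq> 0 \<longrightarrow> point v \<in> curve F \<longrightarrow> \<phi> (point v) = point (mat_ac Q *v v))"
proof -
  have "\<exists>N. invertible N \<and> (\<forall>y. y \<noteq> 0 \<longrightarrow> (ev F y = 0 \<longleftrightarrow> on_D (N *v y))) \<and>
      (\<forall>y. y \<noteq> 0 \<longrightarrow> ev F y = 0 \<longrightarrow> \<phi> (point y) = point (A *v (N *v y)))"
    by (rule isomorphism_linear[OF AB BA curve_iff form_F ev_nonzero[OF F_nonzero] curve_iff_ev[OF F4]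
        isomorphism_over_UNIV[OF \<phi>]])
  then obtain N where N: "invertible N" "\<forall>y. y \<noteq> 0 \<longrightarrow> (ev F y = 0 \<longleftrightarrow> on_D (N *v y))"
    "\<forall>y. y \<noteq> 0 \<longrightarrow> ev F y = 0 \<longrightarrow> \<phi> (point y) = point (A *v (N *v y))" by (elim exE conjE)
  define H where "H = A ** N"
  have H: "invertible H" unfolding H_def by (intro invertible_mult invertible_A N)
  have Hv: "A *v (N *v v) = H *v v" for v by (simp only: H_def matrix_vector_mul_assoc)
  have H0: "H *v v = 0 \<longleftrightarrow> v = 0" for v by (rule invertible_mult_eq_0[OF H])
  have cr: "cross (H *v sq y) (frob H *v sq y) = 0" if y: "y \<noteq> 0" "ev F y = 0" for y
  proof -
    have yC: "point y \<in> curve F" using y curve_iff_ev[OF F4] by blast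
    have y2: "sq y \<noteq> 0" "ev F (sq y) = 0" using y sq_nonzero by (simp_all add: ev_sq)
    then have y2C: "point (sq y) \<in> curve F" using curve_iff_ev[OF F4] by blast
    have m: "morphism_over (range to_ac) (curve F) (curve F) \<phi>" using \<phi> unfolding isomorphism_over_def by blast
    obtain e g d f where g: "form_over (range (to_ac :: bit \<Rightarrow> F2bar)) e g"
      and f: "\<And>i. form_over (range (to_ac :: bit \<Rightarrow> F2bar)) d (f i)" and gy: "eval g y \<noteq> 0"
      and fv: "\<And>v. v \<noteq> 0 \<Longrightarrow> point v \<in> curve F \<Longrightarrow> eval g v \<noteq> 0 \<Longrightarrow>
        (\<chi> i. eval (f i) v) \<noteq> 0 \<and> \<phi> (point v) = point (\<chi> i. eval (f i) v)"
      by (rule morphism_chart[OF m y(1) yC]) (rule that)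
    define w where "w = (\<chi> i. eval (f i) y)"
    have "(\<chi> i. eval (f i) (sq y)) = sq w" by (simp add: vec_eq_iff w_def eval_sq[OF f])
    moreover have "eval g (sq y) \<noteq> 0" using gy by (simp add: eval_sq[OF g])
    ultimately have w2: "sq w \<noteq> 0" "\<phi> (point (sq y)) = point (sq w)" using fv[OF y2(1) y2C] by auto
    have w: "w \<noteq> 0" "\<phi> (point y) = point w" using fv[OF y(1) yC gy] by (simp_all add: w_def)
    have nz: "H *v y \<noteq> 0" "H *v sq y \<noteq> 0" using y(1) y2(1) H0 by blast+
    have "point (H *v y) = point w" using N(3)[rule_format, OF y] w(2) by (simp only: Hv)
    then obtain c where c: "w = c *s (H *v y)" using point_eq_iff[OF nz(1) w(1)] by blast
    have "point (sq w) = point (H *v sq y)" using N(3)[rule_format, OF y2] w2(2) by (simp only: Hv)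
    then obtain d where d: "H *v sq y = d *s sq w" using point_eq_iff[OF w2(1) nz(2)] by blast
    have "sq w = c\<^sup>2 *s (frob H *v sq y)" by (simp only: c vpow_scale sq_mult)
    then show ?thesis unfolding d by (simp add: cross_scale del: cross_component)
  qed
  have "\<exists>c. \<forall>v. (frob H ** A) *v v = c *s ((H ** A) *v v)"
  proof (rule proportional_on_D)
    show "invertible (H ** A)" by (intro invertible_mult H invertible_A)
    fix u assume u: "on_D u"
    obtain y where y: "sq y = A *v u" using sq_surj[of "A *v u"] by blast
    have "A *v u \<noteq> 0" using u by (simp add: on_D_def)
    then have "y \<noteq> 0" unfolding y[symmetric] by auto
    moreover have "(ev F y)\<^sup>2 = 0" using u unfolding ev_sq[symmetric] y by (simp add: ev_F on_D_def)
    ultimately show "cross ((H ** A) *v u) ((frob H ** A) *v u) = 0"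
      using cr[of y] y by (simp add: matrix_vector_mul_assoc del: cross_component)
  qed
  then obtain c where c: "\<And>v. (frob H ** A) *v v = c *s ((H ** A) *v v)" by blast
  have "frob H *v v = c *s (H *v v)" for v
    using c[of "B *v v"] by (simp only: matrix_vector_mul_assoc[symmetric] A_B)
  then obtain k Q where Q: "k \<noteq> 0" "Q \<in> PSL32" "\<forall>v. H *v v = k *s (mat_ac Q *v v)"
    using frob_proportional[OF H] by blast
  have Q0: "mat_ac Q *v v = 0 \<longleftrightarrow> v = 0" for v by (rule mat_ac_eq_0[OF Q(2)])
  have "Q ** P = P ** Q"
  proof (rule preserves_curve_imp_centralizer[OF Q(2)])
    fix v :: "F2bar^3" assume v: "v \<noteq> 0"
    have nz: "mat_ac Q *v v \<noteq> 0" using v Q0 by blast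
    have "N *v v = B *v (H *v v)" by (simp only: Hv[symmetric] B_A)
    then have "N *v v = k *s (B *v (mat_ac Q *v v))" by (simp only: Q(3)[rule_format] vector_scalar_commute)
    then show "point v \<in> curve F \<longleftrightarrow> point (mat_ac Q *v v) \<in> curve F"
      using N(2)[rule_format, OF v] on_D_scale[OF Q(1)] curve_iff_ev[OF F4 v] curve_iff[OF nz] by simp
  qed
  moreover have "\<phi> (point v) = point (mat_ac Q *v v)" if v: "v \<noteq> 0" "point v \<in> curve F" for v
  proof -
    have nz: "mat_ac Q *v v \<noteq> 0" "H *v v \<noteq> 0" using v(1) Q0 H0 by blast+
    have "\<phi> (point v) = point (H *v v)" using N(3)[rule_format, OF v(1)] v curve_iff_ev[OF F4 v(1)] by (simp add: Hv)
    also have "\<dots> = point (mat_ac Q *v v)" using point_eq_iff[OF nz] Q(3) by metis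
    finally show ?thesis .
  qed
  ultimately show ?thesis using Q(2) by blast
qed

text \<open>Injectivity holds because the map on the curve fixes the matrix up to a scalar
  (\<open>proportional_on_D\<close>), and a scalar between two matrices of \<open>PSL32\<close> is
  1.\<close>

theorem rational_automorphisms_centralizer:
  "bij_betw (\<lambda>Q. restrict (proj_map (mat_ac Q)) (curve F)) {Q \<in> PSL32. Q ** P = P ** Q}
     (rational_automorphisms (curve F))"
  unfolding bij_betw_def
proof (intro conjI equalityI subsetI inj_onI)
  have inv: "Q \<in> PSL32 \<Longrightarrow> invertible (mat_ac Q)" for Q by (simp add: PSL32_def invertible_mat_ac)
  fix Q1 Q2
  assume Q1: "Q1 \<in> {Q \<in> PSL32. Q ** P = P ** Q}" and Q2: "Q2 \<in> {Q \<in> PSL32. Q ** P = P ** Q}"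
    and eq: "restrict (proj_map (mat_ac Q1)) (curve F) = restrict (proj_map (mat_ac Q2)) (curve F)"
  have "\<exists>c. \<forall>v. (mat_ac Q2 ** A) *v v = c *s ((mat_ac Q1 ** A) *v v)"
  proof (rule proportional_on_D)
    show "invertible (mat_ac Q1 ** A)" using Q1 inv by (intro invertible_mult invertible_A) auto
    fix u assume u: "on_D u"
    have v: "A *v u \<noteq> 0" "point (A *v u) \<in> curve F" using u curve_iff[of "A *v u"] by (auto simp: on_D_def)
    have "proj_map (mat_ac Q1) (point (A *v u)) = proj_map (mat_ac Q2) (point (A *v u))"
      using fun_cong[OF eq, of "point (A *v u)"] v(2) by simp
    then have p: "point (mat_ac Q1 *v (A *v u)) = point (mat_ac Q2 *v (A *v u))"
      using Q1 Q2 inv by (simp add: proj_map_point[OF _ v(1)])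
    have nz: "mat_ac Q1 *v (A *v u) \<noteq> 0" "mat_ac Q2 *v (A *v u) \<noteq> 0"
      using v(1) Q1 Q2 mat_ac_eq_0 by blast+
    then have "cross (mat_ac Q1 *v (A *v u)) (mat_ac Q2 *v (A *v u)) = 0"
      using p point_eq_iff[OF nz] cross_eq_0_iff[OF nz(1)] by blast
    then show "cross ((mat_ac Q1 ** A) *v u) ((mat_ac Q2 ** A) *v u) = 0" by (simp only: matrix_vector_mul_assoc)
  qed
  then obtain c where c: "\<And>v. (mat_ac Q2 ** A) *v v = c *s ((mat_ac Q1 ** A) *v v)" by blast
  have "mat_ac Q2 *v v = c *s (mat_ac Q1 *v v)" for v
    using c[of "B *v v"] by (simp only: matrix_vector_mul_assoc[symmetric] A_B)
  then have "Q2 = Q1" using scalar_multiple_imp_eq[of Q1 Q2 c] Q1 Q2 by blast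
  then show "Q1 = Q2" by simp
next
  fix \<phi> assume "\<phi> \<in> (\<lambda>Q. restrict (proj_map (mat_ac Q)) (curve F)) ` {Q \<in> PSL32. Q ** P = P ** Q}"
  then obtain Q where Q: "Q \<in> PSL32" "Q ** P = P ** Q" and \<phi>: "\<phi> = restrict (proj_map (mat_ac Q)) (curve F)" by blast
  obtain Q' where Q': "Q' \<in> PSL32" "Q ** Q' = mat 1" "Q' ** Q = mat 1" using PSL32_obtain_inverse[OF Q(1)] .
  have inv: "invertible (mat_ac Q)" using Q(1) by (simp add: PSL32_def invertible_mat_ac)
  have "isomorphism_over (range to_ac) (curve F) (curve F) \<phi>"
  proof (rule isomorphism_over_linear[OF range_to_ac])
    show "mat_ac Q ** mat_ac Q' = mat 1" "mat_ac Q' ** mat_ac Q = mat 1"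
      by (simp_all only: mat_ac_mult[symmetric] Q' mat_ac_one)
  qed (simp_all add: mat_ac_component \<phi> proj_map_point[OF inv] centralizer_preserves_curve[OF Q, symmetric])
  then show "\<phi> \<in> rational_automorphisms (curve F)" unfolding rational_automorphisms_def by (simp add: \<phi>)
next
  fix \<phi> assume "\<phi> \<in> rational_automorphisms (curve F)"
  then have ext: "\<phi> \<in> extensional (curve F)" and iso: "isomorphism_over (range to_ac) (curve F) (curve F) \<phi>"
    unfolding rational_automorphisms_def by blast+
  obtain Q where Q: "Q \<in> PSL32" "Q ** P = P ** Q"
    and Qv: "\<forall>v. v \<noteq> 0 \<longrightarrow> point v \<in> curve F \<longrightarrow> \<phi> (point v) = point (mat_ac Q *v v)"
    using rational_automorphism_linear[OF iso] by blast
  have inv: "invertible (mat_ac Q)" using Q(1) by (simp add: PSL32_def invertible_mat_ac)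
  have "\<phi> = restrict (proj_map (mat_ac Q)) (curve F)"
  proof (rule extensionalityI[OF ext])
    fix p assume p: "p \<in> curve F"
    obtain v where v: "v \<noteq> 0" "p = point v" by (rule point_cases)
    show "\<phi> p = restrict (proj_map (mat_ac Q)) (curve F) p"
      using Qv p v by (simp add: proj_map_point[OF inv])
  qed simp
  then show "\<phi> \<in> (\<lambda>Q. restrict (proj_map (mat_ac Q)) (curve F)) ` {Q \<in> PSL32. Q ** P = P ** Q}"
    using Q by blast
qed

end

theorem theorem1:
  fixes F :: "bit mpoly3" and C :: "F2bar proj2 set"
  assumes "F \<noteq> 0" and "homogeneous 4 F" and "C = curve F"
  shows "(isomorphic_curves C (curve I4) \<longleftrightarrow> (\<exists>P\<in>PSL32. C = curve (quotient_form P))) \<and>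
    (\<forall>P\<in>PSL32. C = curve (quotient_form P) \<longrightarrow>
       bij_betw (\<lambda>A. restrict (proj_map (mat_ac A)) C)
         {A \<in> PSL32. A ** P = P ** A} (rational_automorphisms C) \<and>
       (\<forall>R. frobenius_matrix F R \<longleftrightarrow> R = transpose P) \<and>
       (\<forall>v. v \<noteq> 0 \<and> point v \<in> C \<longrightarrow> tangent_divisor (extend_scalars F) v (power_divisor P v)) \<and>
       (\<forall>Q\<in>PSL32.
          (\<exists>S. finite S \<and> (\<forall>v. v \<noteq> 0 \<and> point v \<in> C - S \<longrightarrow>
             tangent_divisor (extend_scalars F) v (power_divisor Q v))) \<longrightarrow> Q = P))"
proof (intro conjI ballI impI)
  show "isomorphic_curves C (curve I4) \<longleftrightarrow> (\<exists>P\<in>PSL32. C = curve (quotient_form P))"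
  proof
    assume "isomorphic_curves C (curve I4)"
    then show "\<exists>P\<in>PSL32. C = curve (quotient_form P)"
      unfolding assms(3) by (rule isomorphic_imp_quotient[OF assms(1,2)])
  next
    assume "\<exists>P\<in>PSL32. C = curve (quotient_form P)"
    then obtain P where P: "P \<in> PSL32" "C = curve (quotient_form P)" by blast
    obtain A B where "twist P A B" using lang[OF P(1)] by (elim exE)
    then show "isomorphic_curves C (curve I4)" unfolding P(2) by (rule twist.isomorphic_quotient)
  qed
next
  fix P assume P: "P \<in> PSL32" and C: "C = curve (quotient_form P)"
  obtain A B where AB: "twist P A B" using lang[OF P] by (elim exE)
  then interpret twist P A B .
  have CF: "curve F = curve (quotient_form P)" using assms(3) C by simp
  interpret twisted_quartic P A B F
    by unfold_locales (rule assms(2), rule ev_unique[OF assms(1,2) CF])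
  show "bij_betw (\<lambda>A. restrict (proj_map (mat_ac A)) C)
      {A \<in> PSL32. A ** P = P ** A} (rational_automorphisms C)"
    unfolding assms(3) by (rule rational_automorphisms_centralizer)
  show "\<forall>R. frobenius_matrix F R \<longleftrightarrow> R = transpose P" using frobenius_matrix_iff by simp
  show "\<forall>v. v \<noteq> 0 \<and> point v \<in> C \<longrightarrow> tangent_divisor (extend_scalars F) v (power_divisor P v)"
    unfolding assms(3) using tangent_divisor_power by simp
  fix Q
  assume Q: "Q \<in> PSL32" and "\<exists>S. finite S \<and> (\<forall>v. v \<noteq> 0 \<and> point v \<in> C - S \<longrightarrow>
      tangent_divisor (extend_scalars F) v (power_divisor Q v))"
  then obtain S where "finite S" and "\<And>v. v \<noteq> 0 \<Longrightarrow> point v \<in> curve F - S \<Longrightarrow>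
      tangent_divisor (extend_scalars F) v (power_divisor Q v)" unfolding assms(3) by blast
  then show "Q = P" by (rule tangents_determine_matrix[OF Q])
qed

end
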